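(* Under the standing assumptions of the context, let $\mathbb{E}=L_2(\Omega)\times L_2^1(\Omega)$ and for $y=(v_0,\tau_0)\in\mathbb{E}$ let $S_t(y)=(v(t),\tau(t))$, where $(v,\tau)$ is the unique weak solution of problem (P) with $v(0)=v_0$, $\tau(0)=\tau_0$. Then $\{S_t\}_{t\ge0}$ is a dissipative semiflow on $\mathbb{E}$; that is: $S_0=I$, $S_t\circ S_s=S_{t+s}$ for all $t,s\ge0$; the map $(t,y)\mapsto S_t(y)$ is continuous from $[0,\infty)\times\mathbb{E}$ to $\mathbb{E}$; and there is a bounded set $P\subset\mathbb{E}$ such that for every bounded $B\subset\mathbb{E}$ there is $h\ge0$ with $S_tB\subset P$ for all $t\ge h$.
   Context: Standing assumptions. $\Omega\subset\mathbb{R}^n$ ($n\ge1$) is a bounded open set. $\Delta:H^1_0(\Omega)\to H^{-1}(\Omega)$ denotes the (Dirichlet) Laplacian, which is an isomorphism. Set $X(\Omega)=\Delta^{-1}(H^1_0(\Omega))$ and assume $X(\Omega)\subset W^1_{p_0}(\Omega)$ for some $p_0>2$. $D,E,\mu,\nu$ are positive constants. $\beta_0:\mathbb{R}^2\to\mathbb{R}$ is $C^2$, satisfies $\beta_G\le\beta_0(u,\sigma)\le\beta_R$ for constants $\beta_R\ge\beta_G>0$, and $\beta_0(u,\sigma)=\beta_\infty$ (a constant, $\beta_\infty\ge\beta_G$) whenever $|u|+|\sigma|$ is large enough. $\varphi,\phi:\overline{\Omega}\to\mathbb{R}$ are $C^2$ functions satisfying $\beta_0(\varphi(x),\phi(x))\phi(x)=\mu\varphi(x)$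 for $x\in\partial\Omega$. Define $\beta(x,v,\varpi)=\beta_0(v+\varphi(x),\varpi+\phi(x))$, $h(x)=D\Delta\varphi(x)+E\Delta\phi(x)$, $g(x,v,\varpi)=\mu\varphi(x)-\beta_0(v+\varphi(x),\varpi+\phi(x))\phi(x)$, $d=D+\nu E$, and $\gamma(x,v,\tau)=\mu v-\beta(x,v,\tau+\nu v)\tau-\nu\beta(x,v,\tau+\nu v)v+g(x,v,\tau+\nu v)$. Problem (P): $\partial_t v=d\Delta v+E\Delta\tau+h$, $\partial_t\tau=\gamma(x,v,\tau)$ in $(0,\infty)\times\Omega$, $v=\tau=0$ on $\partial\Omega$. Function spaces: $W(\Omega,T)=\{u\in L_2(0,T;H^1_0(\Omega)): u'\in L_2(0,T;H^{-1}(\Omega))\}$ (it embeds in $C([0,T];L_2(\Omega))$); $W_{loc}(\Omega,+\infty)=\{u\in C([0,\infty);L_2(\Omega)): u|_{[0,T]}\in W(\Omega,T)\ \forall T>0\}$; $H^1_{loc}(0,+\infty;H^1_0(\Omega))=\{u\in C([0,\infty);H^1_0(\Omega)): u|_{[0,T]}\in H^1(0,T;H^1_0(\Omega))\ \forall T>0\}$. A weak solution of (P) is a pair $(v,\tau)$ with $v\in W_{loc}(\Omega,+\infty)$, $\tau\in H^1_{loc}(0,+\infty;H^1_0(\Omega))$, such that the first equation holds in $H^{-1}(\Omega)$ for a.a. $t>0$ and the second equation holds in $H^1(\Omega)$ for a.a. $t>0$. For each $v_0\in L_2(\Omega)$, $\tau_0\in H^1_0(\Omega)$ such a solution with $v(0)=v_0,\tau(0)=\tau_0$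 exists and is unique. $L_2^1(\Omega)$ denotes the set $H^1_0(\Omega)$ equipped with the topology (metric) of $L_2(\Omega)$; $\mathbb{E}$ carries the product $L_2\times L_2$ metric. *)

theory Defs
  imports "HOL-Analysis.Analysis"
begin

text \<open>Functions on \<Omega> are represented by their (a.e.-defined) representatives
  'a \<Rightarrow> real; equality in L2 is expressed by zero L2-distance.\<close>

definition L2 :: "'a::euclidean_space set \<Rightarrow> ('a \<Rightarrow> real) \<Rightarrow> bool" where
  "L2 \<Omega> u \<longleftrightarrow> u \<in> borel_measurable (lebesgue_on \<Omega>) \<and>
      integrable (lebesgue_on \<Omega>) (\<lambda>x. (u x)^2)"

definition Lp :: "real \<Rightarrow> 'a::euclidean_space set \<Rightarrow> ('a \<Rightarrow> real) \<Rightarrow> bool" where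
  "Lp p \<Omega> u \<longleftrightarrow> u \<in> borel_measurable (lebesgue_on \<Omega>) \<and>
      integrable (lebesgue_on \<Omega>) (\<lambda>x. \<bar>u x\<bar> powr p)"

definition L2_norm :: "'a::euclidean_space set \<Rightarrow> ('a \<Rightarrow> real) \<Rightarrow> real" where
  "L2_norm \<Omega> u = sqrt (\<integral>x. (u x)^2 \<partial>lebesgue_on \<Omega>)"

definition L2_dist :: "'a::euclidean_space set \<Rightarrow> ('a \<Rightarrow> real) \<Rightarrow> ('a \<Rightarrow> real) \<Rightarrow> real" where
  "L2_dist \<Omega> u w = L2_norm \<Omega> (\<lambda>x. u x - w x)"

definition L2v_norm :: "'a::euclidean_space set \<Rightarrow> ('a \<Rightarrow> 'a) \<Rightarrow> real" where
  "L2v_norm \<Omega> g = sqrt (\<integral>x. (norm (g x))^2 \<partial>lebesgue_on \<Omega>)"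

definition L2_inner :: "'a::euclidean_space set \<Rightarrow> ('a \<Rightarrow> real) \<Rightarrow> ('a \<Rightarrow> real) \<Rightarrow> real" where
  "L2_inner \<Omega> u w = (\<integral>x. u x * w x \<partial>lebesgue_on \<Omega>)"

definition test_pair :: "'a::euclidean_space set \<Rightarrow> ('a \<Rightarrow> real) \<Rightarrow> ('a \<Rightarrow> 'a) \<Rightarrow> bool" where
  "test_pair \<Omega> \<phi> G \<longleftrightarrow> (\<forall>x. (\<phi> has_derivative (\<lambda>h. G x \<bullet> h)) (at x)) \<and>
      continuous_on UNIV G \<and> (\<exists>K. compact K \<and> K \<subseteq> \<Omega> \<and> (\<forall>x. x \<notin> K \<longrightarrow> \<phi> x = 0))"

definition weak_grad :: "'a::euclidean_space set \<Rightarrow> ('a \<Rightarrow> real) \<Rightarrow> ('a \<Rightarrow> 'a) \<Rightarrow> bool" where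
  "weak_grad \<Omega> u g \<longleftrightarrow> (\<forall>\<phi> G. test_pair \<Omega> \<phi> G \<longrightarrow> (\<forall>b\<in>Basis.
      (\<integral>x. u x * (G x \<bullet> b) \<partial>lebesgue_on \<Omega>) = - (\<integral>x. (g x \<bullet> b) * \<phi> x \<partial>lebesgue_on \<Omega>)))"

definition H1 :: "'a::euclidean_space set \<Rightarrow> ('a \<Rightarrow> real) \<Rightarrow> ('a \<Rightarrow> 'a) \<Rightarrow> bool" where
  "H1 \<Omega> u g \<longleftrightarrow> L2 \<Omega> u \<and> (\<forall>b\<in>Basis. L2 \<Omega> (\<lambda>x. g x \<bullet> b)) \<and> weak_grad \<Omega> u g"

definition H10 :: "'a::euclidean_space set \<Rightarrow> ('a \<Rightarrow> real) \<Rightarrow> bool" where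
  "H10 \<Omega> u \<longleftrightarrow> (\<exists>g. H1 \<Omega> u g \<and> (\<exists>\<phi>s Gs. (\<forall>k::nat. test_pair \<Omega> (\<phi>s k) (Gs k)) \<and>
      (\<lambda>k. L2_dist \<Omega> (\<phi>s k) u + L2v_norm \<Omega> (\<lambda>x. Gs k x - g x)) \<longlonglongrightarrow> 0))"

definition grad :: "'a::euclidean_space set \<Rightarrow> ('a \<Rightarrow> real) \<Rightarrow> ('a \<Rightarrow> 'a)" where
  "grad \<Omega> u = (SOME g. H1 \<Omega> u g)"

definition H1_norm :: "'a::euclidean_space set \<Rightarrow> ('a \<Rightarrow> real) \<Rightarrow> real" where
  "H1_norm \<Omega> u = sqrt ((L2_norm \<Omega> u)^2 + (L2v_norm \<Omega> (grad \<Omega> u))^2)"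

text \<open>Dirichlet form: (Delta u)(w) = - Dir u w for u, w in H^1_0.\<close>
definition Dir :: "'a::euclidean_space set \<Rightarrow> ('a \<Rightarrow> real) \<Rightarrow> ('a \<Rightarrow> real) \<Rightarrow> real" where
  "Dir \<Omega> u w = (\<integral>x. grad \<Omega> u x \<bullet> grad \<Omega> w x \<partial>lebesgue_on \<Omega>)"

definition W1p :: "real \<Rightarrow> 'a::euclidean_space set \<Rightarrow> ('a \<Rightarrow> real) \<Rightarrow> bool" where
  "W1p p \<Omega> u \<longleftrightarrow> Lp p \<Omega> u \<and> (\<exists>g. weak_grad \<Omega> u g \<and> (\<forall>b\<in>Basis. Lp p \<Omega> (\<lambda>x. g x \<bullet> b)))"

text \<open>X(\<Omega>) = Delta^{-1}(H^1_0(\<Omega>)) is contained in W^1_p(\<Omega>).\<close>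
definition X_sub_W1p :: "real \<Rightarrow> 'a::euclidean_space set \<Rightarrow> bool" where
  "X_sub_W1p p \<Omega> \<longleftrightarrow> (\<forall>u f. H10 \<Omega> u \<and> H10 \<Omega> f \<and>
      (\<forall>w. H10 \<Omega> w \<longrightarrow> - Dir \<Omega> u w = L2_inner \<Omega> f w) \<longrightarrow> W1p p \<Omega> u)"

definition C2_on_closure :: "'a::euclidean_space set \<Rightarrow> ('a \<Rightarrow> real) \<Rightarrow> bool" where
  "C2_on_closure S f \<longleftrightarrow> (\<exists>G H. (\<forall>x\<in>S. (f has_derivative (\<lambda>h. G x \<bullet> h)) (at x)) \<and>
      (\<forall>b\<in>Basis. \<forall>x\<in>S. ((\<lambda>y. G y \<bullet> b) has_derivative (\<lambda>h. H b x \<bullet> h)) (at x)) \<and>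
      continuous_on (closure S) f \<and> continuous_on (closure S) G \<and>
      (\<forall>b\<in>Basis. continuous_on (closure S) (H b)))"

definition lap :: "('a::euclidean_space \<Rightarrow> real) \<Rightarrow> 'a \<Rightarrow> real" where
  "lap f x = (\<Sum>b\<in>Basis. frechet_derivative (\<lambda>y. frechet_derivative f (at y) b) (at x) b)"

definition beta :: "(real \<Rightarrow> real \<Rightarrow> real) \<Rightarrow> ('a \<Rightarrow> real) \<Rightarrow> ('a \<Rightarrow> real) \<Rightarrow> 'a \<Rightarrow> real \<Rightarrow> real \<Rightarrow> real" where
  "beta \<beta>0 \<phi> \<psi> x v w = \<beta>0 (v + \<phi> x) (w + \<psi> x)"

definition gfun :: "(real \<Rightarrow> real \<Rightarrow> real) \<Rightarrow> real \<Rightarrow> ('a \<Rightarrow> real) \<Rightarrow> ('a \<Rightarrow> real) \<Rightarrow> 'a \<Rightarrow> real \<Rightarrow> real \<Rightarrow> real" where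
  "gfun \<beta>0 \<mu> \<phi> \<psi> x v w = \<mu> * \<phi> x - \<beta>0 (v + \<phi> x) (w + \<psi> x) * \<psi> x"

definition gamma :: "(real \<Rightarrow> real \<Rightarrow> real) \<Rightarrow> real \<Rightarrow> real \<Rightarrow> ('a \<Rightarrow> real) \<Rightarrow> ('a \<Rightarrow> real) \<Rightarrow> 'a \<Rightarrow> real \<Rightarrow> real \<Rightarrow> real" where
  "gamma \<beta>0 \<mu> \<nu> \<phi> \<psi> x v \<tau> =
     \<mu> * v - beta \<beta>0 \<phi> \<psi> x v (\<tau> + \<nu> * v) * \<tau> - \<nu> * beta \<beta>0 \<phi> \<psi> x v (\<tau> + \<nu> * v) * v
       + gfun \<beta>0 \<mu> \<phi> \<psi> x v (\<tau> + \<nu> * v)"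

definition hfun :: "real \<Rightarrow> real \<Rightarrow> ('a::euclidean_space \<Rightarrow> real) \<Rightarrow> ('a \<Rightarrow> real) \<Rightarrow> 'a \<Rightarrow> real" where
  "hfun D Ec \<phi> \<psi> x = D * lap \<phi> x + Ec * lap \<psi> x"

text \<open>u \<in> L_2(0,T; H^1_0(\<Omega>)) (strong measurability expressed as weak measurability
  via Pettis, H^1_0 being separable).\<close>
definition L2H10 :: "'a::euclidean_space set \<Rightarrow> real \<Rightarrow> (real \<Rightarrow> 'a \<Rightarrow> real) \<Rightarrow> bool" where
  "L2H10 \<Omega> T u \<longleftrightarrow> (AE t in lebesgue_on {0..T}. H10 \<Omega> (u t)) \<and>
     (\<forall>w. H10 \<Omega> w \<longrightarrow> (\<lambda>t. L2_inner \<Omega> (u t) w) \<in> borel_measurable (lebesgue_on {0..T}) \<and>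
                        (\<lambda>t. Dir \<Omega> (u t) w) \<in> borel_measurable (lebesgue_on {0..T})) \<and>
     integrable (lebesgue_on {0..T}) (\<lambda>t. (H1_norm \<Omega> (u t))^2)"

text \<open>Weak solution of (P) on (0,\<infinity>): v \<in> W_loc, \<tau> \<in> H^1_loc(0,\<infinity>;H^1_0), the first equation
  in H^{-1} and the second in H^1 for a.a. t (expressed in integrated form).\<close>
definition weak_solution ::
  "'a::euclidean_space set \<Rightarrow> real \<Rightarrow> real \<Rightarrow> real \<Rightarrow> real \<Rightarrow> (real \<Rightarrow> real \<Rightarrow> real) \<Rightarrow>
   ('a \<Rightarrow> real) \<Rightarrow> ('a \<Rightarrow> real) \<Rightarrow> (real \<Rightarrow> 'a \<Rightarrow> real) \<Rightarrow> (real \<Rightarrow> 'a \<Rightarrow> real) \<Rightarrow> bool" where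
  "weak_solution \<Omega> D Ec \<mu> \<nu> \<beta>0 \<phi> \<psi> v \<tau> \<longleftrightarrow>
     (\<forall>t\<ge>0. L2 \<Omega> (v t)) \<and>
     (\<forall>t\<ge>0. ((\<lambda>s. L2_dist \<Omega> (v s) (v t)) \<longlongrightarrow> 0) (at t within {0..})) \<and>
     (\<forall>t\<ge>0. H10 \<Omega> (\<tau> t)) \<and>
     (\<forall>t\<ge>0. ((\<lambda>s. H1_norm \<Omega> (\<lambda>x. \<tau> s x - \<tau> t x)) \<longlongrightarrow> 0) (at t within {0..})) \<and>
     (\<forall>T>0. L2H10 \<Omega> T v \<and>
            L2H10 \<Omega> T (\<lambda>t x. gamma \<beta>0 \<mu> \<nu> \<phi> \<psi> x (v t x) (\<tau> t x))) \<and>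
     (\<forall>w. H10 \<Omega> w \<longrightarrow> (\<forall>s t. 0 \<le> s \<and> s \<le> t \<longrightarrow>
        L2_inner \<Omega> (v t) w - L2_inner \<Omega> (v s) w =
          (\<integral>r. (- (D + \<nu> * Ec) * Dir \<Omega> (v r) w - Ec * Dir \<Omega> (\<tau> r) w
                  + L2_inner \<Omega> (hfun D Ec \<phi> \<psi>) w) \<partial>lebesgue_on {s..t}) \<and>
        L2_inner \<Omega> (\<tau> t) w - L2_inner \<Omega> (\<tau> s) w =
          (\<integral>r. L2_inner \<Omega> (\<lambda>x. gamma \<beta>0 \<mu> \<nu> \<phi> \<psi> x (v r x) (\<tau> r x)) w \<partial>lebesgue_on {s..t})))"

text \<open>The phase space E = L_2 \<times> L_2^1 (second component in H^1_0, L2 metric).\<close>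
definition inE :: "'a::euclidean_space set \<Rightarrow> ('a \<Rightarrow> real) \<times> ('a \<Rightarrow> real) \<Rightarrow> bool" where
  "inE \<Omega> y \<longleftrightarrow> L2 \<Omega> (fst y) \<and> H10 \<Omega> (snd y)"

definition E_dist :: "'a::euclidean_space set \<Rightarrow> ('a \<Rightarrow> real) \<times> ('a \<Rightarrow> real) \<Rightarrow> ('a \<Rightarrow> real) \<times> ('a \<Rightarrow> real) \<Rightarrow> real" where
  "E_dist \<Omega> y z = sqrt ((L2_dist \<Omega> (fst y) (fst z))^2 + (L2_dist \<Omega> (snd y) (snd z))^2)"

definition E_bounded :: "'a::euclidean_space set \<Rightarrow> (('a \<Rightarrow> real) \<times> ('a \<Rightarrow> real)) set \<Rightarrow> bool" where
  "E_bounded \<Omega> B \<longleftrightarrow> (\<exists>R. \<forall>y\<in>B. E_dist \<Omega> y (\<lambda>x. 0, \<lambda>x. 0) \<le> R)"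

end

theory Submission
  imports Defs "HOL-Library.Function_Algebras"
begin

text \<open>
  With \<open>d = D + \<nu> E\<close>, the substitution \<open>z = v + (E/d) \<tau>\<close> turns the system into \<open>z' = d \<Delta>z + h + (E/d) \<gamma>\<close>,
  \<open>\<tau>' = \<gamma>\<close>, where \<open>\<gamma>\<close> is globally Lipschitz in \<open>(v, \<tau>)\<close>. Testing with \<open>z\<close> and \<open>\<tau>\<close> therefore only involves
  \<open>L\<^sub>2\<close> norms and gives Lipschitz dependence on the initial data in \<open>L\<^sub>2 \<times> L\<^sub>2\<close>, hence continuity and
  the semigroup law. Up to a bounded remainder \<open>\<gamma> = a v - b \<tau>\<close> with \<open>b = \<beta>\<^sub>\<infinity>\<close> and \<open>a = \<mu> - \<nu> b\<close>. If
  \<open>a \<le> 0\<close>, a combination of \<open>\<parallel>z\<parallel>\<^sup>2\<close> and \<open>\<parallel>\<tau>\<parallel>\<^sup>2\<close> is a Lyapunov function; if \<open>a > 0\<close>, one uses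
  \<open>a \<parallel>v\<parallel>\<^sup>2 + E \<parallel>\<tau>\<parallel>\<^sup>2\<close> with \<open>v\<close> measured in \<open>H\<^sup>-\<^sup>1\<close>, plus a small multiple of \<open>\<parallel>z\<parallel>\<^sup>2\<close>.

  The energy inequality for \<open>z\<close>, which takes values in \<open>H\<^sup>1\<^sub>0\<close> only for almost all times, is obtained from the
  resolvent-smoothed functionals \<open>sup {2 (z, w) - \<parallel>w\<parallel>\<^sup>2 - \<epsilon> \<parallel>\<nabla>w\<parallel>\<^sup>2}\<close>, \<open>w\<close> in \<open>H\<^sup>1\<^sub>0\<close>, by letting \<open>\<epsilon> \<rightarrow> 0\<close>.
  Near maximisers of such suprema make completeness of \<open>H\<^sup>1\<^sub>0\<close> unnecessary.
\<close>

section \<open>Integral inequalities\<close>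

lemma quadratic_nonneg_discriminant:
  fixes a b c :: real
  assumes "\<And>s. a + 2 * b * s + c * s\<^sup>2 \<ge> 0" and "c \<ge> 0"
  shows "b\<^sup>2 \<le> a * c"
proof (cases "c = 0")
  case True
  have "b = 0"
  proof (rule ccontr)
    assume "b \<noteq> 0"
    with assms(1)[of "- (a + 1) / (2 * b)"] True show False
      by (simp add: field_simps)
  qed
  then show ?thesis using True by simp
next
  case False
  then have "c > 0" using assms(2) by simp
  have "0 \<le> a + 2 * b * (- b / c) + c * (- b / c)\<^sup>2" by (rule assms(1))
  also have "\<dots> = a - b\<^sup>2 / c" using False by (simp add: power2_eq_square field_simps)
  finally show ?thesis using \<open>c > 0\<close> by (simp add: field_simps)
qed

lemma increment_le_of_local:
  fixes q :: "real \<Rightarrow> real"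
  assumes "a \<le> b" "\<delta> > 0"
    and loc: "\<And>s t. a \<le> s \<Longrightarrow> s \<le> t \<Longrightarrow> t \<le> b \<Longrightarrow> t - s < \<delta> \<Longrightarrow> q t - q s \<le> e * (t - s)"
  shows "q b - q a \<le> e * (b - a)"
proof -
  obtain n :: nat where n: "(b - a) / \<delta> < n" using reals_Archimedean2 by blast
  then have "real n > 0" using assms by (smt (verit) divide_nonneg_pos)
  then have step: "(b - a) / n < \<delta>" using n assms by (simp add: field_simps)
  define t where "t i = a + real i * ((b - a) / n)" for i
  have "q (t i) - q (t 0) \<le> e * (t i - t 0)" if "i \<le> n" for i
    using that
  proof (induction i)
    case (Suc i)
    have "t (Suc i) = t i + (b - a) / n" by (simp add: t_def distrib_right add_divide_distrib)
    moreover have "a \<le> t i" using assms by (simp add: t_def)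
    moreover have "t (Suc i) \<le> b"
    proof -
      have "real (Suc i) * ((b - a) / n) \<le> real n * ((b - a) / n)"
        using Suc.prems assms by (intro mult_right_mono) auto
      also have "\<dots> = b - a" using \<open>real n > 0\<close> by simp
      finally show ?thesis by (simp add: t_def)
    qed
    ultimately have "q (t (Suc i)) - q (t i) \<le> e * (t (Suc i) - t i)"
      using step assms by (intro loc) auto
    with Suc show ?case by (simp add: algebra_simps)
  qed simp
  from this[of n] show ?thesis using \<open>real n > 0\<close> by (simp add: t_def)
qed

lemma increment_nonpos_of_local:
  fixes q :: "real \<Rightarrow> real"
  assumes "a \<le> b"
    and loc: "\<And>e. e > 0 \<Longrightarrow> \<exists>\<delta>>0. \<forall>s t. a \<le> s \<and> s \<le> t \<and> t \<le> b \<and> t - s < \<delta> \<longrightarrow> q t - q s \<le> e * (t - s)"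
  shows "q b \<le> q a"
proof -
  have "q b - q a \<le> e * (b - a)" if "e > 0" for e
  proof -
    obtain \<delta> where "\<delta> > 0" "\<forall>s t. a \<le> s \<and> s \<le> t \<and> t \<le> b \<and> t - s < \<delta> \<longrightarrow> q t - q s \<le> e * (t - s)"
      using loc[OF \<open>e > 0\<close>] by blast
    then show ?thesis using assms(1) increment_le_of_local[of a b \<delta> q e] by blast
  qed
  note * = this
  have "q b - q a \<le> 0 + e" if "e > 0" for e
  proof -
    have "q b - q a \<le> e / (b - a + 1) * (b - a)"
      using that assms(1) by (intro *) auto
    also have "\<dots> \<le> e" using that assms(1) by (simp add: field_simps)
    finally show ?thesis by simp
  qed
  then have "q b - q a \<le> 0" by (rule field_le_epsilon)
  then show ?thesis by simp
qed

lemma increment_le_integral_diagonal: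
  fixes f :: "real \<Rightarrow> real" and K :: "real \<Rightarrow> real \<Rightarrow> real"
  assumes ab: "a \<le> b"
    and K: "continuous_on ({a..b} \<times> {a..b}) (\<lambda>x. K (fst x) (snd x))"
    and inc: "\<And>s t. a \<le> s \<Longrightarrow> s \<le> t \<Longrightarrow> t \<le> b \<Longrightarrow> f t - f s \<le> integral {s..t} (K t)"
  shows "f b - f a \<le> integral {a..b} (\<lambda>r. K r r)"
proof -
  have K1: "continuous_on {a..b} (K t)" if "t \<in> {a..b}" for t
    using continuous_on_compose2[OF K, of "{a..b}" "\<lambda>r. (t, r)"] that
    by (auto simp: continuous_on_Pair image_subset_iff)
  have Kd: "continuous_on {a..b} (\<lambda>r. K r r)"
    using continuous_on_compose2[OF K, of "{a..b}" "\<lambda>r. (r, r)"]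
    by (auto simp: continuous_on_Pair image_subset_iff)
  have uc: "uniformly_continuous_on ({a..b} \<times> {a..b}) (\<lambda>x. K (fst x) (snd x))"
    by (intro compact_uniformly_continuous K compact_Times) auto
  define q where "q x = f x - integral {a..x} (\<lambda>r. K r r)" for x
  have "q b \<le> q a"
  proof (rule increment_nonpos_of_local[OF ab])
    fix e :: real assume "e > 0"
    then obtain \<delta> where \<delta>: "\<delta> > 0"
      "\<And>x y. x \<in> {a..b} \<times> {a..b} \<Longrightarrow> y \<in> {a..b} \<times> {a..b} \<Longrightarrow> dist y x < \<delta> \<Longrightarrow>
         dist (K (fst y) (snd y)) (K (fst x) (snd x)) < e"
      using uc unfolding uniformly_continuous_on_def by metis
    have "q t - q s \<le> e * (t - s)" if st: "a \<le> s" "s \<le> t" "t \<le> b" "t - s < \<delta>" for s t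
    proof -
      have int: "(\<lambda>r. K r r) integrable_on {a..t}" "(\<lambda>r. K r r) integrable_on {s..t}"
          "K t integrable_on {s..t}"
        using st by (auto intro!: integrable_continuous_real continuous_on_subset[OF Kd]
            continuous_on_subset[OF K1[of t]])
      have "integral {a..t} (\<lambda>r. K r r) = integral {a..s} (\<lambda>r. K r r) + integral {s..t} (\<lambda>r. K r r)"
        using Henstock_Kurzweil_Integration.integral_combine[of a s t "\<lambda>r. K r r"] st int by simp
      moreover have "integral {s..t} (K t) \<le> integral {s..t} (\<lambda>r. K r r + e)"
      proof (rule integral_le)
        fix r assume "r \<in> {s..t}"
        then have "dist (K t r) (K r r) < e"
          using \<delta>(2)[of "(r, r)" "(t, r)"] st by (auto simp: dist_Pair_Pair dist_real_def)
        then show "K t r \<le> K r r + e" by (simp add: dist_real_def)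
      qed (use int in \<open>auto intro!: integrable_add integrable_const_ivl\<close>)
      moreover have "integral {s..t} (\<lambda>r. K r r + e) = integral {s..t} (\<lambda>r. K r r) + e * (t - s)"
        using int st by (subst Henstock_Kurzweil_Integration.integral_add) (auto intro: integrable_const_ivl)
      ultimately show ?thesis using inc[of s t] st by (simp add: q_def)
    qed
    then show "\<exists>\<delta>>0. \<forall>s t. a \<le> s \<and> s \<le> t \<and> t \<le> b \<and> t - s < \<delta> \<longrightarrow> q t - q s \<le> e * (t - s)"
      using \<delta>(1) by blast
  qed
  then show ?thesis by (simp add: q_def)
qed

lemma exp_remainder_local:
  fixes c :: real
  assumes "e > 0"
  shows "\<exists>\<delta>>0. \<forall>x. 0 \<le> x \<and> x < \<delta> \<longrightarrow> exp (c * x) - 1 - c * x \<le> e * x"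
proof -
  have "((\<lambda>x. exp (c * x)) has_real_derivative c) (at 0)"
    by (auto intro!: derivative_eq_intros)
  then have "((\<lambda>h. (exp (c * (0 + h)) - exp (c * 0)) / h) \<longlongrightarrow> c) (at 0)"
    by (simp only: DERIV_def)
  then obtain \<delta> where \<delta>: "\<delta> > 0"
    "\<And>h. h \<noteq> 0 \<Longrightarrow> \<bar>h\<bar> < \<delta> \<Longrightarrow> \<bar>(exp (c * h) - 1) / h - c\<bar> < e"
    using assms unfolding LIM_def by (auto simp: dist_real_def)
  have "exp (c * x) - 1 - c * x \<le> e * x" if "0 \<le> x" "x < \<delta>" for x
  proof (cases "x = 0")
    case False
    then have "x > 0" using that by simp
    have "(exp (c * x) - 1) / x - c < e" using \<delta>(2)[of x] \<open>x > 0\<close> that by auto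
    then have "((exp (c * x) - 1) / x - c) * x \<le> e * x" using \<open>x > 0\<close> by simp
    moreover have "((exp (c * x) - 1) / x - c) * x = exp (c * x) - 1 - c * x"
      using \<open>x > 0\<close> by (simp add: field_simps)
    ultimately show ?thesis by simp
  qed simp
  then show ?thesis using \<delta>(1) by blast
qed

text \<open>The usual proof differentiates \<open>q 0 + \<integral> G\<close> and needs \<open>c \<le> 0\<close>; for \<open>c > 0\<close> the increment bound has to be
  restarted at every intermediate time, as \<open>q\<close> (later a dual norm) is not known to be continuous.\<close>

lemma gronwall_integral:
  fixes q G :: "real \<Rightarrow> real"
  assumes inc: "\<And>s t. 0 \<le> s \<Longrightarrow> s \<le> t \<Longrightarrow> q t - q s \<le> integral {s..t} G"
    and G: "continuous_on {0..} G"
    and le: "\<And>t. t \<ge> 0 \<Longrightarrow> G t \<le> - c * q t"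
    and "T \<ge> 0"
  shows "q T \<le> exp (- c * T) * q 0"
proof -
  have GT: "continuous_on {0..T} G" using G by (rule continuous_on_subset) auto
  then have "compact (G ` {0..T})" by (intro compact_continuous_image) auto
  then obtain M where M: "\<And>t. t \<in> {0..T} \<Longrightarrow> \<bar>G t\<bar> \<le> M"
    using compact_imp_bounded[of "G ` {0..T}"] unfolding bounded_iff real_norm_def by blast
  have "M \<ge> 0" using M[of 0] \<open>T \<ge> 0\<close> by force
  have Gint: "G integrable_on {s..t}" if "0 \<le> s" "t \<le> T" for s t
    using that by (intro integrable_continuous_real continuous_on_subset[OF GT]) auto
  define Q where "Q = \<bar>q 0\<bar> + M * T"
  have "Q \<ge> 0" using \<open>M \<ge> 0\<close> \<open>T \<ge> 0\<close> by (simp add: Q_def)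
  have qQ: "q t \<le> Q" if "t \<in> {0..T}" for t
  proof -
    have "integral {0..t} G \<le> integral {0..t} (\<lambda>_. M)"
      using that M by (intro integral_le Gint) (auto, smt (verit) atLeastAtMost_iff)
    also have "\<dots> = M * t" using that by simp
    also have "\<dots> \<le> M * T" using that \<open>M \<ge> 0\<close> by (intro mult_left_mono) auto
    finally show ?thesis using inc[of 0 t] that by (simp add: Q_def)
  qed
  define X where "X = exp (\<bar>c\<bar> * T)"
  have "X > 0" by (simp add: X_def)
  have "exp (c * T) * q T \<le> exp (c * 0) * q 0"
  proof (rule increment_nonpos_of_local[OF \<open>T \<ge> 0\<close>, where q = "\<lambda>t. exp (c * t) * q t"])
    fix e :: real assume "e > 0"
    define e1 where "e1 = e / (2 * X)"
    define e2 where "e2 = e / (2 * X * (Q + 1))"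
    have "e1 > 0" "e2 > 0" using \<open>e > 0\<close> \<open>X > 0\<close> \<open>Q \<ge> 0\<close> by (auto simp: e1_def e2_def)
    have "uniformly_continuous_on {0..T} G" by (intro compact_uniformly_continuous GT) auto
    then obtain \<delta>1 where \<delta>1: "\<delta>1 > 0"
      "\<And>x y. x \<in> {0..T} \<Longrightarrow> y \<in> {0..T} \<Longrightarrow> dist y x < \<delta>1 \<Longrightarrow> dist (G y) (G x) < e1"
      using \<open>e1 > 0\<close> unfolding uniformly_continuous_on_def by metis
    obtain \<delta>2 where \<delta>2: "\<delta>2 > 0"
      "\<And>x. 0 \<le> x \<Longrightarrow> x < \<delta>2 \<Longrightarrow> exp (c * x) - 1 - c * x \<le> e2 * x"
      using exp_remainder_local[OF \<open>e2 > 0\<close>] by blast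
    have "exp (c * t) * q t - exp (c * s) * q s \<le> e * (t - s)"
      if st: "0 \<le> s" "s \<le> t" "t \<le> T" "t - s < min \<delta>1 \<delta>2" for s t
    proof -
      define x where "x = t - s"
      have x: "0 \<le> x" "x < \<delta>2" using st by (auto simp: x_def)
      have "integral {s..t} G \<le> integral {s..t} (\<lambda>_. G t + e1)"
      proof (rule integral_le)
        fix r assume "r \<in> {s..t}"
        then have "dist (G r) (G t) < e1" using \<delta>1(2)[of t r] st by (auto simp: dist_real_def)
        then show "G r \<le> G t + e1" by (simp add: dist_real_def)
      qed (use st in \<open>auto intro!: Gint\<close>)
      also have "\<dots> = (G t + e1) * x" using st by (simp add: x_def)
      also have "\<dots> \<le> (- c * q t + e1) * x"
        using le[of t] st x by (intro mult_right_mono) auto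
      finally have 1: "q t - q s \<le> (- c * q t + e1) * x" using inc[of s t] st by simp
      have ex: "exp (c * s) \<le> X"
      proof -
        have "c * s \<le> \<bar>c\<bar> * T" using st by (intro mult_mono) auto
        then show ?thesis by (simp add: X_def)
      qed
      have rem0: "0 \<le> exp (c * x) - 1 - c * x" using exp_ge_add_one_self[of "c * x"] by linarith
      have "exp (c * t) = exp (c * s) * exp (c * x)" by (simp add: x_def exp_add[symmetric] algebra_simps)
      then have "exp (c * t) * q t - exp (c * s) * q s
          = exp (c * s) * ((q t - q s) + (exp (c * x) - 1) * q t)"
        by (simp add: algebra_simps)
      also have "\<dots> \<le> exp (c * s) * ((- c * q t + e1) * x + (exp (c * x) - 1) * q t)"
        using 1 by simp
      also have "\<dots> = exp (c * s) * (e1 * x + (exp (c * x) - 1 - c * x) * q t)"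
        by (simp add: algebra_simps)
      also have "\<dots> \<le> exp (c * s) * (e1 * x + e2 * x * (Q + 1))"
      proof -
        have "(exp (c * x) - 1 - c * x) * q t \<le> (exp (c * x) - 1 - c * x) * (Q + 1)"
          using rem0 qQ[of t] st by (intro mult_left_mono) auto
        also have "\<dots> \<le> e2 * x * (Q + 1)"
          using \<delta>2(2)[OF x] \<open>Q \<ge> 0\<close> by (intro mult_right_mono) auto
        finally show ?thesis by simp
      qed
      also have "\<dots> \<le> X * (e1 * x + e2 * x * (Q + 1))"
        using ex x \<open>e1 > 0\<close> \<open>e2 > 0\<close> \<open>Q \<ge> 0\<close> by (intro mult_right_mono) auto
      also have "\<dots> = e * x"
      proof -
        have "X * (e1 * x) = e * x / 2" using \<open>X > 0\<close> by (simp add: e1_def)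
        moreover have "X * (e2 * x * (Q + 1)) = e * x / 2"
        proof -
          have "Q + 1 \<noteq> 0" using \<open>Q \<ge> 0\<close> by linarith
          then show ?thesis using \<open>X > 0\<close> by (simp add: e2_def)
        qed
        ultimately show ?thesis unfolding distrib_left[of X "e1 * x"] by linarith
      qed
      finally show ?thesis by (simp add: x_def)
    qed
    then show "\<exists>\<delta>>0. \<forall>s t. 0 \<le> s \<and> s \<le> t \<and> t \<le> T \<and> t - s < \<delta> \<longrightarrow>
        exp (c * t) * q t - exp (c * s) * q s \<le> e * (t - s)"
      using \<delta>1(1) \<delta>2(1) by (intro exI[of _ "min \<delta>1 \<delta>2"]) auto
  qed
  then have "exp (- c * T) * (exp (c * T) * q T) \<le> exp (- c * T) * q 0" by simp
  then show ?thesis by (simp add: mult.assoc[symmetric] exp_add[symmetric])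
qed

section \<open>Semi-inner products and dual norms\<close>

locale psd_form =
  fixes S :: "'v::real_vector set" and q :: "'v \<Rightarrow> 'v \<Rightarrow> real"
  assumes subspace: "subspace S"
    and commute: "u \<in> S \<Longrightarrow> w \<in> S \<Longrightarrow> q u w = q w u"
    and add_left: "u \<in> S \<Longrightarrow> u' \<in> S \<Longrightarrow> w \<in> S \<Longrightarrow> q (u + u') w = q u w + q u' w"
    and scale_left: "u \<in> S \<Longrightarrow> w \<in> S \<Longrightarrow> q (c *\<^sub>R u) w = c * q u w"
    and nonneg: "u \<in> S \<Longrightarrow> q u u \<ge> 0"
begin

lemma zero_mem [simp]: "0 \<in> S" by (rule subspace_0[OF subspace])
lemma add_mem: "u \<in> S \<Longrightarrow> w \<in> S \<Longrightarrow> u + w \<in> S" by (rule subspace_add[OF subspace])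
lemma diff_mem: "u \<in> S \<Longrightarrow> w \<in> S \<Longrightarrow> u - w \<in> S" by (rule subspace_diff[OF subspace])
lemma scale_mem: "u \<in> S \<Longrightarrow> c *\<^sub>R u \<in> S" by (rule subspace_scale[OF subspace])
lemmas mem = add_mem diff_mem scale_mem

lemma add_right: "u \<in> S \<Longrightarrow> w \<in> S \<Longrightarrow> w' \<in> S \<Longrightarrow> q u (w + w') = q u w + q u w'"
  by (metis add_left add_mem commute)

lemma scale_right: "u \<in> S \<Longrightarrow> w \<in> S \<Longrightarrow> q u (c *\<^sub>R w) = c * q u w"
  by (metis scale_left scale_mem commute)

lemma diff_left: "u \<in> S \<Longrightarrow> u' \<in> S \<Longrightarrow> w \<in> S \<Longrightarrow> q (u - u') w = q u w - q u' w"
  using add_left[of u "(-1) *\<^sub>R u'" w] scale_left[of u' w "-1"] scale_mem[of u' "-1"] by simp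

lemma diff_right: "u \<in> S \<Longrightarrow> w \<in> S \<Longrightarrow> w' \<in> S \<Longrightarrow> q u (w - w') = q u w - q u w'"
  by (metis diff_left diff_mem commute)

lemma zero_left: "w \<in> S \<Longrightarrow> q 0 w = 0"
  using scale_left[of 0 w 0] by simp

lemma zero_right: "w \<in> S \<Longrightarrow> q w 0 = 0"
  using zero_left commute[of w 0] by simp

lemmas bilin = add_left add_right diff_left diff_right scale_left scale_right

lemma cauchy_schwarz_sq:
  assumes "u \<in> S" "w \<in> S"
  shows "(q u w)\<^sup>2 \<le> q u u * q w w"
proof (rule quadratic_nonneg_discriminant)
  fix s :: real
  have "0 \<le> q (u + s *\<^sub>R w) (u + s *\<^sub>R w)" using assms by (intro nonneg mem)
  also have "\<dots> = q u u + 2 * q u w * s + q w w * s\<^sup>2"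
    using assms by (simp add: bilin mem commute[of w u] power2_eq_square algebra_simps)
  finally show "0 \<le> q u u + 2 * q u w * s + q w w * s\<^sup>2" .
qed (use assms nonneg in auto)

definition n :: "'v \<Rightarrow> real" where "n u = sqrt (q u u)"

lemma n_sq: "u \<in> S \<Longrightarrow> (n u)\<^sup>2 = q u u"
  by (simp add: n_def nonneg)

lemma n_nonneg: "u \<in> S \<Longrightarrow> n u \<ge> 0"
  by (simp add: n_def nonneg)

lemma cauchy_schwarz: "u \<in> S \<Longrightarrow> w \<in> S \<Longrightarrow> \<bar>q u w\<bar> \<le> n u * n w"
  by (rule power2_le_imp_le) (auto simp: power_mult_distrib n_sq cauchy_schwarz_sq n_nonneg)

lemma cauchy_schwarz_le: "u \<in> S \<Longrightarrow> w \<in> S \<Longrightarrow> q u w \<le> n u * n w"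
  using cauchy_schwarz[of u w] by linarith

lemma cauchy_schwarz_ge: "u \<in> S \<Longrightarrow> w \<in> S \<Longrightarrow> - (n u * n w) \<le> q u w"
  using cauchy_schwarz[of u w] by linarith

lemma n_scale: "u \<in> S \<Longrightarrow> n (c *\<^sub>R u) = \<bar>c\<bar> * n u"
  by (simp add: n_def bilin mem real_sqrt_mult flip: mult.assoc power2_eq_square)

lemma n_triangle:
  assumes "u \<in> S" "w \<in> S"
  shows "n (u + w) \<le> n u + n w"
proof (rule power2_le_imp_le)
  have "(n (u + w))\<^sup>2 = (n u)\<^sup>2 + 2 * q u w + (n w)\<^sup>2"
    using assms by (simp add: n_sq mem bilin commute[of w u])
  also have "\<dots> \<le> (n u + n w)\<^sup>2"
    using cauchy_schwarz_le[OF assms] by (simp add: power2_sum)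
  finally show "(n (u + w))\<^sup>2 \<le> (n u + n w)\<^sup>2" .
qed (use assms in \<open>auto simp: n_nonneg\<close>)

lemma n_diff_commute: "u \<in> S \<Longrightarrow> w \<in> S \<Longrightarrow> n (u - w) = n (w - u)"
  using n_scale[of "u - w" "-1"] by (simp add: mem)

lemma n_triangle_diff: "u \<in> S \<Longrightarrow> w \<in> S \<Longrightarrow> n (u - w) \<le> n u + n w"
  using n_triangle[of u "(-1) *\<^sub>R w"] n_scale[of w "-1"] scale_mem[of w "-1"] by simp

lemma n_le_add_diff: "u \<in> S \<Longrightarrow> w \<in> S \<Longrightarrow> n u \<le> n (u - w) + n w"
  using n_triangle[of "u - w" w] by (simp add: mem)

lemma n_triangle3: "u \<in> S \<Longrightarrow> w \<in> S \<Longrightarrow> y \<in> S \<Longrightarrow> n (u - w) \<le> n (u - y) + n (y - w)"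
  using n_triangle[of "u - y" "y - w"] by (simp add: mem)

lemma n_zero [simp]: "n 0 = 0"
  by (simp add: n_def zero_left)

definition ncont :: "(real \<Rightarrow> 'v) \<Rightarrow> bool" where
  "ncont u \<longleftrightarrow> (\<forall>t\<ge>0. u t \<in> S \<and> ((\<lambda>s. n (u s - u t)) \<longlongrightarrow> 0) (at t within {0..}))"

lemma ncont_mem: "ncont u \<Longrightarrow> t \<ge> 0 \<Longrightarrow> u t \<in> S"
  by (simp add: ncont_def)

lemma ncont_le:
  assumes u: "ncont u" and mem: "\<And>t. t \<ge> 0 \<Longrightarrow> w t \<in> S"
    and le: "\<And>s t. s \<ge> 0 \<Longrightarrow> t \<ge> 0 \<Longrightarrow> n (w s - w t) \<le> C * n (u s - u t)"
  shows "ncont w"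
  unfolding ncont_def
proof (intro allI impI conjI mem)
  fix t :: real assume "t \<ge> 0"
  have lim: "((\<lambda>s. C * n (u s - u t)) \<longlongrightarrow> 0) (at t within {0..})"
    using u \<open>t \<ge> 0\<close> tendsto_mult_right_zero by (auto simp: ncont_def)
  show "((\<lambda>s. n (w s - w t)) \<longlongrightarrow> 0) (at t within {0..})"
    by (rule Lim_null_comparison[OF _ lim])
      (use \<open>t \<ge> 0\<close> le mem in \<open>auto simp: eventually_at_filter n_nonneg diff_mem\<close>)
qed

lemma ncont_add:
  assumes u: "ncont u" and w: "ncont w"
  shows "ncont (\<lambda>t. u t + w t)"
  unfolding ncont_def
proof (intro allI impI conjI)
  fix t :: real assume "t \<ge> 0"
  then show "u t + w t \<in> S" using u w by (auto simp: ncont_mem add_mem)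
  have lim: "((\<lambda>s. n (u s - u t) + n (w s - w t)) \<longlongrightarrow> 0) (at t within {0..})"
    using u w \<open>t \<ge> 0\<close> by (intro tendsto_add_zero) (auto simp: ncont_def)
  show "((\<lambda>s. n (u s + w s - (u t + w t))) \<longlongrightarrow> 0) (at t within {0..})"
  proof (rule Lim_null_comparison[OF _ lim])
    show "\<forall>\<^sub>F s in at t within {0..}. norm (n (u s + w s - (u t + w t))) \<le> n (u s - u t) + n (w s - w t)"
      unfolding eventually_at_filter
    proof (intro always_eventually allI impI)
      fix s :: real assume "s \<in> {0..}"
      then have "u s \<in> S" "w s \<in> S" "u t \<in> S" "w t \<in> S"
        using u w \<open>t \<ge> 0\<close> by (auto simp: ncont_mem)
      moreover have eq: "u s + w s - (u t + w t) = (u s - u t) + (w s - w t)" by simp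
      ultimately show "norm (n (u s + w s - (u t + w t))) \<le> n (u s - u t) + n (w s - w t)"
        unfolding eq using n_triangle[of "u s - u t" "w s - w t"] by (simp add: mem n_nonneg)
    qed
  qed
qed

lemma ncont_scale:
  assumes u: "ncont u"
  shows "ncont (\<lambda>t. c *\<^sub>R u t)"
  by (rule ncont_le[OF u, of _ "\<bar>c\<bar>"])
    (use u in \<open>auto simp: ncont_mem mem n_scale simp flip: scaleR_right_diff_distrib\<close>)

lemma ncont_diff: "ncont u \<Longrightarrow> ncont w \<Longrightarrow> ncont (\<lambda>t. u t - w t)"
  using ncont_add[of u "\<lambda>t. (-1) *\<^sub>R w t"] ncont_scale[of w "-1"] by simp

lemma ncont_const: "u \<in> S \<Longrightarrow> ncont (\<lambda>_. u)"
  by (simp add: ncont_def)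

lemma ncont_continuous_on:
  assumes u: "ncont u" and p: "ncont p"
  shows "continuous_on ({0..} \<times> {0..}) (\<lambda>x. q (u (fst x)) (p (snd x)))"
  unfolding continuous_on_eq_continuous_within
proof
  fix x0 :: "real \<times> real" assume "x0 \<in> {0..} \<times> {0..}"
  then obtain t r where x0: "x0 = (t, r)" "t \<ge> 0" "r \<ge> 0" by auto
  let ?F = "at x0 within ({0..} \<times> {0..})"
  have 1: "((\<lambda>x. n (u (fst x) - u t)) \<longlongrightarrow> 0) ?F"
  proof -
    have "continuous (at t within {0..}) (\<lambda>s. n (u s - u t))"
      using u x0 by (simp add: ncont_def continuous_within)
    then have "continuous (at (fst x0) within fst ` ({0..} \<times> {0::real..})) (\<lambda>s. n (u s - u t))"
      using x0 by simp
    from continuous_within_compose[OF continuous_fst[OF continuous_ident] this]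
    show ?thesis using x0 by (simp add: continuous_within o_def)
  qed
  have 2: "((\<lambda>x. n (p (snd x) - p r)) \<longlongrightarrow> 0) ?F"
  proof -
    have "continuous (at r within {0..}) (\<lambda>s. n (p s - p r))"
      using p x0 by (simp add: ncont_def continuous_within)
    then have "continuous (at (snd x0) within snd ` ({0::real..} \<times> {0..})) (\<lambda>s. n (p s - p r))"
      using x0 by simp
    from continuous_within_compose[OF continuous_snd[OF continuous_ident] this]
    show ?thesis using x0 by (simp add: continuous_within o_def)
  qed
  have lim: "((\<lambda>x. n (u (fst x) - u t) * n (p (snd x) - p r) + n (u (fst x) - u t) * n (p r)
      + n (u t) * n (p (snd x) - p r)) \<longlongrightarrow> 0 * 0 + 0 * n (p r) + n (u t) * 0) ?F"
    by (intro tendsto_intros 1 2)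
  have "((\<lambda>x. q (u (fst x)) (p (snd x)) - q (u t) (p r)) \<longlongrightarrow> 0) ?F"
  proof (rule Lim_null_comparison)
    show "((\<lambda>x. n (u (fst x) - u t) * n (p (snd x) - p r) + n (u (fst x) - u t) * n (p r)
      + n (u t) * n (p (snd x) - p r)) \<longlongrightarrow> 0) ?F" using lim by simp
    show "\<forall>\<^sub>F x in ?F. norm (q (u (fst x)) (p (snd x)) - q (u t) (p r))
        \<le> n (u (fst x) - u t) * n (p (snd x) - p r) + n (u (fst x) - u t) * n (p r)
      + n (u t) * n (p (snd x) - p r)"
      unfolding eventually_at_filter
    proof (intro always_eventually allI impI)
      fix x :: "real \<times> real" assume "x \<in> {0..} \<times> {0..}"
      then have m: "u (fst x) \<in> S" "p (snd x) \<in> S" "u t \<in> S" "p r \<in> S"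
        using u p x0 by (auto simp: ncont_mem)
      have "q (u (fst x)) (p (snd x)) - q (u t) (p r) = q (u (fst x) - u t) (p (snd x) - p r)
          + q (u (fst x) - u t) (p r) + q (u t) (p (snd x) - p r)"
        using m by (simp add: bilin mem)
      also have "norm \<dots> \<le> \<bar>q (u (fst x) - u t) (p (snd x) - p r)\<bar>
          + \<bar>q (u (fst x) - u t) (p r)\<bar> + \<bar>q (u t) (p (snd x) - p r)\<bar>" by simp
      also have "\<dots> \<le> n (u (fst x) - u t) * n (p (snd x) - p r) + n (u (fst x) - u t) * n (p r)
      + n (u t) * n (p (snd x) - p r)"
        using m by (intro add_mono cauchy_schwarz mem)
      finally show "norm (q (u (fst x)) (p (snd x)) - q (u t) (p r))
        \<le> n (u (fst x) - u t) * n (p (snd x) - p r) + n (u (fst x) - u t) * n (p r)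
      + n (u t) * n (p (snd x) - p r)" .
    qed
  qed
  then have "((\<lambda>x. q (u (fst x)) (p (snd x))) \<longlongrightarrow> q (u t) (p r)) ?F"
    by (simp add: LIM_zero_iff)
  then show "continuous ?F (\<lambda>x. q (u (fst x)) (p (snd x)))"
    using x0 by (simp add: continuous_within)
qed

lemma ncont_continuous_on1:
  assumes "ncont u" "ncont p"
  shows "continuous_on {0..} (\<lambda>t. q (u t) (p t))"
  using continuous_on_compose2[OF ncont_continuous_on[OF assms], of "{0..}" "\<lambda>t. (t, t)"]
  by (auto simp: continuous_on_Pair image_subset_iff)

lemma ncont_n: "ncont u \<Longrightarrow> continuous_on {0..} (\<lambda>t. n (u t))"
  unfolding n_def by (intro continuous_intros ncont_continuous_on1)

lemma ncont_integrable:
  "ncont u \<Longrightarrow> ncont p \<Longrightarrow> 0 \<le> s \<Longrightarrow> (\<lambda>t. q (u t) (p t)) integrable_on {s..t}"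
  by (intro integrable_continuous_real continuous_on_subset[OF ncont_continuous_on1]) auto

end

locale form_triple = ip: psd_form L ip + dr: psd_form V dr
  for L V :: "'v::real_vector set" and ip dr +
  fixes lam :: real
  assumes V_sub_L: "V \<subseteq> L" and lam_pos: "lam > 0"
    and poincare: "u \<in> V \<Longrightarrow> lam * ip u u \<le> dr u u"
begin

abbreviation n :: "'v \<Rightarrow> real" where "n \<equiv> ip.n"

lemma VL: "u \<in> V \<Longrightarrow> u \<in> L" using V_sub_L by blast

definition fm :: "real \<Rightarrow> real \<Rightarrow> 'v \<Rightarrow> 'v \<Rightarrow> real" where
  "fm \<alpha> \<epsilon> w y = \<alpha> * ip w y + \<epsilon> * dr w y"

text \<open>\<open>N \<alpha> \<epsilon> f\<close> is the squared norm of \<open>f\<close> in the dual of \<open>V\<close> normed by \<open>fm \<alpha> \<epsilon>\<close>. The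
  supremum need not be attained, as \<open>V\<close> is not assumed to be complete.\<close>

definition N :: "real \<Rightarrow> real \<Rightarrow> 'v \<Rightarrow> real" where
  "N \<alpha> \<epsilon> f = (SUP w\<in>V. 2 * ip f w - fm \<alpha> \<epsilon> w w)"

context
  fixes \<alpha> \<epsilon> :: real
  assumes \<alpha>: "\<alpha> \<ge> 0" and \<epsilon>: "\<epsilon> > 0"
begin

lemma coer_pos: "\<alpha> + \<epsilon> * lam > 0"
  using \<alpha> \<epsilon> lam_pos by (simp add: add_nonneg_pos)

lemma fm_coercive: "w \<in> V \<Longrightarrow> (\<alpha> + \<epsilon> * lam) * (n w)\<^sup>2 \<le> fm \<alpha> \<epsilon> w w"
  using poincare[of w] \<epsilon> mult_left_mono[of "lam * ip w w" "dr w w" \<epsilon>]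
  by (simp add: fm_def ip.n_sq VL algebra_simps)

lemma fm_nonneg: "w \<in> V \<Longrightarrow> fm \<alpha> \<epsilon> w w \<ge> 0"
  using \<alpha> \<epsilon> by (simp add: fm_def ip.nonneg dr.nonneg VL)

lemma functional_le:
  assumes "f \<in> L" "w \<in> V"
  shows "2 * ip f w - fm \<alpha> \<epsilon> w w \<le> (n f)\<^sup>2 / (\<alpha> + \<epsilon> * lam)"
proof -
  let ?c = "\<alpha> + \<epsilon> * lam"
  have "2 * ip f w - fm \<alpha> \<epsilon> w w \<le> 2 * (n f * n w) - ?c * (n w)\<^sup>2"
    using fm_coercive[of w] ip.cauchy_schwarz_le[of f w] assms by (simp add: VL)
  also have "\<dots> = (n f)\<^sup>2 / ?c - (n f - ?c * n w)\<^sup>2 / ?c"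
  proof -
    have "2 * (x * y) - c * y\<^sup>2 = x\<^sup>2 / c - (x - c * y)\<^sup>2 / c" if "c > 0" for x y c :: real
      using that by (simp add: field_simps power2_eq_square)
    then show ?thesis using coer_pos .
  qed
  also have "\<dots> \<le> (n f)\<^sup>2 / ?c" using coer_pos by simp
  finally show ?thesis .
qed

lemma functional_bdd: "f \<in> L \<Longrightarrow> bdd_above ((\<lambda>w. 2 * ip f w - fm \<alpha> \<epsilon> w w) ` V)"
  using functional_le by (intro bdd_aboveI2) blast

lemma N_upper: "f \<in> L \<Longrightarrow> w \<in> V \<Longrightarrow> 2 * ip f w - fm \<alpha> \<epsilon> w w \<le> N \<alpha> \<epsilon> f"
  unfolding N_def by (rule cSUP_upper[OF _ functional_bdd])

lemma N_nonneg: "f \<in> L \<Longrightarrow> 0 \<le> N \<alpha> \<epsilon> f"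
  using N_upper[of f 0] by (simp add: fm_def ip.zero_right dr.zero_right)

lemma N_le: "f \<in> L \<Longrightarrow> N \<alpha> \<epsilon> f \<le> (n f)\<^sup>2 / (\<alpha> + \<epsilon> * lam)"
  unfolding N_def by (rule cSUP_least) (auto intro: functional_le dr.zero_mem)

lemma near_maximiser:
  assumes f: "f \<in> L" and \<eta>: "\<eta> > 0"
  obtains w where "w \<in> V" "N \<alpha> \<epsilon> f \<le> 2 * ip f w - fm \<alpha> \<epsilon> w w + \<eta>"
    "\<And>y. y \<in> V \<Longrightarrow> \<bar>ip f y - fm \<alpha> \<epsilon> w y\<bar> \<le> sqrt \<eta> * sqrt (fm \<alpha> \<epsilon> y y)"
    "n w \<le> 2 * n f / (\<alpha> + \<epsilon> * lam) + sqrt (\<eta> / (\<alpha> + \<epsilon> * lam))"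
proof -
  let ?c = "\<alpha> + \<epsilon> * lam"
  have "\<exists>w\<in>V. N \<alpha> \<epsilon> f - \<eta> < 2 * ip f w - fm \<alpha> \<epsilon> w w"
    using \<eta> less_cSUP_iff[OF _ functional_bdd[OF f], of "N \<alpha> \<epsilon> f - \<eta>"] dr.zero_mem
    unfolding N_def by (metis (no_types, lifting) diff_less_eq empty_iff less_add_same_cancel1)
  then obtain w where w: "w \<in> V" "N \<alpha> \<epsilon> f - \<eta> < 2 * ip f w - fm \<alpha> \<epsilon> w w" by blast
  have orth: "\<bar>ip f y - fm \<alpha> \<epsilon> w y\<bar> \<le> sqrt \<eta> * sqrt (fm \<alpha> \<epsilon> y y)" if y: "y \<in> V" for y
  proof -
    let ?b = "ip f y - fm \<alpha> \<epsilon> w y"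
    have "(- ?b)\<^sup>2 \<le> \<eta> * fm \<alpha> \<epsilon> y y"
    proof (rule quadratic_nonneg_discriminant)
      fix s :: real
      have "2 * ip f (w + s *\<^sub>R y) - fm \<alpha> \<epsilon> (w + s *\<^sub>R y) (w + s *\<^sub>R y) \<le> N \<alpha> \<epsilon> f"
        using f w y by (intro N_upper dr.mem)
      also have "2 * ip f (w + s *\<^sub>R y) - fm \<alpha> \<epsilon> (w + s *\<^sub>R y) (w + s *\<^sub>R y) =
          2 * ip f w - fm \<alpha> \<epsilon> w w + 2 * s * ?b - s\<^sup>2 * fm \<alpha> \<epsilon> y y"
        using f w(1) y VL[OF w(1)] VL[OF y]
        by (simp add: fm_def ip.bilin dr.bilin ip.mem dr.mem ip.commute[of y w] dr.commute[of y w]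
            power2_eq_square algebra_simps)
      finally show "0 \<le> \<eta> + 2 * (- ?b) * s + fm \<alpha> \<epsilon> y y * s\<^sup>2"
        using w(2) by (simp add: algebra_simps)
    qed (rule fm_nonneg[OF y])
    then have "sqrt (?b\<^sup>2) \<le> sqrt (\<eta> * fm \<alpha> \<epsilon> y y)" 
      by (intro real_sqrt_le_mono) (simp add: power2_commute)
    then show ?thesis by (simp add: real_sqrt_mult)
  qed
  have "n w \<le> 2 * n f / ?c + sqrt (\<eta> / ?c)"
  proof (rule ccontr)
    assume "\<not> ?thesis"
    then have gt: "n w > 2 * n f / ?c + sqrt (\<eta> / ?c)" by simp
    have nf: "n f \<ge> 0" using f by (rule ip.n_nonneg)
    have sq: "sqrt (\<eta> / ?c) > 0" using \<eta> coer_pos by simp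
    have nw: "n w > sqrt (\<eta> / ?c)" using gt nf coer_pos by (smt (verit) divide_nonneg_pos)
    have "?c * (n w * n w) \<le> fm \<alpha> \<epsilon> w w" using fm_coercive[OF w(1)] by (simp add: power2_eq_square)
    also have "\<dots> \<le> 2 * ip f w + \<eta>" using w(2) N_nonneg[OF f] by simp
    also have "\<dots> \<le> 2 * (n f * n w) + \<eta>" using ip.cauchy_schwarz_le[OF f VL[OF w(1)]] by simp
    also have "\<eta> = ?c * (sqrt (\<eta> / ?c) * sqrt (\<eta> / ?c))"
      using \<eta> coer_pos by simp
    also have "2 * (n f * n w) + ?c * (sqrt (\<eta> / ?c) * sqrt (\<eta> / ?c))
        < 2 * (n f * n w) + ?c * (sqrt (\<eta> / ?c) * n w)"
      using nw sq coer_pos by (intro add_strict_left_mono mult_strict_left_mono)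
    also have "\<dots> = ?c * ((2 * n f / ?c + sqrt (\<eta> / ?c)) * n w)"
      using coer_pos by (simp add: field_simps)
    also have "\<dots> \<le> ?c * (n w * n w)"
      using gt coer_pos ip.n_nonneg[OF VL[OF w(1)]] by (intro mult_left_mono mult_right_mono) auto
    finally show False by simp
  qed
  with that[of w] w orth show ?thesis by force
qed

end

end

lemma young_weighted: 
  fixes x y c :: real
  assumes "c > 0"
  shows "x * y \<le> c / 4 * x\<^sup>2 + y\<^sup>2 / c"
proof -
  have "0 \<le> (c * x / 2 - y)\<^sup>2 / c" using assms by simp
  also have "\<dots> = c / 4 * x\<^sup>2 + y\<^sup>2 / c - x * y"
    using assms by (simp add: field_simps power2_eq_square)
  finally show ?thesis by simp
qed

lemma le_of_le_add_sqrt: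
  fixes x y B :: real
  assumes "\<And>\<eta>. 0 < \<eta> \<Longrightarrow> \<eta> \<le> 1 \<Longrightarrow> x \<le> y + \<eta> + B * sqrt \<eta>"
  shows "x \<le> y"
proof (rule tendsto_le)
  have "((\<lambda>\<eta>. y + \<eta> + B * sqrt \<eta>) \<longlongrightarrow> y + 0 + B * sqrt 0) (at_right 0)"
    by (intro tendsto_intros)
  then show "((\<lambda>\<eta>. y + \<eta> + B * sqrt \<eta>) \<longlongrightarrow> y) (at_right 0)" by simp
  show "\<forall>\<^sub>F \<eta> in at_right 0. x \<le> y + \<eta> + B * sqrt \<eta>"
    unfolding eventually_at_right_field by (intro exI[of _ 1]) (auto intro: assms)
qed auto

section \<open>Energy inequalities for parabolic evolutions\<close>

context form_triple
begin

text \<open>\<open>evol u p F m Z\<close>: \<open>u' = \<Delta>p + F\<close> in the dual of \<open>V\<close>, where \<open>p\<close> is only \<open>V\<close>-valued outside the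
  null set \<open>Z\<close> and \<open>m\<close> is an integrable bound for its squared \<open>V\<close>-norm.\<close>

definition evol :: "(real \<Rightarrow> 'v) \<Rightarrow> (real \<Rightarrow> 'v) \<Rightarrow> (real \<Rightarrow> 'v) \<Rightarrow> (real \<Rightarrow> real) \<Rightarrow> real set \<Rightarrow> bool" where
  "evol u p F m Z \<longleftrightarrow> ip.ncont u \<and> ip.ncont p \<and> ip.ncont F \<and> negligible Z \<and>
     (\<forall>r\<ge>0. r \<notin> Z \<longrightarrow> p r \<in> V \<and> dr (p r) (p r) \<le> m r) \<and>
     (\<forall>s t. 0 \<le> s \<longrightarrow> m integrable_on {s..t}) \<and>
     (\<forall>w\<in>V. \<forall>s t. 0 \<le> s \<and> s \<le> t \<longrightarrow>
        ((\<lambda>r. - dr (p r) w + ip (F r) w) has_integral (ip (u t) w - ip (u s) w)) {s..t})"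

lemma evol_step:
  assumes ev: "evol u p F m Z" and \<alpha>: "\<alpha> \<ge> 0" and \<epsilon>: "\<epsilon> > 0" and st: "0 \<le> s" "s \<le> t" and \<eta>: "\<eta> > 0"
  obtains w where "w \<in> V" "N \<alpha> \<epsilon> (u t) \<le> 2 * ip (u t) w - fm \<alpha> \<epsilon> w w + \<eta>"
    "\<And>y. y \<in> V \<Longrightarrow> \<bar>ip (u t) y - fm \<alpha> \<epsilon> w y\<bar> \<le> sqrt \<eta> * sqrt (fm \<alpha> \<epsilon> y y)"
    "n w \<le> 2 * n (u t) / (\<alpha> + \<epsilon> * lam) + sqrt (\<eta> / (\<alpha> + \<epsilon> * lam))"
    "N \<alpha> \<epsilon> (u t) - N \<alpha> \<epsilon> (u s) \<le>
       \<eta> + 2 * integral {s..t} (\<lambda>r. - (1 / \<epsilon>) * ip (u t - \<alpha> *\<^sub>R w) (p r) + ip (F r) w)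
       + 2 * sqrt \<eta> / \<epsilon> * integral {s..t} (\<lambda>r. 1 + \<alpha> * ip (p r) (p r) + \<epsilon> * m r)"
proof -
  have nc: "ip.ncont u" "ip.ncont p" "ip.ncont F" and Z: "negligible Z"
    and pV: "\<And>r. r \<ge> 0 \<Longrightarrow> r \<notin> Z \<Longrightarrow> p r \<in> V \<and> dr (p r) (p r) \<le> m r"
    and mint: "m integrable_on {s..t}"
    and eq: "\<And>w. w \<in> V \<Longrightarrow> ((\<lambda>r. - dr (p r) w + ip (F r) w) has_integral (ip (u t) w - ip (u s) w)) {s..t}"
    using ev st by (auto simp: evol_def)
  have ut: "u t \<in> L" "u s \<in> L" using nc st by (auto simp: ip.ncont_mem)
  obtain w where w: "w \<in> V" "N \<alpha> \<epsilon> (u t) \<le> 2 * ip (u t) w - fm \<alpha> \<epsilon> w w + \<eta>"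
    "\<And>y. y \<in> V \<Longrightarrow> \<bar>ip (u t) y - fm \<alpha> \<epsilon> w y\<bar> \<le> sqrt \<eta> * sqrt (fm \<alpha> \<epsilon> y y)"
    "n w \<le> 2 * n (u t) / (\<alpha> + \<epsilon> * lam) + sqrt (\<eta> / (\<alpha> + \<epsilon> * lam))"
    using near_maximiser[OF \<alpha> \<epsilon> ut(1) \<eta>] by blast
  have wL: "w \<in> L" using w(1) by (rule VL)
  define A where "A = (\<lambda>r. - (1 / \<epsilon>) * ip (u t - \<alpha> *\<^sub>R w) (p r) + ip (F r) w)"
  define B where "B = (\<lambda>r. 1 + \<alpha> * ip (p r) (p r) + \<epsilon> * m r)"
  have cont: "continuous_on {0..} A"
    unfolding A_def using nc ut wL
    by (intro continuous_intros ip.ncont_continuous_on1 ip.ncont_const ip.mem)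
  have Aint: "A integrable_on {s..t}"
    using st by (intro integrable_continuous_real continuous_on_subset[OF cont]) auto
  have Bint: "B integrable_on {s..t}"
    unfolding B_def using st mint nc
    by (intro integrable_add integrable_const_ivl integrable_on_mult_right ip.ncont_integrable)
  let ?R = "\<lambda>r. A r + sqrt \<eta> / \<epsilon> * B r"
  have le: "- dr (p r) w + ip (F r) w \<le> ?R r" if "r \<in> {s..t}" "r \<notin> Z" for r
  proof -
    have r: "r \<ge> 0" using that st by auto
    have p: "p r \<in> V" "dr (p r) (p r) \<le> m r" "p r \<in> L"
      using pV[OF r \<open>r \<notin> Z\<close>] nc r by (auto simp: ip.ncont_mem)
    have "ip (u t) (p r) - fm \<alpha> \<epsilon> w (p r) \<le> sqrt \<eta> * sqrt (fm \<alpha> \<epsilon> (p r) (p r))"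
      using w(3)[OF p(1)] by linarith
    also have "\<dots> \<le> sqrt \<eta> * B r"
    proof (rule mult_left_mono)
      have f0: "fm \<alpha> \<epsilon> (p r) (p r) \<ge> 0" by (rule fm_nonneg[OF \<alpha> \<epsilon> p(1)])
      have "sqrt (fm \<alpha> \<epsilon> (p r) (p r)) \<le> 1 + fm \<alpha> \<epsilon> (p r) (p r)"
      proof (rule real_le_lsqrt)
        show "fm \<alpha> \<epsilon> (p r) (p r) \<le> (1 + fm \<alpha> \<epsilon> (p r) (p r))\<^sup>2"
          using f0 by (simp add: power2_eq_square algebra_simps)
      qed (use f0 in auto)
      also have "\<dots> \<le> B r" using p(2) \<epsilon> by (simp add: fm_def B_def)
      finally show "sqrt (fm \<alpha> \<epsilon> (p r) (p r)) \<le> B r" .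
    qed (use \<eta> in auto)
    finally have "ip (u t) (p r) - \<alpha> * ip w (p r) - \<epsilon> * dr (p r) w \<le> sqrt \<eta> * B r"
      using dr.commute[OF w(1) p(1)] by (simp add: fm_def)
    then have "(ip (u t) (p r) - \<alpha> * ip w (p r)) - \<epsilon> * dr (p r) w \<le> sqrt \<eta> * B r" by simp
    then have "ip (u t - \<alpha> *\<^sub>R w) (p r) - \<epsilon> * dr (p r) w \<le> sqrt \<eta> * B r"
      using ut wL p by (simp add: ip.bilin ip.mem)
    then have "(ip (u t - \<alpha> *\<^sub>R w) (p r) - \<epsilon> * dr (p r) w) / \<epsilon> \<le> sqrt \<eta> * B r / \<epsilon>"
      using \<epsilon> by (intro divide_right_mono) auto
    then show ?thesis using \<epsilon> by (simp add: A_def diff_divide_distrib)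
  qed
  have "((\<lambda>r. if r \<in> Z then ?R r else - dr (p r) w + ip (F r) w) has_integral (ip (u t) w - ip (u s) w)) {s..t}"
    by (rule has_integral_spike[OF Z _ eq[OF w(1)]]) auto
  moreover have "(?R has_integral (integral {s..t} A + sqrt \<eta> / \<epsilon> * integral {s..t} B)) {s..t}"
    using Aint Bint by (intro has_integral_add has_integral_mult_right integrable_integral)
  ultimately have "ip (u t) w - ip (u s) w \<le> integral {s..t} A + sqrt \<eta> / \<epsilon> * integral {s..t} B"
    by (rule has_integral_le) (use le in auto)
  moreover have "2 * ip (u s) w - fm \<alpha> \<epsilon> w w \<le> N \<alpha> \<epsilon> (u s)"
    by (rule N_upper[OF \<alpha> \<epsilon> ut(2) w(1)])
  ultimately have "N \<alpha> \<epsilon> (u t) - N \<alpha> \<epsilon> (u s) \<le> \<eta> + 2 * integral {s..t} A + 2 * sqrt \<eta> / \<epsilon> * integral {s..t} B"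
    using w(2) by simp
  with that[of w] w show ?thesis unfolding A_def B_def by blast
qed

lemma dual_energy:
  assumes ev: "evol u p F m Z" and st: "0 \<le> s" "s \<le> t"
  shows "N 0 1 (u t) - N 0 1 (u s) \<le>
    integral {s..t} (\<lambda>r. - 2 * ip (u r) (p r) + 4 / lam * n (F r) * n (u r))"
proof (rule increment_le_integral_diagonal[where f = "\<lambda>t. N 0 1 (u t)"
      and K = "\<lambda>t r. - 2 * ip (u t) (p r) + 4 / lam * n (F r) * n (u t)", OF st(2)])
  have nc: "ip.ncont u" "ip.ncont p" "ip.ncont F" using ev by (auto simp: evol_def)
  have un: "continuous_on ({0..} \<times> {0..}) (\<lambda>x::real\<times>real. n (u (fst x)))"
    by (rule continuous_on_compose2[OF ip.ncont_n[OF nc(1)]]) (auto intro!: continuous_intros)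
  have Fn: "continuous_on ({0..} \<times> {0..}) (\<lambda>x::real\<times>real. n (F (snd x)))"
    by (rule continuous_on_compose2[OF ip.ncont_n[OF nc(3)]]) (auto intro!: continuous_intros)
  have "continuous_on ({0..} \<times> {0..}) (\<lambda>x::real\<times>real. - 2 * ip (u (fst x)) (p (snd x))
      + 4 / lam * n (F (snd x)) * n (u (fst x)))"
    using nc by (intro continuous_intros ip.ncont_continuous_on un Fn)
  then show "continuous_on ({s..t} \<times> {s..t}) (\<lambda>x::real\<times>real. - 2 * ip (u (fst x)) (p (snd x))
      + 4 / lam * n (F (snd x)) * n (u (fst x)))"
    by (rule continuous_on_subset) (use st in auto)
  fix a b assume ab: "s \<le> a" "a \<le> b" "b \<le> t"
  then have ab0: "0 \<le> a" "0 \<le> b" using st by auto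
  let ?M = "integral {a..b} (\<lambda>r. 1 + m r)"
  let ?nF = "integral {a..b} (\<lambda>r. n (F r))"
  have Fint: "(\<lambda>r. n (F r)) integrable_on {a..b}"
    using ab0 by (intro integrable_continuous_real continuous_on_subset[OF ip.ncont_n[OF nc(3)]]) auto
  have ub: "u b \<in> L" using nc ab0 by (auto simp: ip.ncont_mem)
  have upint: "(\<lambda>r. ip (u b) (p r)) integrable_on {a..b}"
    using ab0 ip.ncont_integrable[OF ip.ncont_const[OF ub] nc(2)] by auto
  show "N 0 1 (u b) - N 0 1 (u a) \<le> integral {a..b} (\<lambda>r. - 2 * ip (u b) (p r) + 4 / lam * n (F r) * n (u b))"
  proof (rule le_of_le_add_sqrt)
    fix \<eta> :: real assume \<eta>: "\<eta> > 0"
    obtain w where w: "w \<in> V" "n w \<le> 2 * n (u b) / (0 + 1 * lam) + sqrt (\<eta> / (0 + 1 * lam))"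
      "N 0 1 (u b) - N 0 1 (u a) \<le>
       \<eta> + 2 * integral {a..b} (\<lambda>r. - (1 / 1) * ip (u b - 0 *\<^sub>R w) (p r) + ip (F r) w)
       + 2 * sqrt \<eta> / 1 * integral {a..b} (\<lambda>r. 1 + 0 * ip (p r) (p r) + 1 * m r)"
      using evol_step[OF ev order_refl zero_less_one ab0(1) ab(2) \<eta>] by blast
    have wL: "w \<in> L" using w(1) by (rule VL)
    have "2 * integral {a..b} (\<lambda>r. - (1 / 1) * ip (u b - 0 *\<^sub>R w) (p r) + ip (F r) w)
        = integral {a..b} (\<lambda>r. 2 * (- ip (u b) (p r) + ip (F r) w))"
      by (simp only: integral_mult_right scaleR_zero_left diff_zero div_by_1 mult_minus1)
    also have "\<dots> \<le> integral {a..b} (\<lambda>r. (- 2 * ip (u b) (p r) + 4 / lam * n (F r) * n (u b))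
        + 2 * sqrt (\<eta> / lam) * n (F r))"
    proof (rule integral_le)
      show "(\<lambda>r. 2 * (- ip (u b) (p r) + ip (F r) w)) integrable_on {a..b}"
        using upint ip.ncont_integrable[OF nc(3) ip.ncont_const[OF wL] ab0(1)]
        by (intro integrable_on_mult_right integrable_add integrable_neg)
      show "(\<lambda>r. (- 2 * ip (u b) (p r) + 4 / lam * n (F r) * n (u b))
        + 2 * sqrt (\<eta> / lam) * n (F r)) integrable_on {a..b}"
        using upint Fint by (intro integrable_on_mult_right integrable_on_mult_left integrable_add)
      fix r assume "r \<in> {a..b}"
      then have Fr: "F r \<in> L" using nc ab0 by (auto simp: ip.ncont_mem)
      have "ip (F r) w \<le> n (F r) * n w" by (rule ip.cauchy_schwarz_le[OF Fr wL])
      also have "\<dots> \<le> n (F r) * (2 * n (u b) / lam + sqrt (\<eta> / lam))"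
        using w(2) ip.n_nonneg[OF Fr] by (intro mult_left_mono) auto
      also have "\<dots> = 2 / lam * n (F r) * n (u b) + sqrt (\<eta> / lam) * n (F r)"
        by (simp add: distrib_left)
      finally show "2 * (- ip (u b) (p r) + ip (F r) w) \<le> (- 2 * ip (u b) (p r) + 4 / lam * n (F r) * n (u b))
        + 2 * sqrt (\<eta> / lam) * n (F r)"
        by simp
    qed
    also have "\<dots> = integral {a..b} (\<lambda>r. - 2 * ip (u b) (p r) + 4 / lam * n (F r) * n (u b))
        + integral {a..b} (\<lambda>r. 2 * sqrt (\<eta> / lam) * n (F r))"
      using upint Fint
      by (intro Henstock_Kurzweil_Integration.integral_add integrable_on_mult_right integrable_on_mult_left integrable_add)
    also have "integral {a..b} (\<lambda>r. 2 * sqrt (\<eta> / lam) * n (F r)) = 2 * sqrt (\<eta> / lam) * ?nF"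
      by (rule integral_mult_right)
    finally show "N 0 1 (u b) - N 0 1 (u a)
        \<le> integral {a..b} (\<lambda>r. - 2 * ip (u b) (p r) + 4 / lam * n (F r) * n (u b)) + \<eta>
          + (2 / sqrt lam * ?nF + 2 * ?M) * sqrt \<eta>"
      using w(3) by (simp add: real_sqrt_divide algebra_simps)
  qed
qed

lemma smoothed_energy:
  assumes ev: "evol u (\<lambda>t. d *\<^sub>R u t) F m Z" and st: "0 \<le> s" "s \<le> t" and d: "d > 0" and \<epsilon>: "\<epsilon> > 0"
  shows "N 1 \<epsilon> (u t) - N 1 \<epsilon> (u s) \<le>
    integral {s..t} (\<lambda>r. - 2 * d * lam / (1 + 2 * \<epsilon> * lam) * ip (u r) (u r) + 2 * ip (F r) (u r)
       + 2 * \<epsilon> / d * ip (F r) (F r))"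
proof -
  define K where "K = (\<lambda>t r. - 2 * d * lam / (1 + 2 * \<epsilon> * lam) * ip (u t) (u t) + 2 * ip (u t) (F r)
       + 2 * \<epsilon> / d * ip (F r) (F r)
       + 2 * d / \<epsilon> * (ip (u r) (u r) - 2 * ip (u t) (u r) + ip (u t) (u t)))"
  have nc: "ip.ncont u" "ip.ncont (\<lambda>t. d *\<^sub>R u t)" "ip.ncont F" using ev by (auto simp: evol_def)
  have 1: "continuous_on ({0..} \<times> {0..}) (\<lambda>x::real\<times>real. ip (a (fst x)) (a (fst x)))" if "ip.ncont a" for a
    by (rule continuous_on_compose2[OF ip.ncont_continuous_on1[OF that that]]) (auto intro!: continuous_intros)
  have 2: "continuous_on ({0..} \<times> {0..}) (\<lambda>x::real\<times>real. ip (a (snd x)) (a (snd x)))" if "ip.ncont a" for a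
    by (rule continuous_on_compose2[OF ip.ncont_continuous_on1[OF that that]]) (auto intro!: continuous_intros)
  have Kc: "continuous_on ({0..} \<times> {0..}) (\<lambda>x::real\<times>real. K (fst x) (snd x))"
    unfolding K_def by (intro continuous_intros 1 2 ip.ncont_continuous_on nc)
  have "N 1 \<epsilon> (u t) - N 1 \<epsilon> (u s) \<le> integral {s..t} (\<lambda>r. K r r)"
  proof (rule increment_le_integral_diagonal[where f = "\<lambda>t. N 1 \<epsilon> (u t)" and K = K, OF st(2)])
    show "continuous_on ({s..t} \<times> {s..t}) (\<lambda>x. K (fst x) (snd x))"
      by (rule continuous_on_subset[OF Kc]) (use st in auto)
    fix a b assume ab: "s \<le> a" "a \<le> b" "b \<le> t"
    then have ab0: "0 \<le> a" "0 \<le> b" using st by auto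
    have ub: "u b \<in> L" using nc ab0 by (auto simp: ip.ncont_mem)
    have Kint: "K b integrable_on {a..b}"
    proof (rule integrable_continuous_real)
      show "continuous_on {a..b} (K b)"
        using continuous_on_compose2[OF Kc, of "{a..b}" "\<lambda>r. (b, r)"] ab0
        by (auto simp: continuous_on_Pair image_subset_iff)
    qed
    let ?M = "integral {a..b} (\<lambda>r. 1 + 1 * ip (d *\<^sub>R u r) (d *\<^sub>R u r) + \<epsilon> * m r)"
    let ?c = "1 + \<epsilon> * lam"
    have c: "?c > 0" using \<epsilon> lam_pos by (simp add: add_pos_pos)
    define B where "B = 2 * n (u b) * (2 * n (u b) / ?c + sqrt (1 / ?c)) + 1"
    show "N 1 \<epsilon> (u b) - N 1 \<epsilon> (u a) \<le> integral {a..b} (K b)"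
    proof (rule le_of_le_add_sqrt)
      fix \<eta> :: real assume \<eta>: "\<eta> > 0" "\<eta> \<le> 1"
      obtain w where w: "w \<in> V" "N 1 \<epsilon> (u b) \<le> 2 * ip (u b) w - fm 1 \<epsilon> w w + \<eta>"
        "\<And>y. y \<in> V \<Longrightarrow> \<bar>ip (u b) y - fm 1 \<epsilon> w y\<bar> \<le> sqrt \<eta> * sqrt (fm 1 \<epsilon> y y)"
        "n w \<le> 2 * n (u b) / ?c + sqrt (\<eta> / ?c)"
        "N 1 \<epsilon> (u b) - N 1 \<epsilon> (u a) \<le>
         \<eta> + 2 * integral {a..b} (\<lambda>r. - (1 / \<epsilon>) * ip (u b - 1 *\<^sub>R w) (d *\<^sub>R u r) + ip (F r) w)
         + 2 * sqrt \<eta> / \<epsilon> * ?M"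
        using evol_step[OF ev zero_le_one \<epsilon> ab0(1) ab(2) \<eta>(1)] by blast
      have wL: "w \<in> L" using w(1) by (rule VL)
      define y where "y = u b - w"
      have yL: "y \<in> L" unfolding y_def using ub wL by (rule ip.mem)
      have fB: "sqrt (fm 1 \<epsilon> w w) \<le> sqrt B"
      proof (rule real_sqrt_le_mono)
        have "fm 1 \<epsilon> w w \<le> 2 * ip (u b) w + \<eta>"
          using w(2) N_nonneg[OF _ \<epsilon> ub, of 1] by simp
        also have "\<dots> \<le> 2 * (n (u b) * n w) + 1"
          using ip.cauchy_schwarz_le[OF ub wL] \<eta> by simp
        also have "n (u b) * n w \<le> n (u b) * (2 * n (u b) / ?c + sqrt (1 / ?c))"
        proof (rule mult_left_mono[OF _ ip.n_nonneg[OF ub]])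
          have "sqrt (\<eta> / ?c) \<le> sqrt (1 / ?c)" using \<eta> c by (intro real_sqrt_le_mono divide_right_mono) auto
          then show "n w \<le> 2 * n (u b) / ?c + sqrt (1 / ?c)" using w(4) by linarith
        qed
        finally show "fm 1 \<epsilon> w w \<le> B" by (simp add: B_def)
      qed
      define e where "e = d / \<epsilon> * (sqrt \<eta> * sqrt B)"
      have yw: "- (d / \<epsilon>) * ip y w \<le> - d * lam * (n w)\<^sup>2 + e"
      proof -
        have "fm 1 \<epsilon> w w - ip (u b) w \<le> sqrt \<eta> * sqrt (fm 1 \<epsilon> w w)" using w(3)[OF w(1)] by linarith
        also have "\<dots> \<le> sqrt \<eta> * sqrt B" using fB \<eta> by (intro mult_left_mono) auto
        finally have "\<epsilon> * dr w w - sqrt \<eta> * sqrt B \<le> ip y w"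
          using ub wL by (simp add: fm_def y_def ip.bilin)
        moreover have "\<epsilon> * (lam * (n w)\<^sup>2) \<le> \<epsilon> * dr w w"
          using poincare[OF w(1)] \<epsilon> by (simp add: ip.n_sq wL)
        ultimately have "\<epsilon> * (lam * (n w)\<^sup>2) - sqrt \<eta> * sqrt B \<le> ip y w" by linarith
        then have "(d / \<epsilon>) * (\<epsilon> * (lam * (n w)\<^sup>2) - sqrt \<eta> * sqrt B) \<le> (d / \<epsilon>) * ip y w"
          using d \<epsilon> by (intro mult_left_mono) auto
        moreover have "(d / \<epsilon>) * (\<epsilon> * (lam * (n w)\<^sup>2) - sqrt \<eta> * sqrt B) = d * lam * (n w)\<^sup>2 - e"
          using \<epsilon> by (simp add: e_def right_diff_distrib)
        ultimately show ?thesis by simp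
      qed
      have conv: "- d * lam * (n w)\<^sup>2 - d / (2 * \<epsilon>) * (n y)\<^sup>2 \<le> - d * lam / (1 + 2 * \<epsilon> * lam) * ip (u b) (u b)"
      proof -
        have l: "1 + 2 * \<epsilon> * lam > 0" using \<epsilon> lam_pos by (simp add: add_pos_pos)
        have "n (u b) \<le> n w + n y" using ip.n_triangle[OF wL yL] by (simp add: y_def)
        then have "ip (u b) (u b) \<le> (n w + n y)\<^sup>2"
          using ip.n_sq[OF ub] ip.n_nonneg[OF ub] by (metis power_mono)
        also have "\<dots> \<le> (lam * (n w)\<^sup>2 + (n y)\<^sup>2 / (2 * \<epsilon>)) * ((1 + 2 * \<epsilon> * lam) / lam)"
        proof -
          have "0 \<le> (2 * \<epsilon> * lam * n w - n y)\<^sup>2 / (2 * \<epsilon> * lam)" using \<epsilon> lam_pos by simp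
          then show ?thesis using \<epsilon> lam_pos by (simp add: field_simps power2_eq_square)
        qed
        finally have "ip (u b) (u b) * (d * lam / (1 + 2 * \<epsilon> * lam)) \<le>
            (lam * (n w)\<^sup>2 + (n y)\<^sup>2 / (2 * \<epsilon>)) * ((1 + 2 * \<epsilon> * lam) / lam) * (d * lam / (1 + 2 * \<epsilon> * lam))"
          using d l lam_pos by (intro mult_right_mono) auto
        also have "\<dots> = (lam * (n w)\<^sup>2 + (n y)\<^sup>2 / (2 * \<epsilon>)) * d"
          using l lam_pos by simp
        finally show ?thesis using \<epsilon> by (simp add: algebra_simps)
      qed
      have "2 * integral {a..b} (\<lambda>r. - (1 / \<epsilon>) * ip (u b - 1 *\<^sub>R w) (d *\<^sub>R u r) + ip (F r) w)
          = integral {a..b} (\<lambda>r. 2 * (- (1 / \<epsilon>) * ip y (d *\<^sub>R u r) + ip (F r) w))"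
        by (simp only: y_def scaleR_one integral_mult_right)
      also have "\<dots> \<le> integral {a..b} (\<lambda>r. K b r + 2 * e)"
      proof (rule integral_le)
        show "(\<lambda>r. 2 * (- (1 / \<epsilon>) * ip y (d *\<^sub>R u r) + ip (F r) w)) integrable_on {a..b}"
          using ip.ncont_integrable[OF nc(3) ip.ncont_const[OF wL] ab0(1)]
            ip.ncont_integrable[OF ip.ncont_const[OF yL] nc(2) ab0(1)]
          by (intro integrable_on_mult_right integrable_add)
        show "(\<lambda>r. K b r + 2 * e) integrable_on {a..b}"
          using Kint by (intro integrable_add integrable_const_ivl)
        fix r assume "r \<in> {a..b}"
        then have r: "r \<ge> 0" using ab0 by auto
        have Fr: "F r \<in> L" and ur: "u r \<in> L" using nc r by (auto simp: ip.ncont_mem)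
        define g where "g = u r - u b"
        have gL: "g \<in> L" unfolding g_def using ur ub by (rule ip.mem)
        have gsq: "(n g)\<^sup>2 = ip (u r) (u r) - 2 * ip (u b) (u r) + ip (u b) (u b)"
          using ur ub gL by (simp add: ip.n_sq g_def ip.bilin ip.mem ip.commute[of "u r" "u b"])
        have "ip y (u r) = ip y w + (n y)\<^sup>2 + ip y g"
        proof -
          have "u r = w + y + g" by (simp add: y_def g_def)
          then show ?thesis using wL yL gL by (simp add: ip.bilin ip.mem ip.n_sq)
        qed
        then have "- (1 / \<epsilon>) * ip y (d *\<^sub>R u r)
            = - (d / \<epsilon>) * ip y w - d / \<epsilon> * (n y)\<^sup>2 - d / \<epsilon> * ip y g"
          using yL ur by (simp add: ip.bilin algebra_simps)
        moreover have "- (d / \<epsilon>) * ip y g \<le> d / \<epsilon> * ((n y)\<^sup>2 / 4 + (n g)\<^sup>2)"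
        proof -
          have "- ip y g \<le> n y * n g" using ip.cauchy_schwarz_ge[OF yL gL] by simp
          also have "\<dots> \<le> (n y)\<^sup>2 / 4 + (n g)\<^sup>2" using young_weighted[of 1 "n y" "n g"] by simp
          finally have "(d / \<epsilon>) * (- ip y g) \<le> d / \<epsilon> * ((n y)\<^sup>2 / 4 + (n g)\<^sup>2)"
            using d \<epsilon> by (intro mult_left_mono) auto
          then show ?thesis by simp
        qed
        moreover have "ip (F r) w \<le> ip (u b) (F r) + d / \<epsilon> / 4 * (n y)\<^sup>2 + \<epsilon> / d * ip (F r) (F r)"
        proof -
          have "ip (F r) w = ip (u b) (F r) - ip y (F r)"
            using ub wL Fr by (simp add: y_def ip.bilin ip.commute[of w])
          moreover have "- ip y (F r) \<le> n y * n (F r)" using ip.cauchy_schwarz_ge[OF yL Fr] by simp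
          moreover have "n y * n (F r) \<le> d / \<epsilon> / 4 * (n y)\<^sup>2 + (n (F r))\<^sup>2 / (d / \<epsilon>)"
            using d \<epsilon> by (intro young_weighted) auto
          ultimately show ?thesis by (simp add: ip.n_sq Fr field_simps)
        qed
        ultimately have "- (1 / \<epsilon>) * ip y (d *\<^sub>R u r) + ip (F r) w
            \<le> (- d * lam * (n w)\<^sup>2 + e) - d / \<epsilon> * (n y)\<^sup>2 + d / \<epsilon> * ((n y)\<^sup>2 / 4 + (n g)\<^sup>2)
              + (ip (u b) (F r) + d / \<epsilon> / 4 * (n y)\<^sup>2 + \<epsilon> / d * ip (F r) (F r))"
          using yw by linarith
        also have "\<dots> = (- d * lam * (n w)\<^sup>2 - d / (2 * \<epsilon>) * (n y)\<^sup>2) + d / \<epsilon> * (n g)\<^sup>2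
              + ip (u b) (F r) + \<epsilon> / d * ip (F r) (F r) + e"
          using d \<epsilon> by (simp add: field_simps)
        also have "\<dots> \<le> - d * lam / (1 + 2 * \<epsilon> * lam) * ip (u b) (u b) + d / \<epsilon> * (n g)\<^sup>2
              + ip (u b) (F r) + \<epsilon> / d * ip (F r) (F r) + e"
          using conv by simp
        finally have "2 * (- (1 / \<epsilon>) * ip y (d *\<^sub>R u r) + ip (F r) w) \<le>
            2 * (- d * lam / (1 + 2 * \<epsilon> * lam) * ip (u b) (u b) + d / \<epsilon> * (n g)\<^sup>2
              + ip (u b) (F r) + \<epsilon> / d * ip (F r) (F r) + e)" by simp
        also have "\<dots> = K b r + 2 * e"
          unfolding K_def gsq[symmetric] by (simp add: algebra_simps)
        finally show "2 * (- (1 / \<epsilon>) * ip y (d *\<^sub>R u r) + ip (F r) w) \<le> K b r + 2 * e" .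
      qed
      also have "\<dots> = integral {a..b} (K b) + 2 * e * (b - a)"
        using Kint ab by (subst Henstock_Kurzweil_Integration.integral_add) (auto intro: integrable_const_ivl)
      finally have "N 1 \<epsilon> (u b) - N 1 \<epsilon> (u a) \<le> \<eta> + (integral {a..b} (K b) + 2 * e * (b - a))
          + 2 * sqrt \<eta> / \<epsilon> * ?M"
        using w(5) by linarith
      also have "\<dots> = integral {a..b} (K b) + \<eta> + (2 * d / \<epsilon> * sqrt B * (b - a) + 2 / \<epsilon> * ?M) * sqrt \<eta>"
        by (simp add: e_def algebra_simps)
      finally show "N 1 \<epsilon> (u b) - N 1 \<epsilon> (u a) \<le> integral {a..b} (K b) + \<eta>
          + (2 * d / \<epsilon> * sqrt B * (b - a) + 2 / \<epsilon> * ?M) * sqrt \<eta>" .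
    qed
  qed
  also have "integral {s..t} (\<lambda>r. K r r) = integral {s..t} (\<lambda>r. - 2 * d * lam / (1 + 2 * \<epsilon> * lam) * ip (u r) (u r)
       + 2 * ip (F r) (u r) + 2 * \<epsilon> / d * ip (F r) (F r))"
    by (rule integral_cong) (use st nc in \<open>auto simp: K_def ip.commute ip.ncont_mem\<close>)
  finally show ?thesis .
qed

lemma energy:
  assumes ev: "evol u (\<lambda>t. d *\<^sub>R u t) F m Z" and st: "0 \<le> s" "s \<le> t" and d: "d > 0"
  shows "(n (u t))\<^sup>2 - (n (u s))\<^sup>2 \<le>
    integral {s..t} (\<lambda>r. - 2 * d * lam * ip (u r) (u r) + 2 * ip (F r) (u r))"
proof -
  have nc: "ip.ncont u" "ip.ncont F" and Z: "negligible Z"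
    and pV: "\<And>r. r \<ge> 0 \<Longrightarrow> r \<notin> Z \<Longrightarrow> d *\<^sub>R u r \<in> V"
    using ev by (auto simp: evol_def)
  have ut: "u t \<in> L" "u s \<in> L" using nc st by (auto simp: ip.ncont_mem)
  have int: "(\<lambda>r. ip (u r) (u r)) integrable_on {s..t}" "(\<lambda>r. ip (F r) (u r)) integrable_on {s..t}"
      "(\<lambda>r. ip (F r) (F r)) integrable_on {s..t}"
    using nc st by (auto intro: ip.ncont_integrable)
  define U where "U = integral {s..t} (\<lambda>r. ip (u r) (u r))"
  define Y where "Y = integral {s..t} (\<lambda>r. ip (F r) (u r))"
  define X where "X = integral {s..t} (\<lambda>r. ip (F r) (F r))"
  have approx: "\<exists>w\<in>V. n (u t - w) < e" if e: "e > 0" for e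
  proof -
    have "((\<lambda>s. n (u s - u t)) \<longlongrightarrow> 0) (at t within {0..})" using nc st by (auto simp: ip.ncont_def)
    then have "\<forall>\<^sub>F r in at t within {0..}. dist (n (u r - u t)) 0 < e" using e by (rule tendstoD)
    then obtain \<delta> where \<delta>: "\<delta> > 0"
      "\<And>r. r \<ge> 0 \<Longrightarrow> r \<noteq> t \<Longrightarrow> dist r t < \<delta> \<Longrightarrow> \<bar>n (u r - u t)\<bar> < e"
      unfolding eventually_at by auto
    have "\<not> box t (t + \<delta>) \<subseteq> Z"
    proof
      assume "box t (t + \<delta>) \<subseteq> Z"
      then have "negligible (box t (t + \<delta>))" using Z negligible_subset by blast
      then show False using \<delta>(1) negligible_interval(2)[of t "t + \<delta>"] by simp
    qed
    then obtain r where "r \<in> box t (t + \<delta>)" "r \<notin> Z" by blast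
    then have r: "t < r" "r < t + \<delta>" "r \<notin> Z" by auto
    have "d *\<^sub>R u r \<in> V" using pV[of r] r st by auto
    from dr.scale_mem[OF this, of "1 / d"] have "u r \<in> V" using d by simp
    moreover have "n (u t - u r) < e"
      using \<delta>(2)[of r] r st ut(1) ip.n_diff_commute[OF ut(1) VL[OF \<open>u r \<in> V\<close>]] by (auto simp: dist_real_def)
    ultimately show ?thesis by blast
  qed
  have key: "(n (u t))\<^sup>2 - e \<le> (n (u s))\<^sup>2 + (- 2 * d * lam * U + 2 * Y)" if e: "e > 0" for e
  proof -
    obtain w where w: "w \<in> V" "n (u t - w) < sqrt e" using approx[of "sqrt e"] e by auto
    have wL: "w \<in> L" using w(1) by (rule VL)
    have "(n (u t - w))\<^sup>2 \<le> (sqrt e)\<^sup>2"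
      using w(2) ut wL by (intro power_mono) (auto simp: ip.n_nonneg ip.mem)
    then have we: "(n (u t))\<^sup>2 - e \<le> 2 * ip (u t) w - ip w w"
      using e ut wL by (simp add: ip.n_sq ip.mem ip.bilin ip.commute[of w "u t"])
    have le: "(n (u t))\<^sup>2 - e - \<epsilon> * dr w w \<le> (n (u s))\<^sup>2
        + (- 2 * d * lam / (1 + 2 * \<epsilon> * lam) * U + 2 * Y + 2 * \<epsilon> / d * X)" if \<epsilon>: "\<epsilon> > 0" for \<epsilon>
    proof -
      have "(n (u t))\<^sup>2 - e - \<epsilon> * dr w w \<le> 2 * ip (u t) w - fm 1 \<epsilon> w w" using we by (simp add: fm_def)
      also have "\<dots> \<le> N 1 \<epsilon> (u t)" using N_upper[OF _ \<epsilon> ut(1) w(1), of 1] by simp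
      also have "\<dots> \<le> N 1 \<epsilon> (u s) + integral {s..t} (\<lambda>r. - 2 * d * lam / (1 + 2 * \<epsilon> * lam) * ip (u r) (u r)
          + 2 * ip (F r) (u r) + 2 * \<epsilon> / d * ip (F r) (F r))"
        using smoothed_energy[OF ev st d \<epsilon>] by simp
      also have "integral {s..t} (\<lambda>r. - 2 * d * lam / (1 + 2 * \<epsilon> * lam) * ip (u r) (u r)
          + 2 * ip (F r) (u r) + 2 * \<epsilon> / d * ip (F r) (F r))
          = - 2 * d * lam / (1 + 2 * \<epsilon> * lam) * U + 2 * Y + 2 * \<epsilon> / d * X"
        unfolding U_def Y_def X_def
        by (intro integral_unique has_integral_add has_integral_mult_right integrable_integral int)
      also have "N 1 \<epsilon> (u s) \<le> (n (u s))\<^sup>2"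
      proof -
        have "N 1 \<epsilon> (u s) \<le> (n (u s))\<^sup>2 / (1 + \<epsilon> * lam)" using N_le[OF _ \<epsilon> ut(2), of 1] by simp
        also have "\<dots> \<le> (n (u s))\<^sup>2 / 1" using \<epsilon> lam_pos by (intro divide_left_mono) (auto simp: add_pos_pos)
        finally show ?thesis by simp
      qed
      finally show ?thesis by simp
    qed
    show ?thesis
    proof (rule tendsto_le)
      have "((\<lambda>\<epsilon>. (n (u s))\<^sup>2 + (- 2 * d * lam / (1 + 2 * \<epsilon> * lam) * U + 2 * Y + 2 * \<epsilon> / d * X))
          \<longlongrightarrow> (n (u s))\<^sup>2 + (- 2 * d * lam / (1 + 2 * 0 * lam) * U + 2 * Y + 2 * 0 / d * X)) (at_right 0)"
        using d by (intro tendsto_intros) auto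
      then show "((\<lambda>\<epsilon>. (n (u s))\<^sup>2 + (- 2 * d * lam / (1 + 2 * \<epsilon> * lam) * U + 2 * Y + 2 * \<epsilon> / d * X))
          \<longlongrightarrow> (n (u s))\<^sup>2 + (- 2 * d * lam * U + 2 * Y)) (at_right 0)" by simp
      have "((\<lambda>\<epsilon>. (n (u t))\<^sup>2 - e - \<epsilon> * dr w w) \<longlongrightarrow> (n (u t))\<^sup>2 - e - 0 * dr w w) (at_right 0)"
        by (intro tendsto_intros)
      then show "((\<lambda>\<epsilon>. (n (u t))\<^sup>2 - e - \<epsilon> * dr w w) \<longlongrightarrow> (n (u t))\<^sup>2 - e) (at_right 0)" by simp
      show "\<forall>\<^sub>F \<epsilon> in at_right 0. (n (u t))\<^sup>2 - e - \<epsilon> * dr w w \<le> (n (u s))\<^sup>2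
          + (- 2 * d * lam / (1 + 2 * \<epsilon> * lam) * U + 2 * Y + 2 * \<epsilon> / d * X)"
        using le unfolding eventually_at_right_field by (intro exI[of _ 1]) auto
    qed simp
  qed
  have "(n (u t))\<^sup>2 \<le> (n (u s))\<^sup>2 + (- 2 * d * lam * U + 2 * Y)"
    by (rule field_le_epsilon) (use key in \<open>auto simp: field_simps\<close>)
  moreover have "integral {s..t} (\<lambda>r. - 2 * d * lam * ip (u r) (u r) + 2 * ip (F r) (u r)) = - 2 * d * lam * U + 2 * Y"
    unfolding U_def Y_def by (intro integral_unique has_integral_add has_integral_mult_right integrable_integral int)
  ultimately show ?thesis by simp
qed

end

context form_triple
begin

lemma evol_add:
  assumes ev: "evol u p F m Z" and \<theta>: "ip.ncont \<theta>" and G: "ip.ncont G"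
    and eq: "\<And>w s t. w \<in> V \<Longrightarrow> 0 \<le> s \<Longrightarrow> s \<le> t \<Longrightarrow>
      ((\<lambda>r. ip (G r) w) has_integral (ip (\<theta> t) w - ip (\<theta> s) w)) {s..t}"
  shows "evol (\<lambda>t. u t + c *\<^sub>R \<theta> t) p (\<lambda>t. F t + c *\<^sub>R G t) m Z"
proof -
  have nc: "ip.ncont u" "ip.ncont F" using ev by (auto simp: evol_def)
  have "((\<lambda>r. - dr (p r) w + ip (F r + c *\<^sub>R G r) w) has_integral
      (ip (u t + c *\<^sub>R \<theta> t) w - ip (u s + c *\<^sub>R \<theta> s) w)) {s..t}"
    if w: "w \<in> V" and st: "0 \<le> s" "s \<le> t" for w s t
  proof -
    have "((\<lambda>r. (- dr (p r) w + ip (F r) w) + c * ip (G r) w) has_integral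
      ((ip (u t) w - ip (u s) w) + c * (ip (\<theta> t) w - ip (\<theta> s) w))) {s..t}"
      using ev w st eq[OF w st] by (intro has_integral_add has_integral_mult_right) (auto simp: evol_def)
    moreover have "(ip (u t) w - ip (u s) w) + c * (ip (\<theta> t) w - ip (\<theta> s) w)
        = ip (u t + c *\<^sub>R \<theta> t) w - ip (u s + c *\<^sub>R \<theta> s) w"
      using nc \<theta> st VL[OF w] by (simp add: ip.bilin ip.mem ip.ncont_mem algebra_simps)
    ultimately have I: "((\<lambda>r. (- dr (p r) w + ip (F r) w) + c * ip (G r) w) has_integral
      (ip (u t + c *\<^sub>R \<theta> t) w - ip (u s + c *\<^sub>R \<theta> s) w)) {s..t}" by simp
    show ?thesis
      by (rule has_integral_eq[OF _ I]) (use nc G st VL[OF w] in \<open>auto simp: ip.bilin ip.mem ip.ncont_mem\<close>)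
  qed
  then show ?thesis
    using ev \<theta> G by (auto simp: evol_def intro!: ip.ncont_add ip.ncont_scale)
qed

lemma evol_diff:
  assumes ev1: "evol u1 p1 F1 m1 Z1" and ev2: "evol u2 p2 F2 m2 Z2"
  shows "evol (\<lambda>t. u1 t - u2 t) (\<lambda>t. p1 t - p2 t) (\<lambda>t. F1 t - F2 t) (\<lambda>t. 2 * m1 t + 2 * m2 t) (Z1 \<union> Z2)"
proof -
  have nc: "ip.ncont u1" "ip.ncont u2" "ip.ncont p1" "ip.ncont p2" "ip.ncont F1" "ip.ncont F2"
    and Z: "negligible Z1" "negligible Z2"
    and pV1: "\<And>r. r \<ge> 0 \<Longrightarrow> r \<notin> Z1 \<Longrightarrow> p1 r \<in> V \<and> dr (p1 r) (p1 r) \<le> m1 r"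
    and pV2: "\<And>r. r \<ge> 0 \<Longrightarrow> r \<notin> Z2 \<Longrightarrow> p2 r \<in> V \<and> dr (p2 r) (p2 r) \<le> m2 r"
    and mint: "\<And>s t. 0 \<le> s \<Longrightarrow> m1 integrable_on {s..t}" "\<And>s t. 0 \<le> s \<Longrightarrow> m2 integrable_on {s..t}"
    using ev1 ev2 by (auto simp: evol_def)
  have 1: "dr (p1 r - p2 r) (p1 r - p2 r) \<le> 2 * m1 r + 2 * m2 r" if "r \<ge> 0" "r \<notin> Z1 \<union> Z2" for r
  proof -
    have p: "p1 r \<in> V" "p2 r \<in> V" "dr (p1 r) (p1 r) \<le> m1 r" "dr (p2 r) (p2 r) \<le> m2 r"
      using that pV1 pV2 by auto
    have "0 \<le> dr (p1 r + p2 r) (p1 r + p2 r)" using p by (intro dr.nonneg dr.mem)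
    then show ?thesis using p by (simp add: dr.bilin dr.mem)
  qed
  have 2: "((\<lambda>r. - dr (p1 r - p2 r) w + ip (F1 r - F2 r) w) has_integral
      (ip (u1 t - u2 t) w - ip (u1 s - u2 s) w)) {s..t}"
    if w: "w \<in> V" and st: "0 \<le> s" "s \<le> t" for w s t
  proof -
    have "((\<lambda>r. (- dr (p1 r) w + ip (F1 r) w) - (- dr (p2 r) w + ip (F2 r) w)) has_integral
      ((ip (u1 t) w - ip (u1 s) w) - (ip (u2 t) w - ip (u2 s) w))) {s..t}"
      using ev1 ev2 w st by (intro has_integral_diff) (auto simp: evol_def)
    moreover have "(ip (u1 t) w - ip (u1 s) w) - (ip (u2 t) w - ip (u2 s) w)
        = ip (u1 t - u2 t) w - ip (u1 s - u2 s) w"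
      using nc st VL[OF w] by (simp add: ip.bilin ip.ncont_mem)
    ultimately have "((\<lambda>r. (- dr (p1 r) w + ip (F1 r) w) - (- dr (p2 r) w + ip (F2 r) w)) has_integral
      (ip (u1 t - u2 t) w - ip (u1 s - u2 s) w)) {s..t}" by simp
    then show ?thesis
    proof (rule has_integral_spike[rotated 2])
      show "negligible (Z1 \<union> Z2)" using Z by (rule negligible_Un)
      fix r assume r: "r \<in> {s..t} - (Z1 \<union> Z2)"
      then have "p1 r \<in> V" "p2 r \<in> V" "F1 r \<in> L" "F2 r \<in> L"
        using pV1[of r] pV2[of r] nc st by (auto simp: ip.ncont_mem)
      then show "- dr (p1 r - p2 r) w + ip (F1 r - F2 r) w
          = (- dr (p1 r) w + ip (F1 r) w) - (- dr (p2 r) w + ip (F2 r) w)"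
        using w VL[OF w] by (simp add: ip.bilin dr.bilin)
    qed
  qed
  show ?thesis
    unfolding evol_def
    using nc Z 1 2 mint pV1 pV2
    by (auto intro!: ip.ncont_diff negligible_Un dr.diff_mem integrable_add integrable_on_mult_right)
qed

lemma ode_energy:
  assumes \<theta>: "ip.ncont \<theta>" and G: "ip.ncont G" and \<theta>V: "\<And>t. t \<ge> 0 \<Longrightarrow> \<theta> t \<in> V"
    and eq: "\<And>w s t. w \<in> V \<Longrightarrow> 0 \<le> s \<Longrightarrow> s \<le> t \<Longrightarrow>
      ((\<lambda>r. ip (G r) w) has_integral (ip (\<theta> t) w - ip (\<theta> s) w)) {s..t}"
    and st: "0 \<le> s" "s \<le> t"
  shows "(n (\<theta> t))\<^sup>2 - (n (\<theta> s))\<^sup>2 \<le> integral {s..t} (\<lambda>r. 2 * ip (\<theta> r) (G r))"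
proof (rule increment_le_integral_diagonal[where f = "\<lambda>t. (n (\<theta> t))\<^sup>2"
      and K = "\<lambda>t r. 2 * ip (\<theta> t) (G r)", OF st(2)])
  have "continuous_on ({0..} \<times> {0..}) (\<lambda>x. 2 * ip (\<theta> (fst x)) (G (snd x)))"
    using \<theta> G by (intro continuous_intros ip.ncont_continuous_on)
  then show "continuous_on ({s..t} \<times> {s..t}) (\<lambda>x. 2 * ip (\<theta> (fst x)) (G (snd x)))"
    by (rule continuous_on_subset) (use st in auto)
  fix a b assume "s \<le> a" "a \<le> b" "b \<le> t"
  then have ab: "0 \<le> a" "a \<le> b" "0 \<le> b" using st by auto
  have m: "\<theta> a \<in> L" "\<theta> b \<in> L" using ab \<theta>V VL by auto
  have "0 \<le> ip (\<theta> b - \<theta> a) (\<theta> b - \<theta> a)" using m by (intro ip.nonneg ip.mem)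
  then have "(n (\<theta> b))\<^sup>2 - (n (\<theta> a))\<^sup>2 \<le> 2 * (ip (\<theta> b) (\<theta> b) - ip (\<theta> a) (\<theta> b))"
    using m by (simp add: ip.n_sq ip.bilin ip.mem ip.commute[of "\<theta> b" "\<theta> a"])
  also have "ip (\<theta> b) (\<theta> b) - ip (\<theta> a) (\<theta> b) = integral {a..b} (\<lambda>r. ip (G r) (\<theta> b))"
    using eq[OF \<theta>V[OF ab(3)] ab(1,2)] by (simp add: integral_unique)
  also have "2 * \<dots> = integral {a..b} (\<lambda>r. 2 * ip (G r) (\<theta> b))" by simp
  also have "\<dots> = integral {a..b} (\<lambda>r. 2 * ip (\<theta> b) (G r))"
    by (rule integral_cong) (use m G ab in \<open>auto simp: ip.ncont_mem ip.commute[of _ "\<theta> b"]\<close>)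
  finally show "(n (\<theta> b))\<^sup>2 - (n (\<theta> a))\<^sup>2 \<le> integral {a..b} (\<lambda>r. 2 * ip (\<theta> b) (G r))" .
qed

end

lemma negative_definite_form:
  fixes p r k :: real
  assumes "p > 0" "k > 0" "r\<^sup>2 < 4 * p * k"
  shows "\<exists>\<omega>>0. \<forall>x y. - p * x\<^sup>2 + r * (x * y) - k * y\<^sup>2 \<le> - \<omega> * (x\<^sup>2 + y\<^sup>2)"
proof -
  define \<omega> where "\<omega> = (p * k - r\<^sup>2 / 4) / (p + k)"
  have pk: "p + k > 0" using assms by simp
  have pos: "\<omega> > 0" using assms pk by (simp add: \<omega>_def)
  have "\<omega> \<le> p * k / (p + k)" unfolding \<omega>_def using pk by (intro divide_right_mono) auto
  also have "\<dots> < p" using assms pk by (simp add: field_simps)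
  finally have wp: "p - \<omega> > 0" by simp
  have "\<omega> * (p + k) = p * k - r\<^sup>2 / 4" using pk by (simp add: \<omega>_def)
  then have disc: "(p - \<omega>) * (k - \<omega>) - r\<^sup>2 / 4 = \<omega>\<^sup>2" by (simp add: algebra_simps power2_eq_square)
  have "- p * x\<^sup>2 + r * (x * y) - k * y\<^sup>2 \<le> - \<omega> * (x\<^sup>2 + y\<^sup>2)" for x y
  proof -
    have "0 \<le> ((p - \<omega>) * x - r / 2 * y)\<^sup>2 + ((p - \<omega>) * (k - \<omega>) - r\<^sup>2 / 4) * y\<^sup>2"
      unfolding disc by simp
    also have "\<dots> = (p - \<omega>) * ((p - \<omega>) * x\<^sup>2 - r * (x * y) + (k - \<omega>) * y\<^sup>2)"
      by (simp add: power2_eq_square algebra_simps)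
    finally have "0 \<le> (p - \<omega>) * x\<^sup>2 - r * (x * y) + (k - \<omega>) * y\<^sup>2"
      using wp by (simp add: zero_le_mult_iff)
    then show ?thesis by (simp add: algebra_simps)
  qed
  with pos show ?thesis by blast
qed

lemma linear_absorb:
  fixes x c w :: real
  assumes "w > 0"
  shows "c * x \<le> w * x\<^sup>2 + c\<^sup>2 / (4 * w)"
  using young_weighted[of "4 * w" x c] assms by (simp add: mult.commute)

section \<open>The coupled system\<close>

locale coupled_system = form_triple L V ip dr lam
  for L V :: "'v::real_vector set" and ip dr lam +
  fixes d E :: real and h :: 'v and \<Gamma> :: "'v \<Rightarrow> 'v \<Rightarrow> 'v" and K a b C :: real
  assumes d: "d > 0" and E: "E > 0" and h: "h \<in> L" and K: "K \<ge> 0" and b: "b > 0" and ab: "b + a * (E / d) > 0"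
    and \<Gamma>_mem: "v \<in> L \<Longrightarrow> \<tau> \<in> L \<Longrightarrow> \<Gamma> v \<tau> \<in> L"
    and \<Gamma>_lipschitz: "v \<in> L \<Longrightarrow> \<tau> \<in> L \<Longrightarrow> v' \<in> L \<Longrightarrow> \<tau>' \<in> L \<Longrightarrow>
      ip.n (\<Gamma> v \<tau> - \<Gamma> v' \<tau>') \<le> K * (ip.n (v - v') + ip.n (\<tau> - \<tau>'))"
    and \<Gamma>_affine: "v \<in> L \<Longrightarrow> \<tau> \<in> L \<Longrightarrow> ip.n (\<Gamma> v \<tau> - (a *\<^sub>R v - b *\<^sub>R \<tau>)) \<le> C"
begin

definition e where "e = E / d"

lemma e_pos: "e > 0" using d E by (simp add: e_def)

definition sol :: "(real \<Rightarrow> 'v) \<Rightarrow> (real \<Rightarrow> 'v) \<Rightarrow> bool" where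
  "sol v \<tau> \<longleftrightarrow> (\<exists>m Z. evol v (\<lambda>t. d *\<^sub>R v t + E *\<^sub>R \<tau> t) (\<lambda>_. h) m Z) \<and> ip.ncont \<tau> \<and> (\<forall>t\<ge>0. \<tau> t \<in> V) \<and>
     (\<forall>w\<in>V. \<forall>s t. 0 \<le> s \<and> s \<le> t \<longrightarrow>
        ((\<lambda>r. ip (\<Gamma> (v r) (\<tau> r)) w) has_integral (ip (\<tau> t) w - ip (\<tau> s) w)) {s..t})"

lemma sol_ncont: "sol v \<tau> \<Longrightarrow> ip.ncont v" "sol v \<tau> \<Longrightarrow> ip.ncont \<tau>"
  by (auto simp: sol_def evol_def)

lemma ncont_\<Gamma>:
  assumes nc: "ip.ncont v" "ip.ncont \<tau>"
  shows "ip.ncont (\<lambda>t. \<Gamma> (v t) (\<tau> t))"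
  unfolding ip.ncont_def
proof (intro allI impI conjI)
  fix t :: real assume t: "t \<ge> 0"
  then show "\<Gamma> (v t) (\<tau> t) \<in> L" using nc by (intro \<Gamma>_mem) (auto simp: ip.ncont_mem)
  have lim: "((\<lambda>s. K * (n (v s - v t) + n (\<tau> s - \<tau> t))) \<longlongrightarrow> 0) (at t within {0..})"
    using nc t by (intro tendsto_mult_right_zero tendsto_add_zero) (auto simp: ip.ncont_def)
  show "((\<lambda>s. n (\<Gamma> (v s) (\<tau> s) - \<Gamma> (v t) (\<tau> t))) \<longlongrightarrow> 0) (at t within {0..})"
    by (rule Lim_null_comparison[OF _ lim])
      (use nc t in \<open>auto simp: eventually_at_filter ip.n_nonneg ip.diff_mem ip.ncont_mem \<Gamma>_mem intro!: \<Gamma>_lipschitz always_eventually\<close>)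
qed

lemmas sol_ncont_\<Gamma> = ncont_\<Gamma>[OF sol_ncont]

lemma sol_z:
  assumes s: "sol v \<tau>"
  obtains m Z where "evol (\<lambda>t. v t + e *\<^sub>R \<tau> t) (\<lambda>t. d *\<^sub>R (v t + e *\<^sub>R \<tau> t)) (\<lambda>t. h + e *\<^sub>R \<Gamma> (v t) (\<tau> t)) m Z"
proof -
  obtain m Z where "evol v (\<lambda>t. d *\<^sub>R v t + E *\<^sub>R \<tau> t) (\<lambda>_. h) m Z" using s by (auto simp: sol_def)
  then have "evol (\<lambda>t. v t + e *\<^sub>R \<tau> t) (\<lambda>t. d *\<^sub>R v t + E *\<^sub>R \<tau> t) (\<lambda>t. h + e *\<^sub>R \<Gamma> (v t) (\<tau> t)) m Z"
    using s sol_ncont_\<Gamma>[OF s s] by (intro evol_add) (auto simp: sol_def)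
  moreover have "d *\<^sub>R v t + E *\<^sub>R \<tau> t = d *\<^sub>R (v t + e *\<^sub>R \<tau> t)" for t
    using d by (simp add: e_def scaleR_add_right)
  ultimately show ?thesis using that by simp
qed

lemma sol_shift:
  assumes s: "sol v \<tau>" and c: "c \<ge> 0"
  shows "sol (\<lambda>t. v (t + c)) (\<lambda>t. \<tau> (t + c))"
proof -
  have nc: "ip.ncont (\<lambda>t. u (t + c))" if u: "ip.ncont u" for u
    unfolding ip.ncont_def
  proof (intro allI impI conjI)
    fix t :: real assume t: "t \<ge> 0"
    then show "u (t + c) \<in> L" using u c by (simp add: ip.ncont_mem)
    have "continuous (at (t + c) within {0..}) (\<lambda>s. n (u s - u (t + c)))"
      using u t c by (simp add: ip.ncont_def continuous_within)
    then have "continuous (at (t + c) within (\<lambda>s. s + c) ` {0..}) (\<lambda>s. n (u s - u (t + c)))"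
      by (rule continuous_within_subset) (use c in auto)
    moreover have "continuous (at t within {0..}) (\<lambda>s. s + c)" by (intro continuous_intros)
    ultimately have "continuous (at t within {0..}) ((\<lambda>s. n (u s - u (t + c))) \<circ> (\<lambda>s. s + c))"
      by (intro continuous_within_compose)
    then show "((\<lambda>s. n (u (s + c) - u (t + c))) \<longlongrightarrow> 0) (at t within {0..})"
      by (simp add: continuous_within o_def)
  qed
  have hs: "((\<lambda>r. f (r + c)) has_integral I) {s..t}" if "(f has_integral I) {s + c..t + c}" for f :: "real \<Rightarrow> real" and I s t
    using has_integral_shift_real_ivl[OF that, of c] by simp
  obtain m Z where ev: "evol v (\<lambda>t. d *\<^sub>R v t + E *\<^sub>R \<tau> t) (\<lambda>_. h) m Z" using s by (auto simp: sol_def)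
  let ?p = "\<lambda>t. d *\<^sub>R v t + E *\<^sub>R \<tau> t"
  have nv: "ip.ncont v" "ip.ncont ?p" and Z: "negligible Z"
    and pV: "\<And>r. r \<ge> 0 \<Longrightarrow> r \<notin> Z \<Longrightarrow> ?p r \<in> V \<and> dr (?p r) (?p r) \<le> m r"
    and mint: "\<And>s t. 0 \<le> s \<Longrightarrow> m integrable_on {s..t}"
    and eq: "\<And>w s t. w \<in> V \<Longrightarrow> 0 \<le> s \<Longrightarrow> s \<le> t \<Longrightarrow>
      ((\<lambda>r. - dr (?p r) w + ip h w) has_integral (ip (v t) w - ip (v s) w)) {s..t}"
    using ev by (auto simp: evol_def)
  have "evol (\<lambda>t. v (t + c)) (\<lambda>t. ?p (t + c)) (\<lambda>_. h) (\<lambda>t. m (t + c)) ((\<lambda>x. - c + x) ` Z)"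
    unfolding evol_def
  proof (intro conjI allI impI ballI)
    show "ip.ncont (\<lambda>t. v (t + c))" "ip.ncont (\<lambda>t. ?p (t + c))"
      using nc[OF nv(1)] nc[OF nv(2)] by auto
    show "ip.ncont (\<lambda>_. h)" by (rule ip.ncont_const[OF h])
    show "negligible ((\<lambda>x. - c + x) ` Z)" by (rule negligible_translation[OF Z])
    show "(\<lambda>t. m (t + c)) integrable_on {s..t}" if "0 \<le> s" for s t
      using integrable_shift_real_ivl[OF mint[of "s + c" "t + c"], of c] that c by simp
    fix r :: real assume r: "r \<ge> 0" "r \<notin> (\<lambda>x. - c + x) ` Z"
    then have "r + c \<notin> Z" by (auto simp: image_iff)
    then show "?p (r + c) \<in> V" "dr (?p (r + c)) (?p (r + c)) \<le> m (r + c)"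
      using pV[of "r + c"] r c by auto
  next
    fix w s t assume "w \<in> V" "0 \<le> s \<and> s \<le> (t::real)"
    then show "((\<lambda>r. - dr (?p (r + c)) w + ip h w) has_integral (ip (v (t + c)) w - ip (v (s + c)) w)) {s..t}"
      using c by (intro hs eq) auto
  qed
  moreover have "((\<lambda>r. ip (\<Gamma> (v (r + c)) (\<tau> (r + c))) w) has_integral (ip (\<tau> (t + c)) w - ip (\<tau> (s + c)) w)) {s..t}"
    if "w \<in> V" "0 \<le> s" "s \<le> t" for w s t
    by (rule hs[of "\<lambda>r. ip (\<Gamma> (v r) (\<tau> r)) w"]) (use s that c in \<open>auto simp: sol_def\<close>)
  ultimately show ?thesis
    using s c nc[of \<tau>] unfolding sol_def by auto
qed

lemma v_le_z:
  assumes "v \<in> L" "\<tau> \<in> L"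
  shows "(n v)\<^sup>2 \<le> 2 * (n (v + e *\<^sub>R \<tau>))\<^sup>2 + 2 * e\<^sup>2 * (n \<tau>)\<^sup>2"
    and "(n (v + e *\<^sub>R \<tau>))\<^sup>2 \<le> 2 * (n v)\<^sup>2 + 2 * e\<^sup>2 * (n \<tau>)\<^sup>2"
proof -
  have sq: "x\<^sup>2 \<le> 2 * y\<^sup>2 + 2 * e\<^sup>2 * t\<^sup>2" if "x \<le> y + e * t" "x \<ge> 0" for x y t :: real
  proof -
    have "x\<^sup>2 \<le> (y + e * t)\<^sup>2" using that by (intro power_mono)
    moreover have "0 \<le> (y - e * t)\<^sup>2" by simp
    ultimately show ?thesis by (simp add: power2_sum power2_diff power_mult_distrib)
  qed
  have m: "e *\<^sub>R \<tau> \<in> L" using assms by (simp add: ip.mem)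
  have "n (e *\<^sub>R \<tau>) = e * n \<tau>" using assms e_pos by (simp add: ip.n_scale)
  then show "(n v)\<^sup>2 \<le> 2 * (n (v + e *\<^sub>R \<tau>))\<^sup>2 + 2 * e\<^sup>2 * (n \<tau>)\<^sup>2"
    "(n (v + e *\<^sub>R \<tau>))\<^sup>2 \<le> 2 * (n v)\<^sup>2 + 2 * e\<^sup>2 * (n \<tau>)\<^sup>2"
    using ip.n_triangle_diff[of "v + e *\<^sub>R \<tau>" "e *\<^sub>R \<tau>"] ip.n_triangle[of v "e *\<^sub>R \<tau>"] assms m
    by (auto intro!: sq simp: ip.mem ip.n_nonneg)
qed

lemma v_equiv_z:
  assumes "v \<in> L" "\<tau> \<in> L"
  shows "(n v)\<^sup>2 + (n \<tau>)\<^sup>2 \<le> (2 + 2 * e\<^sup>2) * ((n (v + e *\<^sub>R \<tau>))\<^sup>2 + (n \<tau>)\<^sup>2)"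
    and "(n (v + e *\<^sub>R \<tau>))\<^sup>2 + (n \<tau>)\<^sup>2 \<le> (2 + 2 * e\<^sup>2) * ((n v)\<^sup>2 + (n \<tau>)\<^sup>2)"
proof -
  have "x + t \<le> (2 + 2 * e\<^sup>2) * (y + t)" if "x \<le> 2 * y + 2 * e\<^sup>2 * t" "y \<ge> 0" "t \<ge> 0" for x y t :: real
  proof -
    have "0 \<le> t + 2 * e\<^sup>2 * y" using that by simp
    moreover have "(2 + 2 * e\<^sup>2) * (y + t) = (2 * y + 2 * e\<^sup>2 * t) + t + (t + 2 * e\<^sup>2 * y)"
      by (simp add: algebra_simps)
    ultimately show ?thesis using that by linarith
  qed
  with v_le_z[OF assms] show "(n v)\<^sup>2 + (n \<tau>)\<^sup>2 \<le> (2 + 2 * e\<^sup>2) * ((n (v + e *\<^sub>R \<tau>))\<^sup>2 + (n \<tau>)\<^sup>2)"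
    "(n (v + e *\<^sub>R \<tau>))\<^sup>2 + (n \<tau>)\<^sup>2 \<le> (2 + 2 * e\<^sup>2) * ((n v)\<^sup>2 + (n \<tau>)\<^sup>2)"
    by simp_all
qed

lemma lipschitz_dependence:
  assumes s1: "sol v1 \<tau>1" and s2: "sol v2 \<tau>2" and T: "T \<ge> 0"
  shows "(n (v1 T - v2 T))\<^sup>2 + (n (\<tau>1 T - \<tau>2 T))\<^sup>2 \<le>
    (2 + 2 * e\<^sup>2)\<^sup>2 * exp (4 * (1 + e)\<^sup>2 * K * T) * ((n (v1 0 - v2 0))\<^sup>2 + (n (\<tau>1 0 - \<tau>2 0))\<^sup>2)"
proof -
  define w where "w t = v1 t - v2 t" for t
  define \<theta> where "\<theta> t = \<tau>1 t - \<tau>2 t" for t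
  define z where "z t = w t + e *\<^sub>R \<theta> t" for t
  define G where "G t = \<Gamma> (v1 t) (\<tau>1 t) - \<Gamma> (v2 t) (\<tau>2 t)" for t
  note nc = sol_ncont[OF s1] sol_ncont[OF s2] sol_ncont_\<Gamma>[OF s1 s1] sol_ncont_\<Gamma>[OF s2 s2]
  have ncw: "ip.ncont w" "ip.ncont \<theta>" "ip.ncont G"
    unfolding w_def \<theta>_def G_def using nc by (intro ip.ncont_diff; simp)+
  have ncz: "ip.ncont z" unfolding z_def using ncw by (intro ip.ncont_add ip.ncont_scale)
  obtain m1 Z1 where ev1: "evol (\<lambda>t. v1 t + e *\<^sub>R \<tau>1 t) (\<lambda>t. d *\<^sub>R (v1 t + e *\<^sub>R \<tau>1 t)) (\<lambda>t. h + e *\<^sub>R \<Gamma> (v1 t) (\<tau>1 t)) m1 Z1"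
    using sol_z[OF s1] by blast
  obtain m2 Z2 where ev2: "evol (\<lambda>t. v2 t + e *\<^sub>R \<tau>2 t) (\<lambda>t. d *\<^sub>R (v2 t + e *\<^sub>R \<tau>2 t)) (\<lambda>t. h + e *\<^sub>R \<Gamma> (v2 t) (\<tau>2 t)) m2 Z2"
    using sol_z[OF s2] by blast
  have ev: "evol z (\<lambda>t. d *\<^sub>R z t) (\<lambda>t. e *\<^sub>R G t) (\<lambda>t. 2 * m1 t + 2 * m2 t) (Z1 \<union> Z2)"
  proof -
    have "(v1 t + e *\<^sub>R \<tau>1 t) - (v2 t + e *\<^sub>R \<tau>2 t) = z t"
      "d *\<^sub>R (v1 t + e *\<^sub>R \<tau>1 t) - d *\<^sub>R (v2 t + e *\<^sub>R \<tau>2 t) = d *\<^sub>R z t"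
      "(h + e *\<^sub>R \<Gamma> (v1 t) (\<tau>1 t)) - (h + e *\<^sub>R \<Gamma> (v2 t) (\<tau>2 t)) = e *\<^sub>R G t" for t
      by (simp_all add: z_def w_def \<theta>_def G_def algebra_simps)
    then show ?thesis using evol_diff[OF ev1 ev2] by simp
  qed
  have G\<theta>: "((\<lambda>r. ip (G r) y) has_integral (ip (\<theta> t) y - ip (\<theta> s) y)) {s..t}"
    if "y \<in> V" "0 \<le> s" "s \<le> t" for y s t
  proof -
    have "((\<lambda>r. ip (\<Gamma> (v1 r) (\<tau>1 r)) y - ip (\<Gamma> (v2 r) (\<tau>2 r)) y) has_integral
       ((ip (\<tau>1 t) y - ip (\<tau>1 s) y) - (ip (\<tau>2 t) y - ip (\<tau>2 s) y))) {s..t}"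
      using s1 s2 that by (intro has_integral_diff) (auto simp: sol_def)
    moreover have "(ip (\<tau>1 t) y - ip (\<tau>1 s) y) - (ip (\<tau>2 t) y - ip (\<tau>2 s) y) = ip (\<theta> t) y - ip (\<theta> s) y"
      using nc that VL[of y] by (simp add: \<theta>_def ip.bilin ip.ncont_mem)
    ultimately show ?thesis
      by (rule_tac has_integral_eq[rotated])
        (use nc that VL[of y] in \<open>auto simp: G_def ip.bilin ip.ncont_mem \<Gamma>_mem\<close>)
  qed
  define f where "f t = (n (z t))\<^sup>2 + (n (\<theta> t))\<^sup>2" for t
  define H where "H r = (- 2 * d * lam * ip (z r) (z r) + 2 * ip (e *\<^sub>R G r) (z r)) + 2 * ip (\<theta> r) (G r)" for r
  have "f T \<le> exp (- (- (4 * (1 + e)\<^sup>2 * K)) * T) * f 0"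
  proof (rule gronwall_integral[where G = H])
    fix s t :: real assume st: "0 \<le> s" "s \<le> t"
    have "f t - f s \<le> integral {s..t} (\<lambda>r. - 2 * d * lam * ip (z r) (z r) + 2 * ip (e *\<^sub>R G r) (z r))
        + integral {s..t} (\<lambda>r. 2 * ip (\<theta> r) (G r))"
      using energy[OF ev st d] ode_energy[OF ncw(2,3) _ G\<theta> st] s1 s2
      by (auto simp: f_def \<theta>_def sol_def dr.diff_mem)
    also have "\<dots> = integral {s..t} H"
      unfolding H_def using ncz ncw st
      by (intro Henstock_Kurzweil_Integration.integral_add[symmetric] integrable_add integrable_on_mult_right
          ip.ncont_integrable ip.ncont_scale)
    finally show "f t - f s \<le> integral {s..t} H" .
  next
    show "continuous_on {0..} H"
      unfolding H_def using ncz ncw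
      by (intro continuous_intros ip.ncont_continuous_on1 ip.ncont_scale)
  next
    fix t :: real assume t: "t \<ge> 0"
    have m: "z t \<in> L" "\<theta> t \<in> L" "w t \<in> L" "G t \<in> L" using ncz ncw t by (auto simp: ip.ncont_mem)
    define x where "x = n (z t)"
    define y where "y = n (\<theta> t)"
    define g where "g = n (G t)"
    have pos: "x \<ge> 0" "y \<ge> 0" "g \<ge> 0" using m by (auto simp: x_def y_def g_def ip.n_nonneg)
    have "n (w t) \<le> x + e * y"
    proof -
      have "w t = z t - e *\<^sub>R \<theta> t" by (simp add: z_def)
      then show ?thesis using ip.n_triangle_diff[of "z t" "e *\<^sub>R \<theta> t"] m e_pos
        by (simp add: ip.mem ip.n_scale x_def y_def)
    qed
    moreover have "g \<le> K * (n (w t) + y)"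
      unfolding g_def G_def w_def y_def \<theta>_def using nc t by (intro \<Gamma>_lipschitz) (auto simp: ip.ncont_mem)
    ultimately have "g \<le> K * (x + e * y + y)" using K mult_left_mono[of "n (w t) + y" "x + e * y + y" K] by linarith
    also have "\<dots> \<le> K * ((1 + e) * (x + y))"
      using pos e_pos K by (intro mult_left_mono) (auto simp: algebra_simps)
    finally have g: "g \<le> K * (1 + e) * (x + y)" by (simp add: mult.assoc)
    have "H t \<le> 2 * (e * (g * x)) + 2 * (y * g)"
    proof -
      have "- 2 * d * lam * ip (z t) (z t) \<le> 0" using d lam_pos ip.nonneg[OF m(1)] by simp
      moreover have "ip (e *\<^sub>R G t) (z t) \<le> e * (g * x)"
        using ip.cauchy_schwarz_le[OF m(4,1)] e_pos m by (simp add: ip.bilin g_def x_def)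
      moreover have "ip (\<theta> t) (G t) \<le> y * g"
        using ip.cauchy_schwarz_le[OF m(2,4)] by (simp add: g_def y_def)
      ultimately show ?thesis by (simp add: H_def)
    qed
    also have "\<dots> \<le> 2 * ((1 + e) * (x + y)) * g"
      using pos e_pos by (simp add: algebra_simps)
    also have "\<dots> \<le> 2 * ((1 + e) * (x + y)) * (K * (1 + e) * (x + y))"
      using pos e_pos g by (intro mult_left_mono) auto
    also have "\<dots> = 2 * (1 + e)\<^sup>2 * K * (x + y)\<^sup>2" by (simp add: power2_eq_square algebra_simps)
    also have "\<dots> \<le> 2 * (1 + e)\<^sup>2 * K * (2 * (x\<^sup>2 + y\<^sup>2))"
    proof -
      have "0 \<le> (x - y)\<^sup>2" by simp
      then have "(x + y)\<^sup>2 \<le> 2 * (x\<^sup>2 + y\<^sup>2)" by (simp add: power2_sum power2_diff)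
      then show ?thesis using K by (intro mult_left_mono) auto
    qed
    finally show "H t \<le> - (- (4 * (1 + e)\<^sup>2 * K)) * f t" by (simp add: f_def x_def y_def algebra_simps)
  qed (rule T)
  then have fT: "f T \<le> exp (4 * (1 + e)\<^sup>2 * K * T) * f 0" by simp
  define c where "c = 2 + 2 * e\<^sup>2"
  have c: "c \<ge> 0" by (simp add: c_def)
  have m: "w t \<in> L" "\<theta> t \<in> L" if "t \<ge> 0" for t using ncw that by (auto simp: ip.ncont_mem)
  have "(n (w T))\<^sup>2 + (n (\<theta> T))\<^sup>2 \<le> c * f T"
    using v_equiv_z(1)[OF m[OF T]] by (simp add: c_def f_def z_def)
  also have "\<dots> \<le> c * (exp (4 * (1 + e)\<^sup>2 * K * T) * f 0)" using fT c by (rule mult_left_mono)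
  also have "\<dots> \<le> c * (exp (4 * (1 + e)\<^sup>2 * K * T) * (c * ((n (w 0))\<^sup>2 + (n (\<theta> 0))\<^sup>2)))"
  proof -
    have "f 0 \<le> c * ((n (w 0))\<^sup>2 + (n (\<theta> 0))\<^sup>2)"
      using v_equiv_z(2)[OF m[of 0]] by (simp add: c_def f_def z_def)
    then show ?thesis using c by (intro mult_left_mono) auto
  qed
  finally show ?thesis by (simp add: w_def \<theta>_def c_def power2_eq_square algebra_simps)
qed

end

context coupled_system
begin

lemma absorption_of_lyapunov:
  assumes c: "c > 0" and kl: "kl > 0" and M: "M \<ge> 0" and ku: "ku \<ge> 0"
    and lower: "\<And>v \<tau>. v \<in> L \<Longrightarrow> \<tau> \<in> L \<Longrightarrow> kl * ((n v)\<^sup>2 + (n \<tau>)\<^sup>2) \<le> \<Phi> v \<tau>"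
    and upper: "\<And>v \<tau>. v \<in> L \<Longrightarrow> \<tau> \<in> L \<Longrightarrow> \<Phi> v \<tau> \<le> ku * ((n v)\<^sup>2 + (n \<tau>)\<^sup>2)"
    and inc: "\<And>v \<tau> s t. sol v \<tau> \<Longrightarrow> 0 \<le> s \<Longrightarrow> s \<le> t \<Longrightarrow>
       \<Phi> (v t) (\<tau> t) - \<Phi> (v s) (\<tau> s) \<le> integral {s..t} (\<lambda>r. H (v r) (\<tau> r))"
    and cont: "\<And>v \<tau>. sol v \<tau> \<Longrightarrow> continuous_on {0..} (\<lambda>r. H (v r) (\<tau> r))"
    and le: "\<And>v \<tau>. v \<in> L \<Longrightarrow> \<tau> \<in> L \<Longrightarrow> H v \<tau> \<le> - c * \<Phi> v \<tau> + M"
  shows "\<exists>\<rho>. \<forall>R. \<exists>T\<ge>0. \<forall>v \<tau>. sol v \<tau> \<and> (n (v 0))\<^sup>2 + (n (\<tau> 0))\<^sup>2 \<le> R \<longrightarrow>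
    (\<forall>t\<ge>T. (n (v t))\<^sup>2 + (n (\<tau> t))\<^sup>2 \<le> \<rho>)"
proof (rule exI[of _ "(M / c + 1) / kl"], rule allI)
  fix R :: real
  define Q where "Q = ku * \<bar>R\<bar> + 1"
  have Q: "Q > 0" "Q \<ge> 1" using ku by (auto simp: Q_def add_nonneg_pos)
  define T where "T = ln Q / c"
  have T: "T \<ge> 0" using Q c by (simp add: T_def)
  have "(n (v t))\<^sup>2 + (n (\<tau> t))\<^sup>2 \<le> (M / c + 1) / kl"
    if s: "sol v \<tau>" and R: "(n (v 0))\<^sup>2 + (n (\<tau> 0))\<^sup>2 \<le> R" and t: "t \<ge> T" for v \<tau> t
  proof -
    note nc = sol_ncont[OF s]
    have m: "v r \<in> L" "\<tau> r \<in> L" if "r \<ge> 0" for r using nc that by (auto simp: ip.ncont_mem)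
    have t0: "t \<ge> 0" using t T by simp
    define q where "q r = \<Phi> (v r) (\<tau> r) - M / c" for r
    have "q t \<le> exp (- c * t) * q 0"
    proof (rule gronwall_integral[where q = q and c = c, OF _ cont[OF s] _ t0])
      show "q t - q s \<le> integral {s..t} (\<lambda>r. H (v r) (\<tau> r))" if "0 \<le> s" "s \<le> t" for s t
        using inc[OF s that] by (simp add: q_def)
      show "H (v r) (\<tau> r) \<le> - c * q r" if "r \<ge> 0" for r
        using le[OF m[OF that]] c by (simp add: q_def algebra_simps)
    qed
    also have "\<dots> \<le> exp (- c * t) * Q"
    proof (rule mult_left_mono)
      have "\<Phi> (v 0) (\<tau> 0) \<le> ku * ((n (v 0))\<^sup>2 + (n (\<tau> 0))\<^sup>2)" using m by (intro upper) auto
      also have "\<dots> \<le> ku * \<bar>R\<bar>" using R ku by (intro mult_left_mono) auto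
      finally show "q 0 \<le> Q" using divide_nonneg_pos[OF M c] unfolding q_def Q_def by linarith
    qed simp
    also have "\<dots> \<le> 1"
    proof -
      have "ln Q \<le> c * t" using t c by (simp add: T_def field_simps)
      then have "exp (ln Q) \<le> exp (c * t)" by simp
      then show ?thesis using Q by (simp add: exp_minus field_simps)
    qed
    finally have "\<Phi> (v t) (\<tau> t) \<le> M / c + 1" by (simp add: q_def)
    then have "kl * ((n (v t))\<^sup>2 + (n (\<tau> t))\<^sup>2) \<le> M / c + 1" using lower[OF m[OF t0]] by simp
    then show ?thesis using kl by (simp add: field_simps)
  qed
  then show "\<exists>T\<ge>0. \<forall>v \<tau>. sol v \<tau> \<and> (n (v 0))\<^sup>2 + (n (\<tau> 0))\<^sup>2 \<le> R \<longrightarrow>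
    (\<forall>t\<ge>T. (n (v t))\<^sup>2 + (n (\<tau> t))\<^sup>2 \<le> (M / c + 1) / kl)"
    using T by blast
qed

definition Hz :: "'v \<Rightarrow> 'v \<Rightarrow> real" where
  "Hz v \<tau> = - 2 * d * lam * ip (v + e *\<^sub>R \<tau>) (v + e *\<^sub>R \<tau>) + 2 * ip (h + e *\<^sub>R \<Gamma> v \<tau>) (v + e *\<^sub>R \<tau>)"

definition H\<tau> :: "'v \<Rightarrow> 'v \<Rightarrow> real" where
  "H\<tau> v \<tau> = 2 * ip \<tau> (\<Gamma> v \<tau>)"

definition Hv :: "'v \<Rightarrow> 'v \<Rightarrow> real" where
  "Hv v \<tau> = - 2 * ip v (d *\<^sub>R v + E *\<^sub>R \<tau>) + 4 / lam * n h * n v"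

lemma H_continuous:
  assumes "sol v \<tau>"
  shows "continuous_on {0..} (\<lambda>r. Hz (v r) (\<tau> r))" "continuous_on {0..} (\<lambda>r. H\<tau> (v r) (\<tau> r))"
    "continuous_on {0..} (\<lambda>r. Hv (v r) (\<tau> r))"
proof -
  note nc = sol_ncont[OF assms] sol_ncont_\<Gamma>[OF assms assms] h
  show "continuous_on {0..} (\<lambda>r. Hz (v r) (\<tau> r))" unfolding Hz_def
    by (intro continuous_intros ip.ncont_continuous_on1 ip.ncont_add ip.ncont_scale ip.ncont_const nc)
  show "continuous_on {0..} (\<lambda>r. H\<tau> (v r) (\<tau> r))" unfolding H\<tau>_def
    by (intro continuous_intros ip.ncont_continuous_on1 nc)
  show "continuous_on {0..} (\<lambda>r. Hv (v r) (\<tau> r))" unfolding Hv_def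
    by (intro continuous_intros ip.ncont_continuous_on1 ip.ncont_add ip.ncont_scale ip.ncont_n nc)
qed

lemma H_integrable:
  assumes "sol v \<tau>" "0 \<le> s"
  shows "(\<lambda>r. Hz (v r) (\<tau> r)) integrable_on {s..t}" "(\<lambda>r. H\<tau> (v r) (\<tau> r)) integrable_on {s..t}"
    "(\<lambda>r. Hv (v r) (\<tau> r)) integrable_on {s..t}"
  using assms by (auto intro!: integrable_continuous_real continuous_on_subset[OF H_continuous(1)]
      continuous_on_subset[OF H_continuous(2)] continuous_on_subset[OF H_continuous(3)])

lemma H_increments:
  assumes s: "sol v \<tau>" and st: "0 \<le> s" "s \<le> t"
  shows "(n (v t + e *\<^sub>R \<tau> t))\<^sup>2 - (n (v s + e *\<^sub>R \<tau> s))\<^sup>2 \<le> integral {s..t} (\<lambda>r. Hz (v r) (\<tau> r))"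
    and "(n (\<tau> t))\<^sup>2 - (n (\<tau> s))\<^sup>2 \<le> integral {s..t} (\<lambda>r. H\<tau> (v r) (\<tau> r))"
    and "N 0 1 (v t) - N 0 1 (v s) \<le> integral {s..t} (\<lambda>r. Hv (v r) (\<tau> r))"
proof -
  obtain m Z where ev: "evol (\<lambda>t. v t + e *\<^sub>R \<tau> t) (\<lambda>t. d *\<^sub>R (v t + e *\<^sub>R \<tau> t)) (\<lambda>t. h + e *\<^sub>R \<Gamma> (v t) (\<tau> t)) m Z"
    using sol_z[OF s] by blast
  show "(n (v t + e *\<^sub>R \<tau> t))\<^sup>2 - (n (v s + e *\<^sub>R \<tau> s))\<^sup>2 \<le> integral {s..t} (\<lambda>r. Hz (v r) (\<tau> r))"
    unfolding Hz_def by (rule energy[OF ev st d])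
  show "(n (\<tau> t))\<^sup>2 - (n (\<tau> s))\<^sup>2 \<le> integral {s..t} (\<lambda>r. H\<tau> (v r) (\<tau> r))"
    unfolding H\<tau>_def using s by (intro ode_energy[OF sol_ncont(2)[OF s] sol_ncont_\<Gamma>[OF s s] _ _ st]) (auto simp: sol_def)
  obtain m Z where ev: "evol v (\<lambda>t. d *\<^sub>R v t + E *\<^sub>R \<tau> t) (\<lambda>_. h) m Z" using s by (auto simp: sol_def)
  show "N 0 1 (v t) - N 0 1 (v s) \<le> integral {s..t} (\<lambda>r. Hv (v r) (\<tau> r))"
    unfolding Hv_def by (rule dual_energy[OF ev st])
qed

lemma absorption_nonpos:
  assumes a: "a \<le> 0"
  shows "\<exists>\<rho>. \<forall>R. \<exists>T\<ge>0. \<forall>v \<tau>. sol v \<tau> \<and> (n (v 0))\<^sup>2 + (n (\<tau> 0))\<^sup>2 \<le> R \<longrightarrow>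
    (\<forall>t\<ge>T. (n (v t))\<^sup>2 + (n (\<tau> t))\<^sup>2 \<le> \<rho>)"
proof -
  define k where "k = b + a * e"
  have k: "k > 0" using ab by (simp add: k_def e_def)
  define \<delta> where "\<delta> = 2 * d * lam / e"
  have \<delta>: "\<delta> > 0" using d lam_pos e_pos by (simp add: \<delta>_def)
  \<comment> \<open>This weight makes \<open>4 p k - r\<^sup>2 = \<delta>\<^sup>2 - 2 a \<delta>\<close> positive below.\<close>
  define A where "A = (\<delta> - a) / (e * k)"
  have A: "A > 0" using \<delta> a k e_pos by (simp add: A_def)
  define p where "p = A * (d * lam - e * a)"
  have "d * lam > 0" "e * a \<le> 0" using d lam_pos e_pos a by (auto simp: mult_nonneg_nonpos)
  then have p: "p > 0" unfolding p_def using A by (intro mult_pos_pos) auto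
  define r where "r = \<bar>a - A * e * k\<bar>"
  have "r\<^sup>2 < 4 * p * k"
  proof -
    have Ak: "A * e * k = \<delta> - a" using k e_pos by (simp add: A_def)
    have dl: "d * lam = e * \<delta> / 2" using e_pos by (simp add: \<delta>_def)
    have "4 * p * k = 4 * (A * e * k) * (\<delta> / 2 - a)" by (simp add: p_def dl algebra_simps)
    also have "\<dots> = 4 * (\<delta> - a) * (\<delta> / 2 - a)" by (simp add: Ak)
    also have "\<dots> = (a - (\<delta> - a))\<^sup>2 + \<delta>\<^sup>2 - 2 * a * \<delta>"
      by (simp add: power2_eq_square algebra_simps)
    also have "(a - (\<delta> - a))\<^sup>2 = r\<^sup>2" unfolding r_def Ak by simp
    finally have "4 * p * k = r\<^sup>2 + \<delta>\<^sup>2 - 2 * a * \<delta>" .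
    moreover have "a * \<delta> \<le> 0" "\<delta>\<^sup>2 > 0" using \<delta> a by (auto simp: mult_nonpos_nonneg)
    ultimately show ?thesis by linarith
  qed
  then obtain \<omega> where \<omega>: "\<omega> > 0" "\<And>x y. - p * x\<^sup>2 + r * (x * y) - k * y\<^sup>2 \<le> - \<omega> * (x\<^sup>2 + y\<^sup>2)"
    using negative_definite_form[OF p k, of r] by blast
  define c1 where "c1 = 2 * A * n h + 2 * A * e * C"
  define M where "M = c1\<^sup>2 / (4 * \<omega>) + (2 * C)\<^sup>2 / (4 * \<omega>)"
  let ?\<Phi> = "\<lambda>v \<tau>. A * (n (v + e *\<^sub>R \<tau>))\<^sup>2 + (n \<tau>)\<^sup>2"
  let ?c = "2 + 2 * e\<^sup>2"
  define mi where "mi = min A 1"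
  have mi: "mi > 0" "mi \<le> A" "mi \<le> 1" using A by (auto simp: mi_def)
  have cp: "?c > 0" by (simp add: add_pos_nonneg)
  show ?thesis
  proof (rule absorption_of_lyapunov[where \<Phi> = ?\<Phi> and H = "\<lambda>v \<tau>. A * Hz v \<tau> + H\<tau> v \<tau>"
        and c = "\<omega> / (A + 1)" and M = M and kl = "mi / ?c" and ku = "(A + 1) * ?c"])
    show "\<omega> / (A + 1) > 0" "M \<ge> 0" "mi / ?c > 0" "(A + 1) * ?c \<ge> 0"
      using \<omega> A mi cp by (auto simp: M_def)
  next
    fix v \<tau> assume m: "v \<in> L" "\<tau> \<in> L"
    let ?S = "(n (v + e *\<^sub>R \<tau>))\<^sup>2 + (n \<tau>)\<^sup>2"
    have "(n v)\<^sup>2 + (n \<tau>)\<^sup>2 \<le> ?c * ?S" by (rule v_equiv_z(1)[OF m])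
    then have "mi / ?c * ((n v)\<^sup>2 + (n \<tau>)\<^sup>2) \<le> mi / ?c * (?c * ?S)"
      using mi cp by (intro mult_left_mono) auto
    also have "\<dots> = mi * ?S" using cp by simp
    also have "\<dots> \<le> ?\<Phi> v \<tau>" unfolding distrib_left using mi by (intro add_mono mult_right_mono mult_left_le_one_le) auto
    finally show "mi / ?c * ((n v)\<^sup>2 + (n \<tau>)\<^sup>2) \<le> ?\<Phi> v \<tau>" .
    have \<Phi>S: "?\<Phi> v \<tau> \<le> (A + 1) * ?S" using A by (simp add: algebra_simps)
    also have "\<dots> \<le> (A + 1) * (?c * ((n v)\<^sup>2 + (n \<tau>)\<^sup>2))"
      using v_equiv_z(2)[OF m] A by (intro mult_left_mono) auto
    finally show "?\<Phi> v \<tau> \<le> (A + 1) * ?c * ((n v)\<^sup>2 + (n \<tau>)\<^sup>2)" by (simp add: mult.assoc)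
    define z where "z = v + e *\<^sub>R \<tau>"
    have z: "z \<in> L" using m by (simp add: z_def ip.mem)
    define g where "g = \<Gamma> v \<tau> - (a *\<^sub>R v - b *\<^sub>R \<tau>)"
    have g: "g \<in> L" "n g \<le> C" unfolding g_def using m \<Gamma>_mem[OF m] \<Gamma>_affine[OF m] by (auto simp: ip.mem)
    define X where "X = n z"
    define Y where "Y = n \<tau>"
    have XY: "X \<ge> 0" "Y \<ge> 0" using z m by (auto simp: X_def Y_def ip.n_nonneg)
    have \<Gamma>: "\<Gamma> v \<tau> = (a *\<^sub>R z - k *\<^sub>R \<tau>) + g"
      by (simp add: g_def z_def k_def algebra_simps)
    have "A * Hz v \<tau> + H\<tau> v \<tau> = 2 * (- p * X\<^sup>2 + (a - A * e * k) * ip z \<tau> - k * Y\<^sup>2)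
        + 2 * A * ip h z + 2 * A * e * ip g z + 2 * ip \<tau> g"
      unfolding Hz_def H\<tau>_def z_def[symmetric] \<Gamma> X_def Y_def
      using z m g h by (simp add: ip.bilin ip.mem ip.n_sq p_def ip.commute[of \<tau> z] algebra_simps)
    also have "\<dots> \<le> 2 * (- p * X\<^sup>2 + r * (X * Y) - k * Y\<^sup>2) + 2 * A * (n h * X) + 2 * A * e * (C * X) + 2 * (Y * C)"
    proof -
      have f1: "(a - A * e * k) * ip z \<tau> \<le> r * (X * Y)"
      proof -
        have "(a - A * e * k) * ip z \<tau> \<le> r * \<bar>ip z \<tau>\<bar>"
          unfolding r_def by (metis abs_ge_self abs_mult)
        also have "\<dots> \<le> r * (X * Y)"
          using ip.cauchy_schwarz[OF z m(2)] by (intro mult_left_mono) (auto simp: r_def X_def Y_def)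
        finally show ?thesis .
      qed
      have f2: "2 * A * ip h z \<le> 2 * A * (n h * X)"
        using ip.cauchy_schwarz_le[OF h z] A by (intro mult_left_mono) (auto simp: X_def)
      have "ip g z \<le> C * X"
        using ip.cauchy_schwarz_le[OF g(1) z] mult_right_mono[OF g(2) XY(1)] by (simp add: X_def)
      then have f3: "2 * A * e * ip g z \<le> 2 * A * e * (C * X)"
        using A e_pos by (intro mult_left_mono) auto
      have f4: "ip \<tau> g \<le> Y * C"
        using ip.cauchy_schwarz_le[OF m(2) g(1)] mult_left_mono[OF g(2) XY(2)] by (simp add: Y_def)
      have "2 * (x - y1 - y2) + x2 + x3 + 2 * x4 \<le> 2 * (x' - y1 - y2) + x2' + x3' + 2 * x4'"
        if "x \<le> x'" "x2 \<le> x2'" "x3 \<le> x3'" "x4 \<le> x4'" for x x' x2 x2' x3 x3' x4 x4' y1 y2 :: real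
        using that by (intro add_mono mult_left_mono diff_right_mono) auto
      from this[OF f1 f2 f3 f4, of "p * X\<^sup>2" "k * Y\<^sup>2"] show ?thesis by simp
    qed
    also have "\<dots> \<le> 2 * (- \<omega> * (X\<^sup>2 + Y\<^sup>2)) + (c1 * X + (2 * C) * Y)"
      using \<omega>(2)[of X Y] by (simp add: c1_def algebra_simps)
    also have "\<dots> \<le> 2 * (- \<omega> * (X\<^sup>2 + Y\<^sup>2)) + ((\<omega> * X\<^sup>2 + c1\<^sup>2 / (4 * \<omega>)) + (\<omega> * Y\<^sup>2 + (2 * C)\<^sup>2 / (4 * \<omega>)))"
      using \<omega>(1) by (intro add_left_mono add_mono linear_absorb)
    also have "\<dots> = - \<omega> * ?S + M" by (simp add: M_def X_def Y_def z_def algebra_simps)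
    also have "\<dots> \<le> - (\<omega> / (A + 1)) * ?\<Phi> v \<tau> + M"
    proof -
      have "\<omega> / (A + 1) * ?\<Phi> v \<tau> \<le> \<omega> / (A + 1) * ((A + 1) * ?S)"
        using \<Phi>S \<omega> A by (intro mult_left_mono) auto
      also have "\<dots> = \<omega> * ?S" using A by simp
      finally show ?thesis by simp
    qed
    finally show "A * Hz v \<tau> + H\<tau> v \<tau> \<le> - (\<omega> / (A + 1)) * ?\<Phi> v \<tau> + M" .
  next
    fix v \<tau> and s t :: real assume s: "sol v \<tau>" and st: "0 \<le> s" "s \<le> t"
    have "?\<Phi> (v t) (\<tau> t) - ?\<Phi> (v s) (\<tau> s) = A * ((n (v t + e *\<^sub>R \<tau> t))\<^sup>2 - (n (v s + e *\<^sub>R \<tau> s))\<^sup>2)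
        + ((n (\<tau> t))\<^sup>2 - (n (\<tau> s))\<^sup>2)" by (simp add: algebra_simps)
    also have "\<dots> \<le> A * integral {s..t} (\<lambda>r. Hz (v r) (\<tau> r)) + integral {s..t} (\<lambda>r. H\<tau> (v r) (\<tau> r))"
      using H_increments[OF s st] A by (intro add_mono mult_left_mono) auto
    also have "\<dots> = integral {s..t} (\<lambda>r. A * Hz (v r) (\<tau> r) + H\<tau> (v r) (\<tau> r))"
      using H_integrable[OF s st(1)]
      by (intro integral_unique[symmetric] has_integral_add has_integral_mult_right integrable_integral)
    finally show "?\<Phi> (v t) (\<tau> t) - ?\<Phi> (v s) (\<tau> s) \<le> integral {s..t} (\<lambda>r. A * Hz (v r) (\<tau> r) + H\<tau> (v r) (\<tau> r))" .
  next
    fix v \<tau> assume "sol v \<tau>"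
    then show "continuous_on {0..} (\<lambda>r. A * Hz (v r) (\<tau> r) + H\<tau> (v r) (\<tau> r))"
      by (intro continuous_intros H_continuous)
  qed
qed

text \<open>For \<open>a > 0\<close> no combination of the two \<open>L\<^sub>2\<close> norms need be a Lyapunov function; in the combination
  of the dual norm of \<open>v\<close> and the norm of \<open>\<tau>\<close> used here the cross terms cancel.\<close>

lemma absorption_pos:
  assumes a: "a > 0"
  shows "\<exists>\<rho>. \<forall>R. \<exists>T\<ge>0. \<forall>v \<tau>. sol v \<tau> \<and> (n (v 0))\<^sup>2 + (n (\<tau> 0))\<^sup>2 \<le> R \<longrightarrow>
    (\<forall>t\<ge>T. (n (v t))\<^sup>2 + (n (\<tau> t))\<^sup>2 \<le> \<rho>)"
proof -
  define D where "D = d * lam"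
  have D: "D > 0" using d lam_pos by (simp add: D_def)
  define k where "k = min (d * D / (3 * e\<^sup>2 * a)) (E * D / (3 * e\<^sup>2 * b))"
  have k: "k > 0" using a b d E D e_pos by (simp add: k_def)
  have k1: "k * (3 * e\<^sup>2 * a\<^sup>2 / D) \<le> a * d"
  proof -
    have "k * (3 * e\<^sup>2 * a\<^sup>2 / D) \<le> (d * D / (3 * e\<^sup>2 * a)) * (3 * e\<^sup>2 * a\<^sup>2 / D)"
      using D by (intro mult_right_mono) (auto simp: k_def)
    also have "\<dots> = a * d" using D a e_pos by (simp add: power2_eq_square)
    finally show ?thesis .
  qed
  have k2: "k * (3 * e\<^sup>2 * b\<^sup>2 / D) \<le> E * b"
  proof -
    have "k * (3 * e\<^sup>2 * b\<^sup>2 / D) \<le> (E * D / (3 * e\<^sup>2 * b)) * (3 * e\<^sup>2 * b\<^sup>2 / D)"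
      using D by (intro mult_right_mono) (auto simp: k_def)
    also have "\<dots> = E * b" using D b e_pos by (simp add: power2_eq_square)
    finally show ?thesis .
  qed
  let ?\<Phi> = "\<lambda>v \<tau>. a * N 0 1 v + E * (n \<tau>)\<^sup>2 + k * (n (v + e *\<^sub>R \<tau>))\<^sup>2"
  let ?H = "\<lambda>v \<tau>. a * Hv v \<tau> + E * H\<tau> v \<tau> + k * Hz v \<tau>"
  define w where "w = min (a * d / 2) (min (E * b / 2) (k * D / 2))"
  have w: "w > 0" "w \<le> a * d / 2" "w \<le> E * b / 2" "w \<le> k * D / 2" using a b d E D k by (auto simp: w_def)
  define q where "q = a / lam + E + k"
  have q: "q > 0" using a lam_pos E k by (simp add: q_def add_pos_pos)
  define cv where "cv = 4 * a / lam * n h"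
  define ct where "ct = 2 * E * C"
  define cz where "cz = 2 * k * n h"
  define M where "M = cv\<^sup>2 / (4 * w) + ct\<^sup>2 / (4 * w) + cz\<^sup>2 / (4 * w) + k * (3 * e\<^sup>2 * C\<^sup>2 / D)"
  let ?c = "2 + 2 * e\<^sup>2"
  have cp: "?c > 0" by (simp add: add_pos_nonneg)
  define mi where "mi = min E k"
  have mi: "mi > 0" "mi \<le> E" "mi \<le> k" using E k by (auto simp: mi_def)
  have N0: "0 \<le> N 0 1 v" "N 0 1 v \<le> (n v)\<^sup>2 / lam" if "v \<in> L" for v
    using N_nonneg[of 0 1 v] N_le[of 0 1 v] that by auto
  show ?thesis
  proof (rule absorption_of_lyapunov[where \<Phi> = ?\<Phi> and H = ?H
        and c = "w / q" and M = M and kl = "mi / ?c" and ku = "q * (?c + 1)"])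
    show "w / q > 0" "M \<ge> 0" "mi / ?c > 0" "q * (?c + 1) \<ge> 0"
      using w q mi cp k D by (auto simp: M_def)
  next
    fix v \<tau> assume m: "v \<in> L" "\<tau> \<in> L"
    define z where "z = v + e *\<^sub>R \<tau>"
    have z: "z \<in> L" using m by (simp add: z_def ip.mem)
    define U where "U = n v"
    define X where "X = n z"
    define Y where "Y = n \<tau>"
    have XY: "U \<ge> 0" "X \<ge> 0" "Y \<ge> 0" using z m by (auto simp: U_def X_def Y_def ip.n_nonneg)
    have aN: "0 \<le> a * N 0 1 v" "a * N 0 1 v \<le> a / lam * U\<^sup>2"
      using N0[OF m(1)] a mult_left_mono[OF N0(2)[OF m(1)], of a] by (auto simp: U_def)
    have "U\<^sup>2 + Y\<^sup>2 \<le> ?c * (X\<^sup>2 + Y\<^sup>2)" using v_equiv_z(1)[OF m] by (simp add: U_def X_def Y_def z_def)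
    then have "mi / ?c * (U\<^sup>2 + Y\<^sup>2) \<le> mi / ?c * (?c * (X\<^sup>2 + Y\<^sup>2))"
      using mi cp by (intro mult_left_mono) auto
    also have "\<dots> = mi * Y\<^sup>2 + mi * X\<^sup>2" using cp by (simp add: distrib_left)
    also have "\<dots> \<le> E * Y\<^sup>2 + k * X\<^sup>2" using mi by (intro add_mono mult_right_mono) auto
    also have "\<dots> \<le> ?\<Phi> v \<tau>" using aN by (simp add: X_def Y_def z_def)
    finally show "mi / ?c * ((n v)\<^sup>2 + (n \<tau>)\<^sup>2) \<le> ?\<Phi> v \<tau>" by (simp add: U_def Y_def)
    have \<Phi>S: "?\<Phi> v \<tau> \<le> q * (U\<^sup>2 + Y\<^sup>2 + X\<^sup>2)"
    proof -
      have "?\<Phi> v \<tau> \<le> a / lam * U\<^sup>2 + E * Y\<^sup>2 + k * X\<^sup>2" using aN by (simp add: X_def Y_def z_def)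
      also have "\<dots> \<le> q * U\<^sup>2 + q * Y\<^sup>2 + q * X\<^sup>2"
        using a E k lam_pos by (intro add_mono mult_right_mono) (auto simp: q_def)
      finally show ?thesis by (simp add: distrib_left)
    qed
    also have "\<dots> \<le> q * ((?c + 1) * (U\<^sup>2 + Y\<^sup>2))"
    proof (rule mult_left_mono)
      have "X\<^sup>2 \<le> ?c * (U\<^sup>2 + Y\<^sup>2)"
        using v_equiv_z(2)[OF m] zero_le_power2[of "n \<tau>"] unfolding U_def X_def Y_def z_def by linarith
      then show "U\<^sup>2 + Y\<^sup>2 + X\<^sup>2 \<le> (?c + 1) * (U\<^sup>2 + Y\<^sup>2)" by (simp add: distrib_right)
    qed (use q in simp)
    finally show "?\<Phi> v \<tau> \<le> q * (?c + 1) * ((n v)\<^sup>2 + (n \<tau>)\<^sup>2)" by (simp add: mult.assoc U_def Y_def)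
    define g where "g = \<Gamma> v \<tau> - (a *\<^sub>R v - b *\<^sub>R \<tau>)"
    have g: "g \<in> L" "n g \<le> C" unfolding g_def using m \<Gamma>_mem[OF m] \<Gamma>_affine[OF m] by (auto simp: ip.mem)
    have \<Gamma>: "\<Gamma> v \<tau> = (a *\<^sub>R v - b *\<^sub>R \<tau>) + g" by (simp add: g_def)
    define Q where "Q = n (\<Gamma> v \<tau>)"
    have Q0: "Q \<ge> 0" unfolding Q_def by (rule ip.n_nonneg[OF \<Gamma>_mem[OF m]])
    have "Q \<le> a * U + b * Y + C"
    proof -
      have "Q \<le> n (a *\<^sub>R v - b *\<^sub>R \<tau>) + n g"
        unfolding Q_def \<Gamma> using m g by (intro ip.n_triangle ip.mem)
      also have "n (a *\<^sub>R v - b *\<^sub>R \<tau>) \<le> a * U + b * Y"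
        using ip.n_triangle_diff[of "a *\<^sub>R v" "b *\<^sub>R \<tau>"] m a b by (simp add: ip.mem ip.n_scale U_def Y_def)
      finally show ?thesis using g by simp
    qed
    then have "Q\<^sup>2 \<le> (a * U + b * Y + C)\<^sup>2" using Q0 by (intro power_mono)
    also have "\<dots> \<le> 3 * (a\<^sup>2 * U\<^sup>2 + b\<^sup>2 * Y\<^sup>2 + C\<^sup>2)"
    proof -
      have "(x + y + c)\<^sup>2 \<le> 3 * (x\<^sup>2 + y\<^sup>2 + c\<^sup>2)" for x y c :: real
      proof -
        have "0 \<le> (x - y)\<^sup>2 + (y - c)\<^sup>2 + (x - c)\<^sup>2" by simp
        then show ?thesis by (simp add: power2_eq_square algebra_simps)
      qed
      from this[of "a * U" "b * Y" C] show ?thesis by (simp add: power_mult_distrib)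
    qed
    finally have Q2: "Q\<^sup>2 \<le> 3 * (a\<^sup>2 * U\<^sup>2 + b\<^sup>2 * Y\<^sup>2 + C\<^sup>2)" .
    have 1: "a * Hv v \<tau> + E * H\<tau> v \<tau> = - 2 * a * d * U\<^sup>2 - 2 * E * b * Y\<^sup>2 + cv * U + 2 * E * ip \<tau> g"
      unfolding Hv_def H\<tau>_def \<Gamma> using m g
      by (simp add: ip.bilin ip.mem ip.n_sq U_def Y_def cv_def ip.commute[of \<tau> v] algebra_simps)
    have 2: "2 * E * ip \<tau> g \<le> ct * Y"
    proof -
      have "ip \<tau> g \<le> Y * C"
        using ip.cauchy_schwarz_le[OF m(2) g(1)] mult_left_mono[OF g(2) XY(3)] by (simp add: Y_def)
      then have "2 * E * ip \<tau> g \<le> 2 * E * (Y * C)" using E by (intro mult_left_mono) auto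
      then show ?thesis by (simp add: ct_def algebra_simps)
    qed
    have 3: "k * Hz v \<tau> \<le> - k * D * X\<^sup>2 + cz * X + (a * d * U\<^sup>2 + E * b * Y\<^sup>2 + k * (3 * e\<^sup>2 * C\<^sup>2 / D))"
    proof -
      have "Hz v \<tau> = - 2 * D * X\<^sup>2 + 2 * ip h z + 2 * e * ip (\<Gamma> v \<tau>) z"
        unfolding Hz_def z_def[symmetric] using z h \<Gamma>_mem[OF m]
        by (simp add: ip.bilin ip.mem D_def X_def ip.n_sq)
      also have "\<dots> \<le> - 2 * D * X\<^sup>2 + 2 * (n h * X) + (D * X\<^sup>2 + e\<^sup>2 / D * Q\<^sup>2)"
      proof -
        have "e * ip (\<Gamma> v \<tau>) z \<le> e * (Q * X)"
          using ip.cauchy_schwarz_le[OF \<Gamma>_mem[OF m] z] e_pos by (intro mult_left_mono) (auto simp: Q_def X_def)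
        moreover have "(2 * (e * Q)) * X \<le> D * X\<^sup>2 + (2 * (e * Q))\<^sup>2 / (4 * D)"
          using D by (rule linear_absorb)
        ultimately have "2 * e * ip (\<Gamma> v \<tau>) z \<le> D * X\<^sup>2 + e\<^sup>2 / D * Q\<^sup>2"
          by (simp add: power_mult_distrib algebra_simps)
        moreover have "ip h z \<le> n h * X" using ip.cauchy_schwarz_le[OF h z] by (simp add: X_def)
        ultimately show ?thesis by linarith
      qed
      also have "\<dots> \<le> - 2 * D * X\<^sup>2 + 2 * (n h * X) + (D * X\<^sup>2 + e\<^sup>2 / D * (3 * (a\<^sup>2 * U\<^sup>2 + b\<^sup>2 * Y\<^sup>2 + C\<^sup>2)))"
        using Q2 D by (intro add_left_mono mult_left_mono) auto
      also have "\<dots> = - D * X\<^sup>2 + 2 * n h * X + ((3 * e\<^sup>2 * a\<^sup>2 / D) * U\<^sup>2 + (3 * e\<^sup>2 * b\<^sup>2 / D) * Y\<^sup>2 + 3 * e\<^sup>2 * C\<^sup>2 / D)"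
        using D by (simp add: field_simps)
      finally have "k * Hz v \<tau> \<le> k * (- D * X\<^sup>2 + 2 * n h * X + ((3 * e\<^sup>2 * a\<^sup>2 / D) * U\<^sup>2 + (3 * e\<^sup>2 * b\<^sup>2 / D) * Y\<^sup>2 + 3 * e\<^sup>2 * C\<^sup>2 / D))"
        using k by (intro mult_left_mono) auto
      also have "\<dots> = - k * D * X\<^sup>2 + cz * X + ((k * (3 * e\<^sup>2 * a\<^sup>2 / D)) * U\<^sup>2 + (k * (3 * e\<^sup>2 * b\<^sup>2 / D)) * Y\<^sup>2 + k * (3 * e\<^sup>2 * C\<^sup>2 / D))"
        by (simp add: cz_def algebra_simps)
      also have "\<dots> \<le> - k * D * X\<^sup>2 + cz * X + ((a * d) * U\<^sup>2 + (E * b) * Y\<^sup>2 + k * (3 * e\<^sup>2 * C\<^sup>2 / D))"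
        using k1 k2 by (intro add_left_mono add_right_mono add_mono mult_right_mono) auto
      finally show ?thesis .
    qed
    have "?H v \<tau> \<le> - a * d * U\<^sup>2 - E * b * Y\<^sup>2 - k * D * X\<^sup>2 + cv * U + ct * Y + cz * X + k * (3 * e\<^sup>2 * C\<^sup>2 / D)"
      using 1 2 3 by linarith
    also have "\<dots> \<le> - (2 * w) * U\<^sup>2 - (2 * w) * Y\<^sup>2 - (2 * w) * X\<^sup>2 + (w * U\<^sup>2 + cv\<^sup>2 / (4 * w))
        + (w * Y\<^sup>2 + ct\<^sup>2 / (4 * w)) + (w * X\<^sup>2 + cz\<^sup>2 / (4 * w)) + k * (3 * e\<^sup>2 * C\<^sup>2 / D)"
    proof -
      have "(2 * w) * U\<^sup>2 \<le> (a * d) * U\<^sup>2" "(2 * w) * Y\<^sup>2 \<le> (E * b) * Y\<^sup>2" "(2 * w) * X\<^sup>2 \<le> (k * D) * X\<^sup>2"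
        using w by (intro mult_right_mono; simp)+
      then show ?thesis using linear_absorb[OF w(1), of cv U] linear_absorb[OF w(1), of ct Y] linear_absorb[OF w(1), of cz X]
        by linarith
    qed
    also have "\<dots> = - w * (U\<^sup>2 + Y\<^sup>2 + X\<^sup>2) + M" by (simp add: M_def algebra_simps)
    also have "\<dots> \<le> - (w / q) * ?\<Phi> v \<tau> + M"
    proof -
      have "w / q * ?\<Phi> v \<tau> \<le> w / q * (q * (U\<^sup>2 + Y\<^sup>2 + X\<^sup>2))"
        using \<Phi>S w q by (intro mult_left_mono) auto
      also have "\<dots> = w * (U\<^sup>2 + Y\<^sup>2 + X\<^sup>2)" using q by simp
      finally show ?thesis by simp
    qed
    finally show "?H v \<tau> \<le> - (w / q) * ?\<Phi> v \<tau> + M" .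
  next
    fix v \<tau> and s t :: real assume s: "sol v \<tau>" and st: "0 \<le> s" "s \<le> t"
    have "?\<Phi> (v t) (\<tau> t) - ?\<Phi> (v s) (\<tau> s) = a * (N 0 1 (v t) - N 0 1 (v s)) + E * ((n (\<tau> t))\<^sup>2 - (n (\<tau> s))\<^sup>2)
        + k * ((n (v t + e *\<^sub>R \<tau> t))\<^sup>2 - (n (v s + e *\<^sub>R \<tau> s))\<^sup>2)"
      by (simp add: algebra_simps)
    also have "\<dots> \<le> a * integral {s..t} (\<lambda>r. Hv (v r) (\<tau> r)) + E * integral {s..t} (\<lambda>r. H\<tau> (v r) (\<tau> r))
        + k * integral {s..t} (\<lambda>r. Hz (v r) (\<tau> r))"
      using H_increments[OF s st] a E k by (intro add_mono mult_left_mono) auto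
    also have "\<dots> = integral {s..t} (\<lambda>r. ?H (v r) (\<tau> r))"
      using H_integrable[OF s st(1)]
      by (intro integral_unique[symmetric] has_integral_add has_integral_mult_right integrable_integral)
    finally show "?\<Phi> (v t) (\<tau> t) - ?\<Phi> (v s) (\<tau> s) \<le> integral {s..t} (\<lambda>r. ?H (v r) (\<tau> r))" .
  next
    fix v \<tau> assume "sol v \<tau>"
    then show "continuous_on {0..} (\<lambda>r. ?H (v r) (\<tau> r))"
      by (intro continuous_intros H_continuous)
  qed
qed

lemma absorption:
  "\<exists>\<rho>. \<forall>R. \<exists>T\<ge>0. \<forall>v \<tau>. sol v \<tau> \<and> (n (v 0))\<^sup>2 + (n (\<tau> 0))\<^sup>2 \<le> R \<longrightarrow>
    (\<forall>t\<ge>T. (n (v t))\<^sup>2 + (n (\<tau> t))\<^sup>2 \<le> \<rho>)"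
  by (cases "a \<le> 0") (auto intro: absorption_nonpos absorption_pos)

end

section \<open>Test functions\<close>

definition C1 :: "('a::euclidean_space \<Rightarrow> real) \<Rightarrow> bool" where
  "C1 f \<longleftrightarrow> (\<exists>G. (\<forall>x. (f has_derivative (\<lambda>h. G x \<bullet> h)) (at x)) \<and> continuous_on UNIV G)"

lemma C1_continuous: "C1 f \<Longrightarrow> continuous_on UNIV f"
  unfolding C1_def by (meson continuous_at_imp_continuous_on has_derivative_continuous)

lemma C1_const: "C1 (\<lambda>_. c)"
proof -
  have "(\<bullet>) (0::'a) = (\<lambda>_. 0)" by auto
  then show ?thesis unfolding C1_def by (intro exI[of _ "\<lambda>_. 0"]) auto
qed

lemma C1_mult:
  assumes "C1 f" "C1 g"
  shows "C1 (\<lambda>x. f x * g x)"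
proof -
  obtain F G where F: "\<And>x. (f has_derivative (\<lambda>h. F x \<bullet> h)) (at x)" "continuous_on UNIV F"
    and G: "\<And>x. (g has_derivative (\<lambda>h. G x \<bullet> h)) (at x)" "continuous_on UNIV G"
    using assms unfolding C1_def by blast
  have "((\<lambda>x. f x * g x) has_derivative (\<lambda>h. (f x *\<^sub>R G x + g x *\<^sub>R F x) \<bullet> h)) (at x)" for x
    by (rule has_derivative_eq_rhs[OF has_derivative_mult[OF F(1) G(1)]])
      (auto simp: inner_add_left algebra_simps)
  moreover have "continuous_on UNIV (\<lambda>x. f x *\<^sub>R G x + g x *\<^sub>R F x)"
    using assms F G by (intro continuous_intros C1_continuous)
  ultimately show ?thesis unfolding C1_def by (intro exI[of _ "\<lambda>x. f x *\<^sub>R G x + g x *\<^sub>R F x"]) simp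
qed

lemma C1_prod: "finite I \<Longrightarrow> (\<And>i. i \<in> I \<Longrightarrow> C1 (f i)) \<Longrightarrow> C1 (\<lambda>x. \<Prod>i\<in>I. f i x)"
  by (induction I rule: finite_induct) (auto intro: C1_const C1_mult)

lemma C1_compose:
  assumes f: "C1 f" and r: "\<And>s. (r has_real_derivative r' s) (at s)" and r': "continuous_on UNIV r'"
  shows "C1 (\<lambda>x. r (f x))"
proof -
  obtain F where F: "\<And>x. (f has_derivative (\<lambda>h. F x \<bullet> h)) (at x)" "continuous_on UNIV F"
    using f unfolding C1_def by blast
  have A: "((\<lambda>x. r (f x)) has_derivative (\<lambda>h. (r' (f x) *\<^sub>R F x) \<bullet> h)) (at x)" for x
    using has_derivative_compose[OF F(1) r[unfolded has_field_derivative_def]] by simp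
  have B: "continuous_on UNIV (\<lambda>x. r' (f x) *\<^sub>R F x)"
    using F by (intro continuous_intros continuous_on_compose2[OF r' C1_continuous[OF f]]) auto
  show ?thesis unfolding C1_def by (rule exI[of _ "\<lambda>x. r' (f x) *\<^sub>R F x"]) (intro conjI allI A B)
qed

lemma C1_coordinate: "C1 (\<lambda>x. x \<bullet> b)"
  unfolding C1_def
  by (rule exI[of _ "\<lambda>_. b"]) (auto intro!: derivative_eq_intros simp: inner_commute)

lemma hinge_square_derivative:
  "((\<lambda>s::real. (max 0 s)\<^sup>2) has_real_derivative 2 * max 0 s) (at s)"
proof (cases s "0::real" rule: linorder_cases)
  case less
  have "((\<lambda>s::real. 0) has_real_derivative 2 * max 0 s) (at s)" using less by simp
  then show ?thesis
    by (rule has_field_derivative_transform_within_open[of _ _ _ "{..<0}"]) (use less in auto)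
next
  case greater
  have "((\<lambda>s::real. s\<^sup>2) has_real_derivative 2 * max 0 s) (at s)" using greater
    by (auto intro!: derivative_eq_intros)
  then show ?thesis
    by (rule has_field_derivative_transform_within_open[of _ _ _ "{0<..}"]) (use greater in auto)
next
  case equal
  have "((\<lambda>h. ((max 0 (0 + h))\<^sup>2 - (max 0 0)\<^sup>2) / h) \<longlongrightarrow> 0) (at (0::real))"
  proof (rule Lim_null_comparison)
    show "((\<lambda>h::real. \<bar>h\<bar>) \<longlongrightarrow> 0) (at 0)" by (intro tendsto_eq_intros) auto
    show "\<forall>\<^sub>F h in at (0::real). norm (((max 0 (0 + h))\<^sup>2 - (max 0 0)\<^sup>2) / h) \<le> \<bar>h\<bar>"
      by (intro always_eventually) (auto simp: max_def power2_eq_square)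
  qed
  then show ?thesis using equal by (simp add: DERIV_def)
qed

definition box_bump :: "'a::euclidean_space \<Rightarrow> 'a \<Rightarrow> 'a \<Rightarrow> real" where
  "box_bump a b x = (\<Prod>i\<in>Basis. (max 0 (x \<bullet> i - a \<bullet> i))\<^sup>2 * (max 0 (b \<bullet> i - x \<bullet> i))\<^sup>2)"

lemma box_bump_eq_0_iff: "box_bump a b x = 0 \<longleftrightarrow> x \<notin> box a b"
proof -
  have "(max 0 p)\<^sup>2 * (max 0 q)\<^sup>2 = 0 \<longleftrightarrow> \<not> (0 < p \<and> 0 < q)" for p q :: real
    by (auto simp: max_def)
  then show ?thesis by (auto simp: box_bump_def mem_box)
qed

lemma C1_box_bump: "C1 (box_bump a b)"
proof -
  have q: "C1 (\<lambda>x::'a. (max 0 (x \<bullet> i - c))\<^sup>2)" "C1 (\<lambda>x::'a. (max 0 (c - x \<bullet> i))\<^sup>2)" for i and c :: real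
  proof -
    show "C1 (\<lambda>x::'a. (max 0 (x \<bullet> i - c))\<^sup>2)"
    proof (rule C1_compose[OF C1_coordinate])
      show "((\<lambda>s. (max 0 (s - c))\<^sup>2) has_real_derivative 2 * max 0 (s - c)) (at s)" for s
      proof -
        have "((\<lambda>s. s - c) has_real_derivative 1) (at s)" by (auto intro!: derivative_eq_intros)
        from DERIV_chain2[where f = "\<lambda>s. (max 0 s)\<^sup>2" and g = "\<lambda>s. s - c", OF hinge_square_derivative this]
        show ?thesis by simp
      qed
    qed (intro continuous_intros)
    show "C1 (\<lambda>x::'a. (max 0 (c - x \<bullet> i))\<^sup>2)"
    proof (rule C1_compose[OF C1_coordinate])
      show "((\<lambda>s. (max 0 (c - s))\<^sup>2) has_real_derivative - 2 * max 0 (c - s)) (at s)" for s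
      proof -
        have "((\<lambda>s. c - s) has_real_derivative -1) (at s)" by (auto intro!: derivative_eq_intros)
        from DERIV_chain2[where f = "\<lambda>s. (max 0 s)\<^sup>2" and g = "\<lambda>s. c - s", OF hinge_square_derivative this]
        show ?thesis by simp
      qed
    qed (intro continuous_intros)
  qed
  show ?thesis unfolding box_bump_def by (intro C1_prod C1_mult q) auto
qed

definition box_cutoff :: "'a::euclidean_space \<Rightarrow> 'a \<Rightarrow> nat \<Rightarrow> 'a \<Rightarrow> real" where
  "box_cutoff a b k x = real k * (box_bump a b x)\<^sup>2 / (1 + real k * (box_bump a b x)\<^sup>2)"

lemma C1_box_cutoff: "C1 (box_cutoff a b k)"
  unfolding box_cutoff_def
proof (rule C1_compose[OF C1_box_bump])
  fix s :: real
  have pos: "1 + real k * s\<^sup>2 > 0" for s by (simp add: add_pos_nonneg)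
  then have "1 + real k * s\<^sup>2 \<noteq> 0" for s by (metis less_irrefl)
  then show "((\<lambda>s. real k * s\<^sup>2 / (1 + real k * s\<^sup>2)) has_real_derivative
      (2 * real k * s * (1 + real k * s\<^sup>2) - real k * s\<^sup>2 * (2 * real k * s)) / ((1 + real k * s\<^sup>2) * (1 + real k * s\<^sup>2))) (at s)"
    by (auto intro!: derivative_eq_intros)
next
  have "1 + real k * s\<^sup>2 \<noteq> 0" for s :: real
    by (metis add_pos_nonneg less_irrefl mult_nonneg_nonneg of_nat_0_le_iff zero_le_power2 zero_less_one)
  then show "continuous_on UNIV (\<lambda>s. (2 * real k * s * (1 + real k * s\<^sup>2) - real k * s\<^sup>2 * (2 * real k * s)) / ((1 + real k * s\<^sup>2) * (1 + real k * s\<^sup>2)))"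
    by (intro continuous_intros) auto
qed

lemma box_cutoff_bounds: "0 \<le> box_cutoff a b k x" "box_cutoff a b k x \<le> 1"
proof -
  have "0 \<le> y / (1 + y)" "y / (1 + y) \<le> 1" if "y \<ge> 0" for y :: real
    using that by (auto simp: divide_le_eq)
  from this[of "real k * (box_bump a b x)\<^sup>2"] show "0 \<le> box_cutoff a b k x" "box_cutoff a b k x \<le> 1"
    unfolding box_cutoff_def by auto
qed

lemma box_cutoff_tendsto: "(\<lambda>k. box_cutoff a b k x) \<longlonglongrightarrow> indicator (box a b) x"
proof (cases "x \<in> box a b")
  case True
  then have c: "(box_bump a b x)\<^sup>2 > 0" (is "?c > 0") using box_bump_eq_0_iff[of a b x] by simp
  have "filterlim (\<lambda>k. 1 + real k * ?c) at_top sequentially"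
    using filterlim_tendsto_add_at_top[OF tendsto_const
        filterlim_tendsto_pos_mult_at_top[OF tendsto_const c filterlim_real_sequentially]]
    by (simp add: mult.commute)
  then have "(\<lambda>k. inverse (1 + real k * ?c)) \<longlonglongrightarrow> 0"
    by (rule tendsto_inverse_0_at_top)
  then have "(\<lambda>k. 1 - inverse (1 + real k * ?c)) \<longlonglongrightarrow> 1 - 0" by (intro tendsto_intros)
  moreover have "box_cutoff a b k x = 1 - inverse (1 + real k * ?c)" for k
  proof -
    have "1 + real k * ?c > 0" by (simp add: add_pos_nonneg)
    then show ?thesis by (simp add: box_cutoff_def field_simps)
  qed
  ultimately show ?thesis using True by simp
next
  case False
  then show ?thesis using box_bump_eq_0_iff[of a b x] by (simp add: box_cutoff_def)
qed

lemma box_cutoff_test_pair: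
  assumes "cbox a b \<subseteq> \<Omega>"
  shows "\<exists>G. test_pair \<Omega> (box_cutoff a b k) G"
proof -
  have "box_cutoff a b k x = 0" if "x \<notin> cbox a b" for x
    using that box_bump_eq_0_iff[of a b x] box_subset_cbox[of a b] by (auto simp: box_cutoff_def)
  with assms C1_box_cutoff[of a b k] show ?thesis
    unfolding test_pair_def C1_def by (metis compact_cbox)
qed

lemma ae_zero_of_box_integrals:
  fixes f :: "'a::euclidean_space \<Rightarrow> real"
  assumes f: "integrable lborel f"
    and boxes: "\<And>a b. cbox a b \<subseteq> cbox c d \<Longrightarrow> (\<integral>x. indicator (box a b) x * f x \<partial>lborel) = 0"
  shows "AE x in lborel. x \<in> box c d \<longrightarrow> f x = 0"
proof -
  define g where "g x = indicator (box c d) x * f x" for x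
  have g: "integrable lborel g"
    using integrable_mult_indicator[OF _ f, of "box c d"] by (simp add: g_def[abs_def])
  have gA: "set_integrable lborel A g" if "A \<in> sets borel" for A
    unfolding set_integrable_def using that by (intro integrable_mult_indicator g) auto
  have all0: "(\<integral>x\<in>UNIV. g x \<partial>lborel) = 0"
    using boxes[of c d] by (simp add: set_lebesgue_integral_def g_def)
  have zero: "(\<integral>x\<in>A. g x \<partial>lborel) = 0" if "A \<in> sets borel" for A
  proof -
    let ?B = "range (\<lambda>(a, b). box a b :: 'a set)"
    have sb: "sets borel = sigma_sets UNIV ?B" by (subst borel_eq_box) (simp add: sets_measure_of)
    have B: "Int_stable ?B" "?B \<subseteq> Pow UNIV"
      by (auto simp: Int_stable_def box_Int_box)
    from B that[unfolded sb] show ?thesis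
    proof (induct rule: sigma_sets_induct_disjoint)
      case (basic A)
      then obtain a b where A: "A = box a b" by auto
      obtain a' b' where ab: "box a b \<inter> box c d = box a' b'" "cbox a b \<inter> cbox c d = cbox a' b'"
        unfolding box_Int_box Int_interval by blast
      have "(\<integral>x\<in>A. g x \<partial>lborel) = (\<integral>x. indicator (box a' b') x * f x \<partial>lborel)"
        unfolding set_lebesgue_integral_def g_def A ab(1)[symmetric]
        by (simp add: indicator_inter_arith mult.assoc)
      also have "\<dots> = 0" using ab(2) by (intro boxes) auto
      finally show ?case .
    next
      case empty
      then show ?case by (simp add: set_lebesgue_integral_def)
    next
      case (compl A)
      then have A: "A \<in> sets borel" by (simp add: sb)
      have "(\<integral>x\<in>UNIV - A. g x \<partial>lborel) + (\<integral>x\<in>A. g x \<partial>lborel) = (\<integral>x\<in>(UNIV - A) \<union> A. g x \<partial>lborel)"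
        using A by (intro set_integral_Un[symmetric] gA) auto
      also have "\<dots> = 0" using all0 by simp
      finally show ?case using compl by simp
    next
      case (union A)
      then have A: "A i \<in> sets borel" for i by (auto simp: sb)
      have "(\<integral>x\<in>(\<Union>i. A i). g x \<partial>lborel) = (\<Sum>i. (\<integral>x\<in>A i. g x \<partial>lborel))"
        using A union(1) by (intro lebesgue_integral_countable_add gA) (auto simp: disjoint_family_on_def)
      then show ?case using union by simp
    qed
  qed
  have "AE x in lborel. g x = 0"
    by (rule density_unique_real[OF g integrable_zero]) (use zero in \<open>auto simp: set_lebesgue_integral_def\<close>)
  then show ?thesis by eventually_elim (auto simp: g_def)
qed

lemma fundamental_lemma_variations:
  fixes f :: "'a::euclidean_space \<Rightarrow> real"
  assumes \<Omega>: "open \<Omega>" and f: "integrable (lebesgue_on \<Omega>) f"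
    and test: "\<And>\<phi> G. test_pair \<Omega> \<phi> G \<Longrightarrow> (\<integral>x. f x * \<phi> x \<partial>lebesgue_on \<Omega>) = 0"
  shows "AE x in lebesgue_on \<Omega>. f x = 0"
proof -
  have \<Omega>m: "\<Omega> \<in> sets lebesgue" using \<Omega> by simp
  define f0 where "f0 x = indicator \<Omega> x * f x" for x
  have f0: "integrable lebesgue f0"
    using f \<Omega>m integrable_restrict_space[of \<Omega> lebesgue f] by (simp add: f0_def[abs_def])
  then obtain f' where f': "f' \<in> borel_measurable lborel" "AE x in lborel. f0 x = f' x"
    using completion_ex_borel_measurable_real[of f0 lborel] by (auto dest: borel_measurable_integrable)
  have ae: "AE x in lebesgue. f0 x = f' x" using f'(2) by (rule AE_completion)
  have f'm: "f' \<in> borel_measurable lebesgue" using f'(1) by (rule measurable_completion)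
  have "integrable lebesgue f'"
    using integrable_cong_AE[OF borel_measurable_integrable[OF f0] f'm ae] f0 by simp
  then have f'i: "integrable lborel f'" using f'(1) integrable_completion by blast
  have "AE x in lborel. x \<in> box c d \<longrightarrow> f' x = 0" if cd: "cbox c d \<subseteq> \<Omega>" for c d
  proof (rule ae_zero_of_box_integrals[OF f'i])
    fix a b assume "cbox a b \<subseteq> cbox c d"
    then have ab: "cbox a b \<subseteq> \<Omega>" using cd by blast
    have cut0: "(\<integral>x. box_cutoff a b k x * f' x \<partial>lborel) = 0" for k
    proof -
      obtain G where G: "test_pair \<Omega> (box_cutoff a b k) G" using box_cutoff_test_pair[OF ab] by blast
      have cm: "box_cutoff a b k \<in> borel_measurable borel"
        by (rule borel_measurable_continuous_onI[OF C1_continuous[OF C1_box_cutoff]])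
      have "0 = (\<integral>x. f x * box_cutoff a b k x \<partial>lebesgue_on \<Omega>)" using test[OF G] by simp
      also have "\<dots> = (\<integral>x. f0 x * box_cutoff a b k x \<partial>lebesgue)"
        using \<Omega>m by (subst integral_restrict_space) (auto simp: f0_def mult.assoc)
      also have "\<dots> = (\<integral>x. box_cutoff a b k x * f' x \<partial>lebesgue)"
      proof (rule integral_cong_AE)
        have "box_cutoff a b k \<in> borel_measurable lebesgue" using cm by (intro measurable_completion) simp
        then show "(\<lambda>x. f0 x * box_cutoff a b k x) \<in> borel_measurable lebesgue"
            "(\<lambda>x. box_cutoff a b k x * f' x) \<in> borel_measurable lebesgue"
          using f0 f'm by auto
        show "AE x in lebesgue. f0 x * box_cutoff a b k x = box_cutoff a b k x * f' x"
          using ae by eventually_elim simp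
      qed
      also have "\<dots> = (\<integral>x. box_cutoff a b k x * f' x \<partial>lborel)"
        using cm f'(1) by (intro integral_completion) auto
      finally show ?thesis by simp
    qed
    have "(\<lambda>k. \<integral>x. box_cutoff a b k x * f' x \<partial>lborel) \<longlonglongrightarrow> (\<integral>x. indicator (box a b) x * f' x \<partial>lborel)"
    proof (rule integral_dominated_convergence[where w = "\<lambda>x. \<bar>f' x\<bar>"])
      show "(\<lambda>x. indicat_real (box a b) x * f' x) \<in> borel_measurable lborel" using f'(1) by simp
      show "(\<lambda>x. box_cutoff a b k x * f' x) \<in> borel_measurable lborel" for k
        using borel_measurable_continuous_onI[OF C1_continuous[OF C1_box_cutoff[of a b k]]] f'(1) by simp
      show "integrable lborel (\<lambda>x. \<bar>f' x\<bar>)" using f'i by simp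
      show "AE x in lborel. (\<lambda>k. box_cutoff a b k x * f' x) \<longlonglongrightarrow> indicat_real (box a b) x * f' x"
        by (intro AE_I2 tendsto_mult box_cutoff_tendsto tendsto_const)
      show "AE x in lborel. norm (box_cutoff a b k x * f' x) \<le> \<bar>f' x\<bar>" for k
        using box_cutoff_bounds[of a b k] by (intro AE_I2) (auto simp: abs_mult intro!: mult_left_le_one_le)
    qed
    then show "(\<integral>x. indicator (box a b) x * f' x \<partial>lborel) = 0" by (simp add: cut0 LIMSEQ_const_iff)
  qed
  note box0 = this
  have cbox0: "AE x in lborel. x \<in> cbox c d \<longrightarrow> f' x = 0" if "cbox c d \<subseteq> \<Omega>" for c d
  proof -
    have "AE x in lborel. x \<notin> cbox c d - box c d" by (rule AE_not_in[OF null_sets_cbox_Diff_box])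
    with box0[OF that] show ?thesis by eventually_elim auto
  qed
  obtain \<D> where D: "countable \<D>" "\<D> \<subseteq> Pow \<Omega>" "\<And>X. X \<in> \<D> \<Longrightarrow> \<exists>a b. X = cbox a b" "\<Union>\<D> = \<Omega>"
    using open_countable_Union_open_cbox[OF \<Omega>] by blast
  have "AE x in lborel. \<forall>X\<in>\<D>. x \<in> X \<longrightarrow> f' x = 0"
    using D cbox0 by (subst AE_ball_countable) (auto, metis PowD subsetD)
  then have "AE x in lborel. x \<in> \<Omega> \<longrightarrow> f' x = 0"
    by eventually_elim (use D(4) in auto)
  then have "AE x in lebesgue. x \<in> \<Omega> \<longrightarrow> f' x = 0" by (rule AE_completion)
  with ae have "AE x in lebesgue. x \<in> \<Omega> \<longrightarrow> f x = 0"
    by eventually_elim (auto simp: f0_def)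
  then show ?thesis using \<Omega>m by (subst AE_restrict_space_iff) auto
qed

lemma gradient_zero_outside_support:
  fixes f :: "'a::euclidean_space \<Rightarrow> real"
  assumes "(f has_derivative (\<lambda>h. g \<bullet> h)) (at x)" "compact K" "\<And>x. x \<notin> K \<Longrightarrow> f x = 0" "x \<notin> K"
  shows "g = 0"
proof -
  have "open (- K)" using assms(2) compact_imp_closed open_Compl by blast
  have "((\<lambda>_. 0) has_derivative (\<lambda>h. g \<bullet> h)) (at x)"
    by (rule has_derivative_transform_within_open[OF assms(1) \<open>open (- K)\<close>]) (use assms in auto)
  then have "(\<lambda>h. g \<bullet> h) = (\<lambda>h. 0)" using has_derivative_const has_derivative_unique by blast
  then have "g \<bullet> g = 0" by meson
  then show ?thesis by simp
qed

lemma compact_support_lipschitz: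
  fixes f :: "'a::euclidean_space \<Rightarrow> real"
  assumes der: "\<And>x. (f has_derivative (\<lambda>h. G x \<bullet> h)) (at x)" and G: "continuous_on UNIV G"
    and K: "compact K" "\<And>x. x \<notin> K \<Longrightarrow> f x = 0"
  obtains B where "B \<ge> 0" "\<And>x y. \<bar>f y - f x\<bar> \<le> B * norm (y - x)"
proof -
  have "bounded (G ` K)" by (intro compact_imp_bounded compact_continuous_image continuous_on_subset[OF G] K) auto
  then obtain B0 where B0: "\<And>x. x \<in> K \<Longrightarrow> norm (G x) \<le> B0" unfolding bounded_iff by blast
  define B where "B = max B0 0"
  have B: "norm (G x) \<le> B" for x
    using B0[of x] gradient_zero_outside_support[OF der K, of x] by (cases "x \<in> K") (auto simp: B_def)
  have "norm (f y - f x) \<le> B * norm (y - x)" for x y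
  proof (rule differentiable_bound[where S = UNIV])
    show "onorm ((\<bullet>) (G y)) \<le> B" for y
    proof (rule onorm_le)
      fix v
      have "norm (G y \<bullet> v) \<le> norm (G y) * norm v" using Cauchy_Schwarz_ineq2 by simp
      also have "\<dots> \<le> B * norm v" by (intro mult_right_mono B) simp
      finally show "norm (G y \<bullet> v) \<le> B * norm v" .
    qed
  qed (use der in auto)
  then show ?thesis using that[of B] by (simp add: B_def)
qed

lemma integral_partial_derivative_zero:
  fixes f :: "'a::euclidean_space \<Rightarrow> real"
  assumes der: "\<And>x. (f has_derivative (\<lambda>h. G x \<bullet> h)) (at x)" and G: "continuous_on UNIV G"
    and K: "compact K" "\<And>x. x \<notin> K \<Longrightarrow> f x = 0" and b: "norm b = 1"
  shows "(\<integral>x. G x \<bullet> b \<partial>lborel) = 0"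
proof -
  have cont: "continuous_on UNIV f"
    using der has_derivative_continuous continuous_at_imp_continuous_on by blast
  obtain B where B: "B \<ge> 0" "\<And>x y. \<bar>f y - f x\<bar> \<le> B * norm (y - x)"
    using compact_support_lipschitz[OF der G K] by blast
  have lip: "\<bar>f (x + h *\<^sub>R b) - f x\<bar> \<le> B * \<bar>h\<bar>" for x h
    using B(2)[of "x + h *\<^sub>R b" x] b by simp
  obtain r where r: "\<And>x. x \<in> K \<Longrightarrow> norm x \<le> r" using compact_imp_bounded[OF K(1)] unfolding bounded_iff by blast
  let ?S = "cball (0::'a) (r + 1)"
  define q where "q k x = real (Suc k) * (f (x + (1 / real (Suc k)) *\<^sub>R b) - f x)" for k x
  have fint: "integrable lborel f"
  proof -
    have "integrable lborel (\<lambda>x. indicator K x *\<^sub>R f x)"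
      by (intro borel_integrable_compact K continuous_on_subset[OF cont]) auto
    moreover have "(\<lambda>x. indicator K x *\<^sub>R f x) = f" using K by (auto simp: indicator_def fun_eq_iff)
    ultimately show ?thesis by simp
  qed
  have fm: "f \<in> borel_measurable borel" using cont by (rule borel_measurable_continuous_onI)
  have shift: "integrable lborel (\<lambda>x. f (c + x))" "(\<integral>x. f (c + x) \<partial>lborel) = (\<integral>x. f x \<partial>lborel)" for c
  proof -
    have "integrable (distr lborel borel ((+) c)) f" using fint by (simp add: lborel_distr_plus)
    then show "integrable lborel (\<lambda>x. f (c + x))"
      by (subst (asm) integrable_distr_eq) (use fm in auto)
    have "(\<integral>x. f x \<partial>lborel) = (\<integral>x. f x \<partial>distr lborel borel ((+) c))" by (simp add: lborel_distr_plus)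
    also have "\<dots> = (\<integral>x. f (c + x) \<partial>lborel)" using fm by (subst integral_distr) auto
    finally show "(\<integral>x. f (c + x) \<partial>lborel) = (\<integral>x. f x \<partial>lborel)" by simp
  qed
  have q0: "(\<integral>x. q k x \<partial>lborel) = 0" for k
    unfolding q_def using shift[of "(1 / real (Suc k)) *\<^sub>R b"] fint by (simp add: add.commute)
  have "(\<lambda>k. \<integral>x. q k x \<partial>lborel) \<longlonglongrightarrow> (\<integral>x. G x \<bullet> b \<partial>lborel)"
  proof (rule integral_dominated_convergence[where w = "\<lambda>x. B * indicator ?S x"])
    show "(\<lambda>x. G x \<bullet> b) \<in> borel_measurable lborel"
      using borel_measurable_continuous_onI[OF continuous_on_inner[OF G continuous_on_const]] by simp
    show "q k \<in> borel_measurable lborel" for k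
      unfolding q_def using fm shift[of "(1 / real (Suc k)) *\<^sub>R b"] 
      by (auto simp: add.commute dest!: borel_measurable_integrable)
    show "integrable lborel (\<lambda>x. B * indicator ?S x)"
      using emeasure_lborel_cball_finite[of 0 "r + 1"] by (intro integrable_mult_right) (auto simp: integrable_indicator_iff)
    show "AE x in lborel. (\<lambda>k. q k x) \<longlonglongrightarrow> G x \<bullet> b"
    proof (rule AE_I2)
      fix x
      have "((\<lambda>h. (f (x + h *\<^sub>R b))) has_derivative (\<lambda>s. G x \<bullet> (s *\<^sub>R b))) (at 0)"
        by (rule has_derivative_compose[of "\<lambda>h. x + h *\<^sub>R b" "\<lambda>s. s *\<^sub>R b" 0 UNIV f])
          (auto intro!: derivative_eq_intros der)
      then have "((\<lambda>h. (f (x + h *\<^sub>R b))) has_real_derivative (G x \<bullet> b)) (at 0)"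
        unfolding has_field_derivative_def by (rule has_derivative_eq_rhs) (auto simp: mult.commute)
      then have "((\<lambda>h. (f (x + (0 + h) *\<^sub>R b) - f (x + 0 *\<^sub>R b)) / h) \<longlongrightarrow> G x \<bullet> b) (at 0)"
        unfolding DERIV_def .
      then have lim: "((\<lambda>h. (f (x + h *\<^sub>R b) - f x) / h) \<longlongrightarrow> G x \<bullet> b) (at 0)" by simp
      have "filterlim (\<lambda>k. 1 / real (Suc k)) (at 0) sequentially"
        unfolding filterlim_at using LIMSEQ_inverse_real_of_nat by (auto simp: inverse_eq_divide)
      from filterlim_compose[OF lim this] show "(\<lambda>k. q k x) \<longlonglongrightarrow> G x \<bullet> b"
        by (simp add: q_def mult.commute)
    qed
    show "AE x in lborel. norm (q k x) \<le> B * indicator ?S x" for k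
    proof (rule AE_I2)
      fix x
      let ?h = "1 / real (Suc k)"
      show "norm (q k x) \<le> B * indicator ?S x"
      proof (cases "x \<in> ?S")
        case True
        have "norm (q k x) = real (Suc k) * \<bar>f (x + ?h *\<^sub>R b) - f x\<bar>" by (simp add: q_def abs_mult)
        also have "\<dots> \<le> real (Suc k) * (B * \<bar>?h\<bar>)" by (intro mult_left_mono lip) simp
        also have "\<dots> = B" by simp
        finally show ?thesis using True by simp
      next
        case False
        then have "norm x > r + 1" by simp
        moreover have "norm x \<le> norm (x + ?h *\<^sub>R b) + norm (?h *\<^sub>R b)"
          by (metis add_diff_cancel_right' norm_triangle_ineq4)
        moreover have "norm (?h *\<^sub>R b) \<le> 1" using b by (simp add: divide_simps)
        ultimately have "x \<notin> K" "x + ?h *\<^sub>R b \<notin> K" using r[of x] r[of "x + ?h *\<^sub>R b"] by linarith+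
        then show ?thesis using K B(1) by (simp add: q_def)
      qed
    qed
  qed
  then show ?thesis by (simp add: q0 LIMSEQ_const_iff)
qed

section \<open>The spaces \<open>L\<^sub>2\<close> and \<open>H\<^sup>1\<^sub>0\<close>\<close>

instantiation "fun" :: (type, real_vector) real_vector
begin

definition "c *\<^sub>R f = (\<lambda>x. c *\<^sub>R f x)"

instance
  by standard (simp_all add: scaleR_fun_def fun_eq_iff scaleR_add_right scaleR_add_left)

end

lemma scaleR_fun_apply [simp]: "(c *\<^sub>R f) x = c *\<^sub>R f x"
  by (simp add: scaleR_fun_def)

lemma L2_mult_integrable:
  assumes "L2 \<Omega> u" "L2 \<Omega> w"
  shows "integrable (lebesgue_on \<Omega>) (\<lambda>x. u x * w x)"
proof (rule Bochner_Integration.integrable_bound)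
  show "integrable (lebesgue_on \<Omega>) (\<lambda>x. (u x)\<^sup>2 + (w x)\<^sup>2)"
    using assms by (auto simp: L2_def)
  show "(\<lambda>x. u x * w x) \<in> borel_measurable (lebesgue_on \<Omega>)"
    using assms by (auto simp: L2_def)
  have "\<bar>p * q\<bar> \<le> p\<^sup>2 + q\<^sup>2" for p q :: real
  proof -
    have "0 \<le> (\<bar>p\<bar> - \<bar>q\<bar>)\<^sup>2" "0 \<le> p\<^sup>2 + q\<^sup>2" by simp_all
    then show ?thesis unfolding power2_diff abs_mult power2_abs by linarith
  qed
  then show "AE x in lebesgue_on \<Omega>. norm (u x * w x) \<le> norm ((u x)\<^sup>2 + (w x)\<^sup>2)"
    by (intro AE_I2) simp
qed

lemma L2_bound:
  assumes "L2 \<Omega> w" "u \<in> borel_measurable (lebesgue_on \<Omega>)" "\<And>x. x \<in> \<Omega> \<Longrightarrow> \<bar>u x\<bar> \<le> c * \<bar>w x\<bar>"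
  shows "L2 \<Omega> u"
  unfolding L2_def
proof
  show "integrable (lebesgue_on \<Omega>) (\<lambda>x. (u x)\<^sup>2)"
  proof (rule Bochner_Integration.integrable_bound)
    show "integrable (lebesgue_on \<Omega>) (\<lambda>x. c\<^sup>2 * (w x)\<^sup>2)" using assms by (auto simp: L2_def)
    show "AE x in lebesgue_on \<Omega>. norm ((u x)\<^sup>2) \<le> norm (c\<^sup>2 * (w x)\<^sup>2)"
    proof (rule AE_I2)
      fix x assume "x \<in> space (lebesgue_on \<Omega>)"
      then have "\<bar>u x\<bar>\<^sup>2 \<le> (c * \<bar>w x\<bar>)\<^sup>2" using assms(3)[of x] by (intro power_mono) auto
      then show "norm ((u x)\<^sup>2) \<le> norm (c\<^sup>2 * (w x)\<^sup>2)" by (simp add: power_mult_distrib)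
    qed
  qed (use assms in auto)
qed fact

lemma L2_add:
  assumes "L2 \<Omega> u" "L2 \<Omega> w"
  shows "L2 \<Omega> (\<lambda>x. u x + w x)"
proof -
  have "integrable (lebesgue_on \<Omega>) (\<lambda>x. (u x)\<^sup>2 + 2 * (u x * w x) + (w x)\<^sup>2)"
    using assms L2_mult_integrable[OF assms] by (auto simp: L2_def)
  moreover have "(\<lambda>x. (u x + w x)\<^sup>2) = (\<lambda>x. (u x)\<^sup>2 + 2 * (u x * w x) + (w x)\<^sup>2)"
    by (auto simp: power2_sum)
  ultimately show ?thesis using assms by (auto simp: L2_def)
qed

lemma L2_scale: "L2 \<Omega> u \<Longrightarrow> L2 \<Omega> (\<lambda>x. c * u x)"
  by (auto simp: L2_def power_mult_distrib)

lemma L2_zero: "L2 \<Omega> (\<lambda>x. 0)"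
  by (auto simp: L2_def)

lemma psd_form_L2: "psd_form {u. L2 \<Omega> u} (L2_inner \<Omega>)"
proof
  show "subspace {u. L2 \<Omega> u}"
    by (auto simp: subspace_def zero_fun_def plus_fun_def scaleR_fun_def L2_zero L2_add L2_scale)
  show "L2_inner \<Omega> u w = L2_inner \<Omega> w u" for u w by (simp add: L2_inner_def mult.commute)
qed (auto simp: L2_inner_def distrib_right L2_mult_integrable mult.assoc)

definition L2v :: "'a::euclidean_space set \<Rightarrow> ('a \<Rightarrow> 'a) set" where
  "L2v \<Omega> = {g. \<forall>b\<in>Basis. L2 \<Omega> (\<lambda>x. g x \<bullet> b)}"

definition L2v_inner :: "'a::euclidean_space set \<Rightarrow> ('a \<Rightarrow> 'a) \<Rightarrow> ('a \<Rightarrow> 'a) \<Rightarrow> real" where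
  "L2v_inner \<Omega> g k = (\<integral>x. g x \<bullet> k x \<partial>lebesgue_on \<Omega>)"

lemma L2v_measurable:
  assumes "g \<in> L2v \<Omega>"
  shows "g \<in> borel_measurable (lebesgue_on \<Omega>)"
proof -
  have "(\<lambda>x. g x \<bullet> b) \<in> borel_measurable (lebesgue_on \<Omega>)" if "b \<in> Basis" for b
    using assms that by (auto simp: L2v_def L2_def)
  then show ?thesis by (subst borel_measurable_euclidean_space) auto
qed

lemma L2v_inner_integrable:
  assumes "g \<in> L2v \<Omega>" "k \<in> L2v \<Omega>"
  shows "integrable (lebesgue_on \<Omega>) (\<lambda>x. g x \<bullet> k x)"
  using assms unfolding L2v_def euclidean_inner[of "g _" "k _"]
  by (auto intro!: Bochner_Integration.integrable_sum L2_mult_integrable)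

lemma psd_form_L2v: "psd_form (L2v \<Omega>) (L2v_inner \<Omega>)"
proof
  show "subspace (L2v \<Omega>)"
    by (auto simp: L2v_def subspace_def zero_fun_def plus_fun_def scaleR_fun_def inner_add_left
        L2_zero L2_add L2_scale)
  show "L2v_inner \<Omega> u w = L2v_inner \<Omega> w u" for u w by (simp add: L2v_inner_def inner_commute)
qed (auto simp: L2v_inner_def inner_add_left L2v_inner_integrable)

lemma L2_norm_eq: "psd_form.n (L2_inner \<Omega>) u = L2_norm \<Omega> u"
  by (simp add: psd_form.n_def[OF psd_form_L2] L2_norm_def L2_inner_def power2_eq_square)

lemma L2v_norm_eq: "psd_form.n (L2v_inner \<Omega>) g = L2v_norm \<Omega> g"
  by (simp add: psd_form.n_def[OF psd_form_L2v] L2v_norm_def L2v_inner_def power2_norm_eq_inner)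

lemma L2v_inner_cong:
  assumes "AE x in lebesgue_on \<Omega>. g x = g' x" "g \<in> L2v \<Omega>" "g' \<in> L2v \<Omega>" "k \<in> L2v \<Omega>"
  shows "L2v_inner \<Omega> g k = L2v_inner \<Omega> g' k"
  unfolding L2v_inner_def
proof (rule integral_cong_AE)
  show "AE x in lebesgue_on \<Omega>. g x \<bullet> k x = g' x \<bullet> k x" using assms(1) by eventually_elim simp
qed (use assms L2v_measurable in \<open>auto intro!: borel_measurable_inner\<close>)

locale bdd_domain =
  fixes \<Omega> :: "'a::euclidean_space set"
  assumes bdd: "bounded \<Omega>" and opn: "open \<Omega>"
begin

sublocale L: psd_form "{u. L2 \<Omega> u}" "L2_inner \<Omega>" by (rule psd_form_L2)
sublocale Lv: psd_form "L2v \<Omega>" "L2v_inner \<Omega>" by (rule psd_form_L2v)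

lemma meas: "\<Omega> \<in> sets lebesgue" using opn by simp

lemma fin: "finite_measure (lebesgue_on \<Omega>)"
  by (rule finite_measure_lebesgue_on[OF lmeasurable_open[OF bdd opn]])

lemma bounded_L2:
  assumes "f \<in> borel_measurable (lebesgue_on \<Omega>)" "\<And>x. x \<in> \<Omega> \<Longrightarrow> \<bar>f x\<bar> \<le> B"
  shows "L2 \<Omega> f"
  unfolding L2_def
proof
  show "integrable (lebesgue_on \<Omega>) (\<lambda>x. (f x)\<^sup>2)"
  proof (rule finite_measure.integrable_const_bound[OF fin, where B = "B\<^sup>2"])
    show "AE x in lebesgue_on \<Omega>. norm ((f x)\<^sup>2) \<le> B\<^sup>2"
    proof (rule AE_I2)
      fix x assume "x \<in> space (lebesgue_on \<Omega>)"
      then have "\<bar>f x\<bar>\<^sup>2 \<le> B\<^sup>2" using assms(2)[of x] by (intro power_mono) auto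
      then show "norm ((f x)\<^sup>2) \<le> B\<^sup>2" by simp
    qed
  qed (use assms in auto)
qed fact

lemma L2_integrable:
  assumes "L2 \<Omega> u"
  shows "integrable (lebesgue_on \<Omega>) u"
proof -
  have "L2 \<Omega> (\<lambda>x. 1)" by (rule bounded_L2[of _ 1]) auto
  from L2_mult_integrable[OF assms this] show ?thesis by simp
qed

lemma continuous_measurable:
  assumes "continuous_on \<Omega> f"
  shows "f \<in> borel_measurable (lebesgue_on \<Omega>)"
  using assms meas by (rule continuous_imp_measurable_on_sets_lebesgue)

lemma test_pair_gradient_support:
  assumes "test_pair \<Omega> \<phi> G"
  obtains K where "compact K" "K \<subseteq> \<Omega>" "\<And>x. x \<notin> K \<Longrightarrow> \<phi> x = 0" "\<And>x. x \<notin> K \<Longrightarrow> G x = 0"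
proof -
  obtain K where K: "compact K" "K \<subseteq> \<Omega>" "\<And>x. x \<notin> K \<Longrightarrow> \<phi> x = 0"
    using assms unfolding test_pair_def by blast
  have "G x = 0" if "x \<notin> K" for x
    by (rule gradient_zero_outside_support[OF _ K(1) K(3) that]) (use assms in \<open>auto simp: test_pair_def\<close>)
  with that K show ?thesis by blast
qed

lemma compact_support_L2:
  assumes "continuous_on UNIV f" "compact K" "\<And>x. x \<notin> K \<Longrightarrow> f x = 0"
  shows "L2 \<Omega> f"
proof -
  have "bounded (f ` K)"
    using assms by (intro compact_imp_bounded compact_continuous_image continuous_on_subset[OF assms(1)]) auto
  then obtain B where B: "\<And>x. x \<in> K \<Longrightarrow> norm (f x) \<le> B" unfolding bounded_iff by blast
  have "\<bar>f x\<bar> \<le> max B 0" for x using B[of x] assms(3)[of x] by (cases "x \<in> K") auto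
  moreover have "f \<in> borel_measurable (lebesgue_on \<Omega>)"
    using assms(1) by (intro continuous_measurable continuous_on_subset[OF assms(1)]) auto
  ultimately show ?thesis by (intro bounded_L2)
qed

lemma test_pair_continuous:
  assumes "test_pair \<Omega> \<phi> G"
  shows "continuous_on UNIV \<phi>" "continuous_on UNIV G"
  using assms unfolding test_pair_def
  by (auto intro: continuous_at_imp_continuous_on has_derivative_continuous)

lemma test_pair_L2:
  assumes "test_pair \<Omega> \<phi> G"
  shows "L2 \<Omega> \<phi>" "G \<in> L2v \<Omega>"
proof -
  obtain K where K: "compact K" "\<And>x. x \<notin> K \<Longrightarrow> \<phi> x = 0" "\<And>x. x \<notin> K \<Longrightarrow> G x = 0"
    using test_pair_gradient_support[OF assms] by metis
  show "L2 \<Omega> \<phi>" using K test_pair_continuous[OF assms] by (intro compact_support_L2[of _ K])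
  show "G \<in> L2v \<Omega>"
    unfolding L2v_def using K test_pair_continuous[OF assms]
    by (auto intro!: compact_support_L2[of _ K] continuous_intros)
qed

lemma weak_gradient_unique:
  assumes "H1 \<Omega> u g" "H1 \<Omega> u k"
  shows "AE x in lebesgue_on \<Omega>. g x = k x"
proof -
  have "AE x in lebesgue_on \<Omega>. g x \<bullet> b - k x \<bullet> b = 0" if b: "b \<in> Basis" for b
  proof (rule fundamental_lemma_variations[OF opn])
    have L: "L2 \<Omega> (\<lambda>x. g x \<bullet> b)" "L2 \<Omega> (\<lambda>x. k x \<bullet> b)" using assms b by (auto simp: H1_def)
    then show "integrable (lebesgue_on \<Omega>) (\<lambda>x. g x \<bullet> b - k x \<bullet> b)" by (auto intro: L2_integrable)
    fix \<phi> G assume t: "test_pair \<Omega> \<phi> G"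
    have "(\<integral>x. u x * (G x \<bullet> b) \<partial>lebesgue_on \<Omega>) = - (\<integral>x. (g x \<bullet> b) * \<phi> x \<partial>lebesgue_on \<Omega>)"
      "(\<integral>x. u x * (G x \<bullet> b) \<partial>lebesgue_on \<Omega>) = - (\<integral>x. (k x \<bullet> b) * \<phi> x \<partial>lebesgue_on \<Omega>)"
      using assms t b by (auto simp: H1_def weak_grad_def)
    then show "(\<integral>x. (g x \<bullet> b - k x \<bullet> b) * \<phi> x \<partial>lebesgue_on \<Omega>) = 0"
      using L test_pair_L2(1)[OF t] by (simp add: left_diff_distrib L2_mult_integrable)
  qed
  then have "AE x in lebesgue_on \<Omega>. \<forall>b\<in>Basis. g x \<bullet> b - k x \<bullet> b = 0"
    by (subst AE_ball_countable) (auto intro: countable_finite)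
  then show ?thesis by eventually_elim (auto intro: euclidean_eqI)
qed

lemma H1_grad: "H1 \<Omega> u g \<Longrightarrow> H1 \<Omega> u (grad \<Omega> u)"
  unfolding grad_def by (rule someI[of "H1 \<Omega> u"])

lemma H10_H1: "H10 \<Omega> u \<Longrightarrow> H1 \<Omega> u (grad \<Omega> u)"
  unfolding H10_def using H1_grad by blast

lemma H10_L2: "H10 \<Omega> u \<Longrightarrow> L2 \<Omega> u"
  using H10_H1 by (auto simp: H1_def)

lemma H1_L2v: "H1 \<Omega> u g \<Longrightarrow> g \<in> L2v \<Omega>"
  by (auto simp: H1_def L2v_def)

lemma H1_linear:
  assumes "H1 \<Omega> u g" "H1 \<Omega> w k"
  shows "H1 \<Omega> (\<lambda>x. u x + c * w x) (\<lambda>x. g x + c *\<^sub>R k x)"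
  unfolding H1_def
proof (intro conjI ballI)
  show "L2 \<Omega> (\<lambda>x. u x + c * w x)" using assms by (auto simp: H1_def intro: L2_add L2_scale)
  show "L2 \<Omega> (\<lambda>x. (g x + c *\<^sub>R k x) \<bullet> b)" if "b \<in> Basis" for b
    using assms that by (auto simp: H1_def inner_add_left intro!: L2_add L2_scale)
  show "weak_grad \<Omega> (\<lambda>x. u x + c * w x) (\<lambda>x. g x + c *\<^sub>R k x)"
    unfolding weak_grad_def
  proof (intro allI impI ballI)
    fix \<phi> G and b :: 'a assume t: "test_pair \<Omega> \<phi> G" and b: "b \<in> Basis"
    have L: "L2 \<Omega> u" "L2 \<Omega> w" "L2 \<Omega> (\<lambda>x. g x \<bullet> b)" "L2 \<Omega> (\<lambda>x. k x \<bullet> b)" "L2 \<Omega> \<phi>" "L2 \<Omega> (\<lambda>x. G x \<bullet> b)"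
      using assms b test_pair_L2[OF t] by (auto simp: H1_def L2v_def)
    have e: "(\<integral>x. u x * (G x \<bullet> b) \<partial>lebesgue_on \<Omega>) = - (\<integral>x. (g x \<bullet> b) * \<phi> x \<partial>lebesgue_on \<Omega>)"
      "(\<integral>x. w x * (G x \<bullet> b) \<partial>lebesgue_on \<Omega>) = - (\<integral>x. (k x \<bullet> b) * \<phi> x \<partial>lebesgue_on \<Omega>)"
      using assms t b by (auto simp: H1_def weak_grad_def)
    have "(\<integral>x. (u x + c * w x) * (G x \<bullet> b) \<partial>lebesgue_on \<Omega>)
        = (\<integral>x. u x * (G x \<bullet> b) \<partial>lebesgue_on \<Omega>) + c * (\<integral>x. w x * (G x \<bullet> b) \<partial>lebesgue_on \<Omega>)"
      using L by (simp add: distrib_right mult.assoc L2_mult_integrable)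
    also have "\<dots> = - ((\<integral>x. (g x \<bullet> b) * \<phi> x \<partial>lebesgue_on \<Omega>) + c * (\<integral>x. (k x \<bullet> b) * \<phi> x \<partial>lebesgue_on \<Omega>))"
      by (simp add: e)
    also have "\<dots> = - (\<integral>x. ((g x + c *\<^sub>R k x) \<bullet> b) * \<phi> x \<partial>lebesgue_on \<Omega>)"
      using L by (simp add: inner_add_left distrib_right mult.assoc L2_mult_integrable)
    finally show "(\<integral>x. (u x + c * w x) * (G x \<bullet> b) \<partial>lebesgue_on \<Omega>)
        = - (\<integral>x. ((g x + c *\<^sub>R k x) \<bullet> b) * \<phi> x \<partial>lebesgue_on \<Omega>)" .
  qed
qed

lemma H10_linear:
  assumes u: "H10 \<Omega> u" and w: "H10 \<Omega> w"
  shows "H10 \<Omega> (\<lambda>x. u x + c * w x)"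
proof -
  obtain g \<phi>s Gs where g: "H1 \<Omega> u g" "\<And>k::nat. test_pair \<Omega> (\<phi>s k) (Gs k)"
      "(\<lambda>k. L2_dist \<Omega> (\<phi>s k) u + L2v_norm \<Omega> (\<lambda>x. Gs k x - g x)) \<longlonglongrightarrow> 0"
    using u unfolding H10_def by blast
  obtain g' \<phi>s' Gs' where g': "H1 \<Omega> w g'" "\<And>k::nat. test_pair \<Omega> (\<phi>s' k) (Gs' k)"
      "(\<lambda>k. L2_dist \<Omega> (\<phi>s' k) w + L2v_norm \<Omega> (\<lambda>x. Gs' k x - g' x)) \<longlonglongrightarrow> 0"
    using w unfolding H10_def by blast
  let ?\<phi> = "\<lambda>k x. \<phi>s k x + c * \<phi>s' k x" and ?G = "\<lambda>k x. Gs k x + c *\<^sub>R Gs' k x"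
  have test: "test_pair \<Omega> (?\<phi> k) (?G k)" for k
  proof -
    obtain K K' where K: "compact K" "K \<subseteq> \<Omega>" "\<forall>x. x \<notin> K \<longrightarrow> \<phi>s k x = 0"
        "compact K'" "K' \<subseteq> \<Omega>" "\<forall>x. x \<notin> K' \<longrightarrow> \<phi>s' k x = 0"
      using g(2)[of k] g'(2)[of k] unfolding test_pair_def by metis
    have d: "(\<phi>s k has_derivative (\<lambda>h. Gs k x \<bullet> h)) (at x)" "(\<phi>s' k has_derivative (\<lambda>h. Gs' k x \<bullet> h)) (at x)" for x
      using g(2)[of k] g'(2)[of k] unfolding test_pair_def by auto
    have "(?\<phi> k has_derivative (\<lambda>h. ?G k x \<bullet> h)) (at x)" for x
      by (rule has_derivative_eq_rhs[OF has_derivative_add[OF d(1) has_derivative_mult_right[OF d(2)]]])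
        (auto simp: inner_add_left)
    moreover have "continuous_on UNIV (?G k)"
      using g(2)[of k] g'(2)[of k] unfolding test_pair_def by (intro continuous_intros) auto
    moreover have "compact (K \<union> K') \<and> K \<union> K' \<subseteq> \<Omega> \<and> (\<forall>x. x \<notin> K \<union> K' \<longrightarrow> ?\<phi> k x = 0)"
      using K by auto
    ultimately show ?thesis unfolding test_pair_def by (intro conjI allI exI[of _ "K \<union> K'"]) auto
  qed
  have le: "L2_dist \<Omega> (?\<phi> k) (\<lambda>x. u x + c * w x) + L2v_norm \<Omega> (\<lambda>x. ?G k x - (g x + c *\<^sub>R g' x))
      \<le> (L2_dist \<Omega> (\<phi>s k) u + L2v_norm \<Omega> (\<lambda>x. Gs k x - g x))
        + \<bar>c\<bar> * (L2_dist \<Omega> (\<phi>s' k) w + L2v_norm \<Omega> (\<lambda>x. Gs' k x - g' x))" for k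
  proof -
    have m: "\<phi>s k \<in> {u. L2 \<Omega> u}" "\<phi>s' k \<in> {u. L2 \<Omega> u}" "u \<in> {u. L2 \<Omega> u}" "w \<in> {u. L2 \<Omega> u}"
      "Gs k \<in> L2v \<Omega>" "Gs' k \<in> L2v \<Omega>" "g \<in> L2v \<Omega>" "g' \<in> L2v \<Omega>"
      using test_pair_L2[OF g(2)] test_pair_L2[OF g'(2)] u w g g' H10_L2 H1_L2v by auto
    have "L2_dist \<Omega> (?\<phi> k) (\<lambda>x. u x + c * w x) = L.n ((\<phi>s k - u) + c *\<^sub>R (\<phi>s' k - w))"
      by (simp add: L2_dist_def L2_norm_eq plus_fun_def fun_diff_def scaleR_fun_def algebra_simps)
    also have "\<dots> \<le> L.n (\<phi>s k - u) + L.n (c *\<^sub>R (\<phi>s' k - w))" using m by (intro L.n_triangle L.mem)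
    also have "L.n (c *\<^sub>R (\<phi>s' k - w)) = \<bar>c\<bar> * L.n (\<phi>s' k - w)" using m by (intro L.n_scale L.mem)
    finally have 1: "L2_dist \<Omega> (?\<phi> k) (\<lambda>x. u x + c * w x) \<le> L2_dist \<Omega> (\<phi>s k) u + \<bar>c\<bar> * L2_dist \<Omega> (\<phi>s' k) w"
      by (simp add: L2_dist_def L2_norm_eq fun_diff_def)
    have "L2v_norm \<Omega> (\<lambda>x. ?G k x - (g x + c *\<^sub>R g' x)) = Lv.n ((Gs k - g) + c *\<^sub>R (Gs' k - g'))"
      by (simp add: L2v_norm_eq plus_fun_def fun_diff_def scaleR_fun_def algebra_simps)
    also have "\<dots> \<le> Lv.n (Gs k - g) + Lv.n (c *\<^sub>R (Gs' k - g'))" using m by (intro Lv.n_triangle Lv.mem)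
    also have "Lv.n (c *\<^sub>R (Gs' k - g')) = \<bar>c\<bar> * Lv.n (Gs' k - g')" using m by (intro Lv.n_scale Lv.mem)
    finally have 2: "L2v_norm \<Omega> (\<lambda>x. ?G k x - (g x + c *\<^sub>R g' x))
        \<le> L2v_norm \<Omega> (\<lambda>x. Gs k x - g x) + \<bar>c\<bar> * L2v_norm \<Omega> (\<lambda>x. Gs' k x - g' x)"
      by (simp add: L2v_norm_eq fun_diff_def)
    show ?thesis using 1 2 by (simp add: distrib_left)
  qed
  have "(\<lambda>k. L2_dist \<Omega> (?\<phi> k) (\<lambda>x. u x + c * w x) + L2v_norm \<Omega> (\<lambda>x. ?G k x - (g x + c *\<^sub>R g' x))) \<longlonglongrightarrow> 0"
  proof (rule Lim_null_comparison)
    show "(\<lambda>k. (L2_dist \<Omega> (\<phi>s k) u + L2v_norm \<Omega> (\<lambda>x. Gs k x - g x))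
        + \<bar>c\<bar> * (L2_dist \<Omega> (\<phi>s' k) w + L2v_norm \<Omega> (\<lambda>x. Gs' k x - g' x))) \<longlonglongrightarrow> 0"
      by (rule tendsto_add_zero[OF g(3) tendsto_mult_right_zero[OF g'(3)]])
    show "\<forall>\<^sub>F k in sequentially. norm (L2_dist \<Omega> (?\<phi> k) (\<lambda>x. u x + c * w x) + L2v_norm \<Omega> (\<lambda>x. ?G k x - (g x + c *\<^sub>R g' x)))
      \<le> (L2_dist \<Omega> (\<phi>s k) u + L2v_norm \<Omega> (\<lambda>x. Gs k x - g x))
        + \<bar>c\<bar> * (L2_dist \<Omega> (\<phi>s' k) w + L2v_norm \<Omega> (\<lambda>x. Gs' k x - g' x))"
      using le by (intro always_eventually) (simp add: L2_dist_def L2_norm_def L2v_norm_def)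
  qed
  with H1_linear[OF g(1) g'(1), of c] test show ?thesis unfolding H10_def
    by (intro exI[of _ "\<lambda>x. g x + c *\<^sub>R g' x"] exI[of _ ?\<phi>] exI[of _ ?G] conjI allI)
qed

lemma H10_zero: "H10 \<Omega> (\<lambda>x. 0)"
proof -
  have "(\<bullet>) (0::'a) = (\<lambda>_. 0)" by auto
  then have "test_pair \<Omega> (\<lambda>x. 0) (\<lambda>x. 0)" unfolding test_pair_def by (auto intro!: exI[of _ "{}"])
  moreover have "H1 \<Omega> (\<lambda>x. 0) (\<lambda>x. 0)" by (simp add: H1_def L2_zero weak_grad_def)
  moreover have "(\<lambda>k::nat. L2_dist \<Omega> (\<lambda>x. 0) (\<lambda>x. 0) + L2v_norm \<Omega> (\<lambda>x. 0 - 0)) \<longlonglongrightarrow> 0"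
    by (simp add: L2_dist_def L2_norm_def L2v_norm_def)
  ultimately show ?thesis unfolding H10_def
    by (intro exI[of _ "\<lambda>x. 0"] exI[of _ "\<lambda>k x. 0"] conjI allI) auto
qed

lemma Dir_eq: "Dir \<Omega> u w = L2v_inner \<Omega> (grad \<Omega> u) (grad \<Omega> w)"
  by (simp add: Dir_def L2v_inner_def)

lemma psd_form_Dir: "psd_form {u. H10 \<Omega> u} (Dir \<Omega>)"
proof
  have gm: "grad \<Omega> u \<in> L2v \<Omega>" if "H10 \<Omega> u" for u using H1_L2v[OF H10_H1[OF that]] .
  have lin: "Dir \<Omega> (\<lambda>x. u x + c * w x) y = Dir \<Omega> u y + c * Dir \<Omega> w y"
    if "H10 \<Omega> u" "H10 \<Omega> w" "H10 \<Omega> y" for u w y c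
  proof -
    have "AE x in lebesgue_on \<Omega>. grad \<Omega> (\<lambda>x. u x + c * w x) x = (grad \<Omega> u + c *\<^sub>R grad \<Omega> w) x"
      using weak_gradient_unique[OF H10_H1[OF H10_linear[OF that(1,2), of c]]
          H1_linear[OF H10_H1[OF that(1)] H10_H1[OF that(2)], of c]]
      by simp
    then have "Dir \<Omega> (\<lambda>x. u x + c * w x) y = L2v_inner \<Omega> (grad \<Omega> u + c *\<^sub>R grad \<Omega> w) (grad \<Omega> y)"
      unfolding Dir_eq using that gm H10_linear[OF that(1,2), of c]
      by (intro L2v_inner_cong Lv.mem) auto
    then show ?thesis using that gm by (simp add: Dir_eq Lv.bilin Lv.mem)
  qed
  show "subspace {u. H10 \<Omega> u}"
    using H10_zero H10_linear[of _ _ 1] H10_linear[OF H10_zero]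
    by (auto simp: subspace_def zero_fun_def plus_fun_def scaleR_fun_def)
  fix u u' w assume m: "u \<in> {u. H10 \<Omega> u}" "w \<in> {u. H10 \<Omega> u}"
  show "Dir \<Omega> u w = Dir \<Omega> w u" using m gm by (simp add: Dir_eq Lv.commute)
  show "Dir \<Omega> (u + u') w = Dir \<Omega> u w + Dir \<Omega> u' w" if "u' \<in> {u. H10 \<Omega> u}"
    using lin[of u u' w 1] m that by (simp add: plus_fun_def)
  show "Dir \<Omega> u u \<ge> 0" using m gm by (simp add: Dir_eq Lv.nonneg)
  fix c :: real
  have "Dir \<Omega> (\<lambda>x. 0 + 1 * 0) w = Dir \<Omega> (\<lambda>x. 0) w + 1 * Dir \<Omega> (\<lambda>x. 0) w"
    by (rule lin) (use m H10_zero in auto)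
  then have "Dir \<Omega> (\<lambda>x. 0) w = 0" by simp
  then show "Dir \<Omega> (c *\<^sub>R u) w = c * Dir \<Omega> u w"
    using lin[OF H10_zero, of u w c] m by (simp add: scaleR_fun_def)
qed

lemma poincare_test:
  assumes t: "test_pair \<Omega> \<phi> G" and R: "\<And>x. x \<in> \<Omega> \<Longrightarrow> norm x \<le> R"
  shows "L2_norm \<Omega> \<phi> \<le> 2 * R * L2v_norm \<Omega> G"
proof -
  obtain K where K: "compact K" "K \<subseteq> \<Omega>" "\<And>x. x \<notin> K \<Longrightarrow> \<phi> x = 0" "\<And>x. x \<notin> K \<Longrightarrow> G x = 0"
    using test_pair_gradient_support[OF t] by metis
  obtain b :: 'a where b: "b \<in> Basis" using nonempty_Basis by blast
  note cont = test_pair_continuous[OF t]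
  have der: "(\<phi> has_derivative (\<lambda>h. G x \<bullet> h)) (at x)" for x using t by (simp add: test_pair_def)
  define \<psi> where "\<psi> x = (x \<bullet> b) * (G x \<bullet> b)" for x
  define Q where "Q x = (2 * \<phi> x * (x \<bullet> b)) *\<^sub>R G x + (\<phi> x)\<^sup>2 *\<^sub>R b" for x
  have "(\<integral>x. Q x \<bullet> b \<partial>lborel) = 0"
  proof (rule integral_partial_derivative_zero[where f = "\<lambda>x. \<phi> x * \<phi> x * (x \<bullet> b)"])
    show "((\<lambda>x. \<phi> x * \<phi> x * (x \<bullet> b)) has_derivative (\<lambda>h. Q x \<bullet> h)) (at x)" for x
      by (rule has_derivative_eq_rhs[OF has_derivative_mult[OF has_derivative_mult[OF der der]
            has_derivative_inner_left[OF has_derivative_ident]]])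
        (auto simp: Q_def inner_add_left inner_commute[of b] power2_eq_square algebra_simps)
    show "continuous_on UNIV Q" unfolding Q_def using cont by (intro continuous_intros)
    show "compact K" by fact
    show "\<phi> x * \<phi> x * (x \<bullet> b) = 0" if "x \<notin> K" for x using K that by simp
    show "norm b = 1" using b by simp
  qed
  moreover have "(\<integral>x. Q x \<bullet> b \<partial>lebesgue_on \<Omega>) = (\<integral>x. Q x \<bullet> b \<partial>lborel)"
  proof -
    have "(\<integral>x. Q x \<bullet> b \<partial>lebesgue_on \<Omega>) = (\<integral>x. indicator \<Omega> x *\<^sub>R (Q x \<bullet> b) \<partial>lebesgue)"
      using meas by (subst integral_restrict_space) auto
    also have "(\<lambda>x. indicator \<Omega> x *\<^sub>R (Q x \<bullet> b)) = (\<lambda>x. Q x \<bullet> b)"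
    proof
      fix x
      show "indicator \<Omega> x *\<^sub>R (Q x \<bullet> b) = Q x \<bullet> b"
      proof (cases "x \<in> \<Omega>")
        case False
        then have "\<phi> x = 0" using K by blast
        then show ?thesis using False by (simp add: Q_def)
      qed simp
    qed
    also have "(\<integral>x. Q x \<bullet> b \<partial>lebesgue) = (\<integral>x. Q x \<bullet> b \<partial>lborel)"
    proof (rule integral_completion)
      have "continuous_on UNIV (\<lambda>x. Q x \<bullet> b)" unfolding Q_def using cont by (intro continuous_intros)
      then show "(\<lambda>x. Q x \<bullet> b) \<in> borel_measurable lborel"
        by (simp add: borel_measurable_continuous_onI)
    qed
    finally show ?thesis .
  qed
  moreover have \<phi>L: "\<phi> \<in> {u. L2 \<Omega> u}" and GL: "G \<in> L2v \<Omega>" using test_pair_L2[OF t] by auto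
  have Gb: "L2 \<Omega> (\<lambda>x. G x \<bullet> b)" using GL b by (simp add: L2v_def)
  have xb: "\<bar>x \<bullet> b\<bar> \<le> R" if "x \<in> \<Omega>" for x
    using Basis_le_norm[OF b, of x] R[OF that] by simp
  have \<psi>L: "\<psi> \<in> {u. L2 \<Omega> u}"
  proof -
    have "\<psi> \<in> borel_measurable (lebesgue_on \<Omega>)"
      unfolding \<psi>_def using cont
      by (intro continuous_measurable continuous_intros continuous_on_subset[OF cont(2)]) auto
    moreover have "\<bar>\<psi> x\<bar> \<le> R * \<bar>G x \<bullet> b\<bar>" if "x \<in> \<Omega>" for x
      unfolding \<psi>_def abs_mult using xb[OF that] by (intro mult_right_mono) auto
    ultimately have "L2 \<Omega> \<psi>" by (rule L2_bound[OF Gb])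
    then show ?thesis by simp
  qed
  moreover have "(\<integral>x. Q x \<bullet> b \<partial>lebesgue_on \<Omega>) = 2 * L2_inner \<Omega> \<phi> \<psi> + L2_inner \<Omega> \<phi> \<phi>"
  proof -
    have "Q x \<bullet> b = 2 * (\<phi> x * \<psi> x) + \<phi> x * \<phi> x" for x
      using b by (simp add: Q_def \<psi>_def inner_add_left power2_eq_square)
    then show ?thesis using \<phi>L \<psi>L by (simp add: L2_inner_def L2_mult_integrable)
  qed
  ultimately have "L2_inner \<Omega> \<phi> \<phi> = - 2 * L2_inner \<Omega> \<phi> \<psi>" by simp
  also have "\<dots> \<le> 2 * (L.n \<phi> * L.n \<psi>)" using L.cauchy_schwarz_ge[OF \<phi>L \<psi>L] by simp
  also have "L2_inner \<Omega> \<phi> \<phi> = L.n \<phi> * L.n \<phi>" using L.n_sq[OF \<phi>L] by (simp add: power2_eq_square)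
  finally have "L.n \<phi> * L.n \<phi> \<le> L.n \<phi> * (2 * L.n \<psi>)" by simp
  then have 1: "L.n \<phi> \<le> 2 * L.n \<psi>"
    using L.n_nonneg[OF \<phi>L] L.n_nonneg[OF \<psi>L] by (cases "L.n \<phi> = 0") auto
  have "\<bar>R\<bar> * Lv.n G \<ge> 0" using Lv.n_nonneg[OF GL] by simp
  have "(L.n \<psi>)\<^sup>2 \<le> (\<bar>R\<bar> * Lv.n G)\<^sup>2"
  proof -
    have "(L.n \<psi>)\<^sup>2 = (\<integral>x. (\<psi> x)\<^sup>2 \<partial>lebesgue_on \<Omega>)" using L.n_sq[OF \<psi>L] by (simp add: L2_inner_def power2_eq_square)
    also have "\<dots> \<le> (\<integral>x. R\<^sup>2 * (G x \<bullet> G x) \<partial>lebesgue_on \<Omega>)"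
    proof (rule integral_mono)
      show "integrable (lebesgue_on \<Omega>) (\<lambda>x. (\<psi> x)\<^sup>2)" using \<psi>L by (simp add: L2_def)
      show "integrable (lebesgue_on \<Omega>) (\<lambda>x. R\<^sup>2 * (G x \<bullet> G x))" using L2v_inner_integrable[OF GL GL] by simp
      fix x assume x: "x \<in> space (lebesgue_on \<Omega>)"
      have "(x \<bullet> b)\<^sup>2 \<le> R\<^sup>2"
      proof -
        have "\<bar>x \<bullet> b\<bar>\<^sup>2 \<le> R\<^sup>2" using xb[of x] x by (intro power_mono) auto
        then show ?thesis by simp
      qed
      moreover have "(G x \<bullet> b)\<^sup>2 \<le> G x \<bullet> G x"
      proof -
        have "\<bar>G x \<bullet> b\<bar>\<^sup>2 \<le> (norm (G x))\<^sup>2" using Basis_le_norm[OF b, of "G x"] by (intro power_mono) auto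
        then show ?thesis by (simp add: power2_norm_eq_inner)
      qed
      ultimately show "(\<psi> x)\<^sup>2 \<le> R\<^sup>2 * (G x \<bullet> G x)"
        unfolding \<psi>_def power_mult_distrib by (intro mult_mono) auto
    qed
    also have "\<dots> = (\<bar>R\<bar> * Lv.n G)\<^sup>2" using Lv.n_sq[OF GL] by (simp add: L2v_inner_def power_mult_distrib)
    finally show ?thesis .
  qed
  then have "L.n \<psi> \<le> \<bar>R\<bar> * Lv.n G" using \<open>\<bar>R\<bar> * Lv.n G \<ge> 0\<close> by (rule power2_le_imp_le)
  with 1 have 2: "L.n \<phi> \<le> 2 * \<bar>R\<bar> * Lv.n G" by simp
  show ?thesis
  proof (cases "\<Omega> = {}")
    case True
    then have "space (lebesgue_on \<Omega>) = {}" by simp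
    then show ?thesis by (simp add: L2_norm_def L2v_norm_def Bochner_Integration.integral_empty)
  next
    case False
    then obtain x where "x \<in> \<Omega>" by blast
    then have "R \<ge> 0" using R[of x] norm_ge_zero[of x] by linarith
    then show ?thesis using 2 by (simp add: L2_norm_eq L2v_norm_eq)
  qed
qed

lemma poincare_H10:
  assumes u: "H10 \<Omega> u" and R: "R > 0" "\<And>x. x \<in> \<Omega> \<Longrightarrow> norm x \<le> R"
  shows "1 / (2 * R)\<^sup>2 * L2_inner \<Omega> u u \<le> Dir \<Omega> u u"
proof -
  obtain g \<phi>s Gs where g: "H1 \<Omega> u g" "\<And>k::nat. test_pair \<Omega> (\<phi>s k) (Gs k)"
      "(\<lambda>k. L2_dist \<Omega> (\<phi>s k) u + L2v_norm \<Omega> (\<lambda>x. Gs k x - g x)) \<longlonglongrightarrow> 0"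
    using u unfolding H10_def by blast
  have gL: "g \<in> L2v \<Omega>" and uL: "u \<in> {u. L2 \<Omega> u}" using H1_L2v[OF g(1)] H10_L2[OF u] by auto
  define \<delta> where "\<delta> k = L2_dist \<Omega> (\<phi>s k) u + L2v_norm \<Omega> (\<lambda>x. Gs k x - g x)" for k
  have "L.n u \<le> 2 * R * Lv.n g + (1 + 2 * R) * \<delta> k" for k
  proof -
    have m: "\<phi>s k \<in> {u. L2 \<Omega> u}" "Gs k \<in> L2v \<Omega>" using test_pair_L2[OF g(2)] by auto
    have d: "L.n (\<phi>s k - u) = L2_dist \<Omega> (\<phi>s k) u" "Lv.n (Gs k - g) = L2v_norm \<Omega> (\<lambda>x. Gs k x - g x)"
      by (simp_all add: L2_dist_def L2_norm_eq L2v_norm_eq fun_diff_def)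
    have d0: "L.n (\<phi>s k - u) \<ge> 0" "Lv.n (Gs k - g) \<ge> 0"
      using L.n_nonneg[OF L.diff_mem[OF m(1) uL]] Lv.n_nonneg[OF Lv.diff_mem[OF m(2) gL]] by auto
    have "L.n u \<le> L.n (\<phi>s k - u) + L.n (\<phi>s k)"
      using L.n_le_add_diff[OF uL m(1)] L.n_diff_commute[OF uL m(1)] by simp
    also have "L.n (\<phi>s k) \<le> 2 * R * Lv.n (Gs k)"
      using poincare_test[OF g(2) R(2)] by (simp add: L2_norm_eq L2v_norm_eq)
    also have "\<dots> \<le> 2 * R * (Lv.n (Gs k - g) + Lv.n g)"
      using R Lv.n_le_add_diff[OF m(2) gL] by (intro mult_left_mono) auto
    finally have "L.n u \<le> 2 * R * Lv.n g + L.n (\<phi>s k - u) + 2 * R * Lv.n (Gs k - g)"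
      unfolding distrib_left by linarith
    also have "\<dots> \<le> 2 * R * Lv.n g + (1 + 2 * R) * \<delta> k"
    proof -
      have "0 \<le> Lv.n (Gs k - g) + 2 * R * L.n (\<phi>s k - u)" using d0 R by simp
      then show ?thesis unfolding \<delta>_def d[symmetric] by (simp add: algebra_simps)
    qed
    finally show ?thesis .
  qed
  moreover have "(\<lambda>k. 2 * R * Lv.n g + (1 + 2 * R) * \<delta> k) \<longlonglongrightarrow> 2 * R * Lv.n g + (1 + 2 * R) * 0"
    using g(3) unfolding \<delta>_def by (intro tendsto_intros)
  ultimately have "L.n u \<le> 2 * R * Lv.n g" by (intro LIMSEQ_le_const[of _ "2 * R * Lv.n g"]) auto
  then have "(L.n u)\<^sup>2 \<le> (2 * R * Lv.n g)\<^sup>2" using L.n_nonneg[OF uL] by (intro power_mono)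
  then have "L2_inner \<Omega> u u \<le> (2 * R)\<^sup>2 * L2v_inner \<Omega> g g"
    using L.n_sq[OF uL] Lv.n_sq[OF gL] by (simp add: power_mult_distrib)
  also have "L2v_inner \<Omega> g g = Dir \<Omega> u u"
  proof -
    have gr: "grad \<Omega> u \<in> L2v \<Omega>" using H1_L2v[OF H10_H1[OF u]] .
    have ae: "AE x in lebesgue_on \<Omega>. g x = grad \<Omega> u x" by (rule weak_gradient_unique[OF g(1) H10_H1[OF u]])
    have "L2v_inner \<Omega> g g = L2v_inner \<Omega> (grad \<Omega> u) g" by (rule L2v_inner_cong[OF ae gL gr gL])
    also have "\<dots> = L2v_inner \<Omega> g (grad \<Omega> u)" using gL gr by (rule Lv.commute[rotated])
    also have "\<dots> = Dir \<Omega> u u" unfolding Dir_eq by (rule L2v_inner_cong[OF ae gL gr gr])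
    finally show ?thesis .
  qed
  finally show ?thesis using R(1) by (simp add: field_simps)
qed

lemma form_triple_L2_H10:
  assumes "R > 0" "\<And>x. x \<in> \<Omega> \<Longrightarrow> norm x \<le> R"
  shows "form_triple {u. L2 \<Omega> u} {u. H10 \<Omega> u} (L2_inner \<Omega>) (Dir \<Omega>) (1 / (2 * R)\<^sup>2)"
  by (intro form_triple.intro psd_form_L2 psd_form_Dir form_triple_axioms.intro)
    (use assms poincare_H10[OF _ assms] H10_L2 in auto)

end

section \<open>The concrete problem\<close>

lemma lap_C2_on_closure:
  assumes S: "open S" and f: "C2_on_closure S f"
  obtains F where "continuous_on (closure S) F" "\<And>x. x \<in> S \<Longrightarrow> lap f x = F x"
proof -
  obtain G H where G: "\<And>x. x \<in> S \<Longrightarrow> (f has_derivative (\<lambda>h. G x \<bullet> h)) (at x)"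
    and H: "\<And>b x. b \<in> Basis \<Longrightarrow> x \<in> S \<Longrightarrow> ((\<lambda>y. G y \<bullet> b) has_derivative (\<lambda>h. H b x \<bullet> h)) (at x)"
    and c: "\<And>b. b \<in> Basis \<Longrightarrow> continuous_on (closure S) (H b)"
    using f unfolding C2_on_closure_def by blast
  have "lap f x = (\<Sum>b\<in>Basis. H b x \<bullet> b)" if x: "x \<in> S" for x
    unfolding lap_def
  proof (rule sum.cong[OF refl])
    fix b :: 'a assume b: "b \<in> Basis"
    have "((\<lambda>y. frechet_derivative f (at y) b) has_derivative (\<lambda>h. H b x \<bullet> h)) (at x)"
    proof (rule has_derivative_transform_within_open[OF H[OF b x] S x])
      fix y assume "y \<in> S"
      then show "G y \<bullet> b = frechet_derivative f (at y) b"
        using frechet_derivative_at[OF G] by metis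
    qed
    then show "frechet_derivative (\<lambda>y. frechet_derivative f (at y) b) (at x) b = H b x \<bullet> b"
      using frechet_derivative_at by metis
  qed
  moreover have "continuous_on (closure S) (\<lambda>x. \<Sum>b\<in>Basis. H b x \<bullet> b)"
    using c by (intro continuous_intros)
  ultimately show ?thesis using that by blast
qed

context bdd_domain
begin

lemma continuous_closure_bounded:
  assumes "continuous_on (closure \<Omega>) (f :: 'a \<Rightarrow> real)"
  obtains B where "\<And>x. x \<in> \<Omega> \<Longrightarrow> \<bar>f x\<bar> \<le> B"
proof -
  have "bounded (f ` closure \<Omega>)"
    using assms bdd by (intro compact_imp_bounded compact_continuous_image) auto
  then obtain B where "\<And>x. x \<in> closure \<Omega> \<Longrightarrow> norm (f x) \<le> B" unfolding bounded_iff by blast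
  then show ?thesis using that closure_subset by (metis real_norm_def subsetD)
qed

lemma continuous_closure_measurable:
  "continuous_on (closure \<Omega>) f \<Longrightarrow> f \<in> borel_measurable (lebesgue_on \<Omega>)"
  by (rule continuous_measurable[OF continuous_on_subset[OF _ closure_subset]])

lemma lap_L2:
  assumes "C2_on_closure \<Omega> f"
  shows "L2 \<Omega> (lap f)"
proof -
  obtain F where F: "continuous_on (closure \<Omega>) F" "\<And>x. x \<in> \<Omega> \<Longrightarrow> lap f x = F x"
    using lap_C2_on_closure[OF opn assms] by blast
  obtain B where B: "\<And>x. x \<in> \<Omega> \<Longrightarrow> \<bar>F x\<bar> \<le> B" using continuous_closure_bounded[OF F(1)] by blast
  have "lap f \<in> borel_measurable (lebesgue_on \<Omega>)"
    using continuous_closure_measurable[OF F(1)] by (subst measurable_cong[where g = F]) (use F(2) in auto)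
  then show ?thesis by (rule bounded_L2) (use F(2) B in auto)
qed

lemma n_mono:
  assumes u: "L2 \<Omega> u" and w: "L2 \<Omega> w" and le: "\<And>x. x \<in> \<Omega> \<Longrightarrow> \<bar>u x\<bar> \<le> w x"
  shows "L.n u \<le> L.n w"
  unfolding L2_norm_eq L2_norm_def
proof (rule real_sqrt_le_mono, rule integral_mono)
  fix x assume "x \<in> space (lebesgue_on \<Omega>)"
  then have "\<bar>u x\<bar>\<^sup>2 \<le> (w x)\<^sup>2" using le[of x] by (intro power_mono) auto
  then show "(u x)\<^sup>2 \<le> (w x)\<^sup>2" by simp
qed (use u w in \<open>auto simp: L2_def\<close>)

lemma L2_abs: "L2 \<Omega> u \<Longrightarrow> L2 \<Omega> (\<lambda>x. \<bar>u x\<bar>)"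
  by (auto simp: L2_def)

lemma n_abs: "L.n (\<lambda>x. \<bar>u x\<bar>) = L.n u"
  by (simp add: L2_norm_eq L2_norm_def)

end

locale diffusion_problem = bdd_domain \<Omega> for \<Omega> :: "'a::euclidean_space set" +
  fixes D Ec \<mu> \<nu> \<beta>G \<beta>inf :: real and \<beta>0 :: "real \<Rightarrow> real \<Rightarrow> real" and \<phi> \<psi> :: "'a \<Rightarrow> real"
  assumes D: "D > 0" and Ec: "Ec > 0" and \<mu>: "\<mu> > 0" and \<nu>: "\<nu> > 0"
    and \<beta>0_C2: "C2_on_closure UNIV (\<lambda>p. \<beta>0 (fst p) (snd p))"
    and \<beta>G: "\<beta>G > 0" and \<beta>inf: "\<beta>inf \<ge> \<beta>G"
    and \<beta>0_inf: "\<exists>R. \<forall>u \<sigma>. \<bar>u\<bar> + \<bar>\<sigma>\<bar> \<ge> R \<longrightarrow> \<beta>0 u \<sigma> = \<beta>inf"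
    and \<phi>: "C2_on_closure \<Omega> \<phi>" and \<psi>: "C2_on_closure \<Omega> \<psi>"
begin

definition \<kappa> :: "real \<times> real \<Rightarrow> real" where
  "\<kappa> p = (\<beta>0 (fst p) (snd p) - \<beta>inf) * snd p"

definition \<Gamma> :: "('a \<Rightarrow> real) \<Rightarrow> ('a \<Rightarrow> real) \<Rightarrow> 'a \<Rightarrow> real" where
  "\<Gamma> v \<tau> = (\<lambda>x. gamma \<beta>0 \<mu> \<nu> \<phi> \<psi> x (v x) (\<tau> x))"

definition rem :: "('a \<Rightarrow> real) \<Rightarrow> ('a \<Rightarrow> real) \<Rightarrow> 'a \<Rightarrow> real" where
  "rem v \<tau> x = \<mu> * \<phi> x - \<beta>inf * \<psi> x - \<kappa> (v x + \<phi> x, \<tau> x + \<nu> * v x + \<psi> x)"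

lemma \<Gamma>_eq: "\<Gamma> v \<tau> x = (\<mu> - \<nu> * \<beta>inf) * v x - \<beta>inf * \<tau> x + rem v \<tau> x"
  by (simp add: \<Gamma>_def rem_def \<kappa>_def gamma_def beta_def gfun_def algebra_simps)

lemma \<kappa>_props:
  obtains M B where "continuous_on UNIV \<kappa>" "M \<ge> 0" "\<And>p q. \<bar>\<kappa> q - \<kappa> p\<bar> \<le> M * norm (q - p)" "\<And>p. \<bar>\<kappa> p\<bar> \<le> B"
proof -
  obtain R0 where R0: "\<And>u \<sigma>. \<bar>u\<bar> + \<bar>\<sigma>\<bar> \<ge> R0 \<Longrightarrow> \<beta>0 u \<sigma> = \<beta>inf" using \<beta>0_inf by blast
  let ?K = "cball (0::real \<times> real) \<bar>R0\<bar>"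
  have K0: "\<kappa> p = 0" if "p \<notin> ?K" for p
  proof -
    have "\<bar>R0\<bar> < norm p" using that by simp
    also have "norm p \<le> \<bar>fst p\<bar> + \<bar>snd p\<bar>" using norm_Pair_le[of "fst p" "snd p"] by simp
    finally have "\<beta>0 (fst p) (snd p) = \<beta>inf" by (intro R0) auto
    then show ?thesis by (simp add: \<kappa>_def)
  qed
  have "C1 \<kappa>"
  proof -
    have "C1 (\<lambda>p. \<beta>0 (fst p) (snd p))"
      using \<beta>0_C2 unfolding C2_on_closure_def C1_def by auto
    then have "C1 (\<lambda>p. \<beta>0 (fst p) (snd p) - \<beta>inf)"
      by (rule C1_compose[where r = "\<lambda>s. s - \<beta>inf" and r' = "\<lambda>_. 1"]) (auto intro!: derivative_eq_intros)
    moreover have "C1 (\<lambda>p::real \<times> real. snd p)"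
      using C1_coordinate[of "(0, 1) :: real \<times> real"] by (simp add: inner_prod_def)
    ultimately show ?thesis unfolding \<kappa>_def[abs_def] by (rule C1_mult)
  qed
  then obtain G where G: "\<And>x. (\<kappa> has_derivative (\<lambda>h. G x \<bullet> h)) (at x)" "continuous_on UNIV G"
    unfolding C1_def by blast
  have cont: "continuous_on UNIV \<kappa>" using \<open>C1 \<kappa>\<close> by (rule C1_continuous)
  obtain M where M: "M \<ge> 0" "\<And>p q. \<bar>\<kappa> q - \<kappa> p\<bar> \<le> M * norm (q - p)"
    using compact_support_lipschitz[OF G, of ?K] K0 by auto
  have "bounded (\<kappa> ` ?K)" by (intro compact_imp_bounded compact_continuous_image continuous_on_subset[OF cont]) auto
  then obtain B where "\<And>p. p \<in> ?K \<Longrightarrow> norm (\<kappa> p) \<le> B" unfolding bounded_iff by blast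
  then have "\<bar>\<kappa> p\<bar> \<le> max B 0" for p using K0[of p] by (cases "p \<in> ?K") (auto simp: le_max_iff_disj)
  with that[OF cont M] show ?thesis by blast
qed

lemma data_continuous: "continuous_on (closure \<Omega>) \<phi>" "continuous_on (closure \<Omega>) \<psi>"
  using \<phi> \<psi> by (auto simp: C2_on_closure_def)

lemma rem_bounded:
  obtains B where "\<And>v \<tau> x. x \<in> \<Omega> \<Longrightarrow> \<bar>rem v \<tau> x\<bar> \<le> B"
proof -
  obtain B1 B2 B3 where B: "\<And>x. x \<in> \<Omega> \<Longrightarrow> \<bar>\<phi> x\<bar> \<le> B1" "\<And>x. x \<in> \<Omega> \<Longrightarrow> \<bar>\<psi> x\<bar> \<le> B2" "\<And>p. \<bar>\<kappa> p\<bar> \<le> B3"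
    using continuous_closure_bounded[OF data_continuous(1)] continuous_closure_bounded[OF data_continuous(2)] \<kappa>_props
    by metis
  have "\<bar>rem v \<tau> x\<bar> \<le> \<mu> * B1 + \<bar>\<beta>inf\<bar> * B2 + B3" if x: "x \<in> \<Omega>" for v \<tau> x
  proof -
    have "\<bar>\<mu> * \<phi> x\<bar> \<le> \<mu> * B1" using B(1)[OF x] \<mu> by (simp add: abs_mult)
    moreover have "\<bar>\<beta>inf * \<psi> x\<bar> \<le> \<bar>\<beta>inf\<bar> * B2" using B(2)[OF x] by (simp add: abs_mult mult_left_mono)
    ultimately show ?thesis using B(3)[of "(v x + \<phi> x, \<tau> x + \<nu> * v x + \<psi> x)"] unfolding rem_def by linarith
  qed
  then show ?thesis using that by blast
qed

lemma rem_measurable: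
  assumes "L2 \<Omega> v" "L2 \<Omega> \<tau>"
  shows "rem v \<tau> \<in> borel_measurable (lebesgue_on \<Omega>)"
proof -
  have cont: "continuous_on UNIV \<kappa>" by (rule \<kappa>_props)
  have m: "\<phi> \<in> borel_measurable (lebesgue_on \<Omega>)" "\<psi> \<in> borel_measurable (lebesgue_on \<Omega>)"
    "v \<in> borel_measurable (lebesgue_on \<Omega>)" "\<tau> \<in> borel_measurable (lebesgue_on \<Omega>)"
    using continuous_closure_measurable data_continuous assms by (auto simp: L2_def)
  have "(\<lambda>x. (v x + \<phi> x, \<tau> x + \<nu> * v x + \<psi> x)) \<in> borel_measurable (lebesgue_on \<Omega>)"
    using m by (intro borel_measurable_Pair) auto
  then have "(\<lambda>x. \<kappa> (v x + \<phi> x, \<tau> x + \<nu> * v x + \<psi> x)) \<in> borel_measurable (lebesgue_on \<Omega>)"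
    by (rule borel_measurable_continuous_on[OF cont])
  then show ?thesis unfolding rem_def[abs_def] using m by auto
qed

lemma rem_L2: "L2 \<Omega> v \<Longrightarrow> L2 \<Omega> \<tau> \<Longrightarrow> L2 \<Omega> (rem v \<tau>)"
  using rem_bounded bounded_L2[OF rem_measurable] by metis

lemma \<Gamma>_fun_eq: "\<Gamma> v \<tau> = ((\<mu> - \<nu> * \<beta>inf) *\<^sub>R v - \<beta>inf *\<^sub>R \<tau>) + rem v \<tau>"
  by (auto simp: \<Gamma>_eq fun_eq_iff)

lemma \<Gamma>_L2: "L2 \<Omega> v \<Longrightarrow> L2 \<Omega> \<tau> \<Longrightarrow> L2 \<Omega> (\<Gamma> v \<tau>)"
  using L.mem rem_L2 unfolding \<Gamma>_fun_eq by (metis mem_Collect_eq)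

lemma \<Gamma>_Lipschitz:
  obtains K where "K \<ge> 0" "\<And>v \<tau> v' \<tau>'. L2 \<Omega> v \<Longrightarrow> L2 \<Omega> \<tau> \<Longrightarrow> L2 \<Omega> v' \<Longrightarrow> L2 \<Omega> \<tau>' \<Longrightarrow>
    L.n (\<Gamma> v \<tau> - \<Gamma> v' \<tau>') \<le> K * (L.n (v - v') + L.n (\<tau> - \<tau>'))"
proof -
  obtain M where M: "M \<ge> 0" "\<And>p q. \<bar>\<kappa> q - \<kappa> p\<bar> \<le> M * norm (q - p)" using \<kappa>_props by metis
  let ?a = "\<mu> - \<nu> * \<beta>inf"
  define K where "K = \<bar>?a\<bar> + \<bar>\<beta>inf\<bar> + M * (1 + \<nu>)"
  have K: "K \<ge> 0" using M \<nu> by (simp add: K_def)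
  have "L.n (\<Gamma> v \<tau> - \<Gamma> v' \<tau>') \<le> K * (L.n (v - v') + L.n (\<tau> - \<tau>'))"
    if m: "L2 \<Omega> v" "L2 \<Omega> \<tau>" "L2 \<Omega> v'" "L2 \<Omega> \<tau>'" for v \<tau> v' \<tau>'
  proof -
    define p where "p = (\<lambda>x. \<bar>v x - v' x\<bar>)"
    define q where "q = (\<lambda>x. \<bar>\<tau> x - \<tau>' x\<bar>)"
    have d: "L2 \<Omega> (v - v')" "L2 \<Omega> (\<tau> - \<tau>')" "L2 \<Omega> (\<Gamma> v \<tau> - \<Gamma> v' \<tau>')"
      using m \<Gamma>_L2 L.diff_mem by auto
    have pq: "p \<in> {u. L2 \<Omega> u}" "q \<in> {u. L2 \<Omega> u}"
      using L2_abs[OF d(1)] L2_abs[OF d(2)] by (auto simp: p_def q_def)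
    have npq: "L.n p = L.n (v - v')" "L.n q = L.n (\<tau> - \<tau>')"
      using n_abs[of "v - v'"] n_abs[of "\<tau> - \<tau>'"] by (auto simp: p_def q_def)
    have "L.n (\<Gamma> v \<tau> - \<Gamma> v' \<tau>') \<le> L.n (K *\<^sub>R (p + q))"
    proof (rule n_mono[OF d(3)])
      show "L2 \<Omega> (K *\<^sub>R (p + q))" using L.scale_mem[OF L.add_mem[OF pq], of K] by simp
      fix x assume "x \<in> \<Omega>"
      let ?P = "(v x + \<phi> x, \<tau> x + \<nu> * v x + \<psi> x)" and ?Q = "(v' x + \<phi> x, \<tau>' x + \<nu> * v' x + \<psi> x)"
      have "norm (?P - ?Q) \<le> (1 + \<nu>) * p x + q x"
      proof -
        have "norm (?P - ?Q) = norm (v x - v' x, (\<tau> x - \<tau>' x) + \<nu> * (v x - v' x))" by (simp add: algebra_simps)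
        also have "\<dots> \<le> \<bar>v x - v' x\<bar> + \<bar>(\<tau> x - \<tau>' x) + \<nu> * (v x - v' x)\<bar>"
          using norm_Pair_le[of "v x - v' x" "(\<tau> x - \<tau>' x) + \<nu> * (v x - v' x)"] by simp
        also have "\<bar>(\<tau> x - \<tau>' x) + \<nu> * (v x - v' x)\<bar> \<le> \<bar>\<tau> x - \<tau>' x\<bar> + \<nu> * \<bar>v x - v' x\<bar>"
          using abs_triangle_ineq[of "\<tau> x - \<tau>' x" "\<nu> * (v x - v' x)"] \<nu> by (simp add: abs_mult)
        finally show ?thesis by (simp add: p_def q_def algebra_simps)
      qed
      also have "\<dots> \<le> (1 + \<nu>) * (p x + q x)" using \<nu> by (simp add: p_def q_def algebra_simps)
      finally have "M * norm (?P - ?Q) \<le> M * ((1 + \<nu>) * (p x + q x))" using M(1) by (intro mult_left_mono)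
      then have \<kappa>: "\<bar>\<kappa> ?P - \<kappa> ?Q\<bar> \<le> M * (1 + \<nu>) * (p x + q x)" using M(2)[of ?P ?Q] by (simp add: mult.assoc)
      have eq: "(\<Gamma> v \<tau> - \<Gamma> v' \<tau>') x = ?a * (v x - v' x) - \<beta>inf * (\<tau> x - \<tau>' x) - (\<kappa> ?P - \<kappa> ?Q)"
        by (simp add: \<Gamma>_eq rem_def algebra_simps)
      have "\<bar>c * y\<bar> \<le> \<bar>c\<bar> * z" if "\<bar>y\<bar> \<le> z" for c y z :: real
        using that by (simp add: abs_mult mult_left_mono)
      then have "\<bar>?a * (v x - v' x)\<bar> \<le> \<bar>?a\<bar> * (p x + q x)" "\<bar>\<beta>inf * (\<tau> x - \<tau>' x)\<bar> \<le> \<bar>\<beta>inf\<bar> * (p x + q x)"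
        by (simp_all add: p_def q_def)
      with \<kappa> have "\<bar>(\<Gamma> v \<tau> - \<Gamma> v' \<tau>') x\<bar> \<le> \<bar>?a\<bar> * (p x + q x) + \<bar>\<beta>inf\<bar> * (p x + q x) + M * (1 + \<nu>) * (p x + q x)"
        unfolding eq by linarith
      also have "\<dots> = K * (p x + q x)" unfolding K_def by (simp only: distrib_right)
      also have "\<dots> = (K *\<^sub>R (p + q)) x" by simp
      finally show "\<bar>(\<Gamma> v \<tau> - \<Gamma> v' \<tau>') x\<bar> \<le> (K *\<^sub>R (p + q)) x" .
    qed
    also have "\<dots> = K * L.n (p + q)" using L.n_scale[OF L.add_mem[OF pq], of K] K by simp
    also have "\<dots> \<le> K * (L.n p + L.n q)" using K L.n_triangle[OF pq] by (rule mult_left_mono[rotated])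
    finally show ?thesis by (simp add: npq)
  qed
  with that K show ?thesis by blast
qed

lemma \<Gamma>_affine_bound:
  obtains C where "\<And>v \<tau>. L2 \<Omega> v \<Longrightarrow> L2 \<Omega> \<tau> \<Longrightarrow>
    L.n (\<Gamma> v \<tau> - ((\<mu> - \<nu> * \<beta>inf) *\<^sub>R v - \<beta>inf *\<^sub>R \<tau>)) \<le> C"
proof -
  obtain B where B: "\<And>v \<tau> x. x \<in> \<Omega> \<Longrightarrow> \<bar>rem v \<tau> x\<bar> \<le> B" using rem_bounded by blast
  have "L2 \<Omega> (\<lambda>x. B)" by (rule bounded_L2[of _ "\<bar>B\<bar>"]) auto
  then have "L.n (rem v \<tau>) \<le> L.n (\<lambda>x. B)" if "L2 \<Omega> v" "L2 \<Omega> \<tau>" for v \<tau>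
    using B that by (intro n_mono rem_L2)
  then show ?thesis using that[of "L.n (\<lambda>x. B)"] by (simp add: \<Gamma>_fun_eq)
qed

lemma hfun_L2: "L2 \<Omega> (hfun D Ec \<phi> \<psi>)"
  unfolding hfun_def[abs_def] by (intro L2_add L2_scale lap_L2 \<phi> \<psi>)

lemma coupled_system_exists:
  obtains lam K C where "coupled_system {u. L2 \<Omega> u} {u. H10 \<Omega> u} (L2_inner \<Omega>) (Dir \<Omega>) lam
    (D + \<nu> * Ec) Ec (hfun D Ec \<phi> \<psi>) \<Gamma> K (\<mu> - \<nu> * \<beta>inf) \<beta>inf C"
proof -
  obtain R0 where R0: "\<And>x. x \<in> \<Omega> \<Longrightarrow> norm x \<le> R0" using bdd unfolding bounded_iff by blast
  define R where "R = max R0 1"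
  have R: "R > 0" "\<And>x. x \<in> \<Omega> \<Longrightarrow> norm x \<le> R" using R0 by (auto simp: R_def le_max_iff_disj)
  obtain K where K: "K \<ge> 0" "\<And>v \<tau> v' \<tau>'. L2 \<Omega> v \<Longrightarrow> L2 \<Omega> \<tau> \<Longrightarrow> L2 \<Omega> v' \<Longrightarrow> L2 \<Omega> \<tau>' \<Longrightarrow>
    L.n (\<Gamma> v \<tau> - \<Gamma> v' \<tau>') \<le> K * (L.n (v - v') + L.n (\<tau> - \<tau>'))" using \<Gamma>_Lipschitz by blast
  obtain C where C: "\<And>v \<tau>. L2 \<Omega> v \<Longrightarrow> L2 \<Omega> \<tau> \<Longrightarrow>
    L.n (\<Gamma> v \<tau> - ((\<mu> - \<nu> * \<beta>inf) *\<^sub>R v - \<beta>inf *\<^sub>R \<tau>)) \<le> C" using \<Gamma>_affine_bound by blast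
  have d: "D + \<nu> * Ec > 0" using D \<nu> Ec by (simp add: add_pos_pos)
  have b: "\<beta>inf > 0" using \<beta>G \<beta>inf by simp
  have "\<beta>inf + (\<mu> - \<nu> * \<beta>inf) * (Ec / (D + \<nu> * Ec)) = (\<beta>inf * D + \<mu> * Ec) / (D + \<nu> * Ec)"
    using d by (simp add: field_simps)
  also have "\<dots> > 0" using d b D \<mu> Ec by (simp add: add_pos_pos)
  finally have "\<beta>inf + (\<mu> - \<nu> * \<beta>inf) * (Ec / (D + \<nu> * Ec)) > 0" .
  then have "coupled_system_axioms {u. L2 \<Omega> u} (L2_inner \<Omega>)
    (D + \<nu> * Ec) Ec (hfun D Ec \<phi> \<psi>) \<Gamma> K (\<mu> - \<nu> * \<beta>inf) \<beta>inf C"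
    using d Ec hfun_L2 K C b \<Gamma>_L2 by unfold_locales auto
  then show ?thesis using form_triple_L2_H10[OF R] that by (blast intro: coupled_system.intro)
qed

lemma integrable_lebesgue_on_subset:
  fixes f :: "real \<Rightarrow> real"
  assumes f: "integrable (lebesgue_on {a..b}) f" and s: "{s..t} \<subseteq> {a..b}"
  shows "integrable (lebesgue_on {s..t}) f"
proof -
  have I: "integrable lebesgue (\<lambda>x. indicator {a..b} x *\<^sub>R f x)" using f by (simp add: integrable_restrict_space)
  have "integrable lebesgue (\<lambda>x. indicator {s..t} x *\<^sub>R (indicator {a..b} x *\<^sub>R f x))"
    by (rule integrable_mult_indicator[OF _ I]) simp
  moreover have "(\<lambda>x. indicator {s..t} x *\<^sub>R (indicator {a..b} x *\<^sub>R f x)) = (\<lambda>x. indicator {s..t} x *\<^sub>R f x)"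
    using s by (auto simp: fun_eq_iff indicator_def)
  ultimately show ?thesis by (simp add: integrable_restrict_space)
qed

lemma weak_solution_imp_sol:
  assumes cs: "coupled_system {u. L2 \<Omega> u} {u. H10 \<Omega> u} (L2_inner \<Omega>) (Dir \<Omega>) lam
      (D + \<nu> * Ec) Ec (hfun D Ec \<phi> \<psi>) \<Gamma> K (\<mu> - \<nu> * \<beta>inf) \<beta>inf C"
    and ws: "weak_solution \<Omega> D Ec \<mu> \<nu> \<beta>0 \<phi> \<psi> v \<tau>"
  shows "coupled_system.sol {u. L2 \<Omega> u} {u. H10 \<Omega> u} (L2_inner \<Omega>) (Dir \<Omega>)
      (D + \<nu> * Ec) Ec (hfun D Ec \<phi> \<psi>) \<Gamma> v \<tau>"
proof -
  interpret coupled_system "{u. L2 \<Omega> u}" "{u. H10 \<Omega> u}" "L2_inner \<Omega>" "Dir \<Omega>" lam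
      "D + \<nu> * Ec" Ec "hfun D Ec \<phi> \<psi>" \<Gamma> K "\<mu> - \<nu> * \<beta>inf" \<beta>inf C by (rule cs)
  let ?d = "D + \<nu> * Ec" and ?h = "hfun D Ec \<phi> \<psi>"
  have vL: "\<And>t. t \<ge> 0 \<Longrightarrow> L2 \<Omega> (v t)"
    and vc: "\<And>t. t \<ge> 0 \<Longrightarrow> ((\<lambda>s. L2_dist \<Omega> (v s) (v t)) \<longlongrightarrow> 0) (at t within {0..})"
    and \<tau>V: "\<And>t. t \<ge> 0 \<Longrightarrow> H10 \<Omega> (\<tau> t)"
    and \<tau>c: "\<And>t. t \<ge> 0 \<Longrightarrow> ((\<lambda>s. H1_norm \<Omega> (\<lambda>x. \<tau> s x - \<tau> t x)) \<longlongrightarrow> 0) (at t within {0..})"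
    and vH: "\<And>T. T > 0 \<Longrightarrow> L2H10 \<Omega> T v"
    and veq: "\<And>w s t. H10 \<Omega> w \<Longrightarrow> 0 \<le> s \<Longrightarrow> s \<le> t \<Longrightarrow> L2_inner \<Omega> (v t) w - L2_inner \<Omega> (v s) w =
          (\<integral>r. (- ?d * Dir \<Omega> (v r) w - Ec * Dir \<Omega> (\<tau> r) w + L2_inner \<Omega> ?h w) \<partial>lebesgue_on {s..t})"
    and \<tau>eq: "\<And>w s t. H10 \<Omega> w \<Longrightarrow> 0 \<le> s \<Longrightarrow> s \<le> t \<Longrightarrow> L2_inner \<Omega> (\<tau> t) w - L2_inner \<Omega> (\<tau> s) w =
          (\<integral>r. L2_inner \<Omega> (\<Gamma> (v r) (\<tau> r)) w \<partial>lebesgue_on {s..t})"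
    using ws unfolding weak_solution_def \<Gamma>_def by auto
  have H1n: "(H1_norm \<Omega> u)\<^sup>2 = (n u)\<^sup>2 + Dir \<Omega> u u" for u
  proof -
    have "(L2v_norm \<Omega> (grad \<Omega> u))\<^sup>2 = Dir \<Omega> u u"
      unfolding L2v_norm_def Dir_def by (simp add: power2_norm_eq_inner)
    moreover have "(H1_norm \<Omega> u)\<^sup>2 = (L2_norm \<Omega> u)\<^sup>2 + (L2v_norm \<Omega> (grad \<Omega> u))\<^sup>2"
      unfolding H1_norm_def by (rule real_sqrt_pow2) simp
    ultimately show ?thesis by (simp add: L2_norm_eq)
  qed
  have nV: "n u \<le> H1_norm \<Omega> u" "dr.n u \<le> H1_norm \<Omega> u" if "H10 \<Omega> u" for u
  proof -
    have 0: "H1_norm \<Omega> u \<ge> 0" by (simp add: H1_norm_def)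
    have "(n u)\<^sup>2 \<le> (H1_norm \<Omega> u)\<^sup>2" "(dr.n u)\<^sup>2 \<le> (H1_norm \<Omega> u)\<^sup>2"
      using H1n[of u] dr.nonneg[of u] dr.n_sq[of u] that by auto
    then show "n u \<le> H1_norm \<Omega> u" "dr.n u \<le> H1_norm \<Omega> u" using 0 by (auto intro: power2_le_imp_le)
  qed
  have ncv: "L.ncont v"
    using vL vc by (simp add: L.ncont_def L2_norm_eq L2_dist_def fun_diff_def)
  have \<tau>d: "H10 \<Omega> (\<tau> s - \<tau> t)" if "s \<ge> 0" "t \<ge> 0" for s t
    using dr.diff_mem[of "\<tau> s" "\<tau> t"] \<tau>V that by simp
  have nc\<tau>: "L.ncont \<tau>" "dr.ncont \<tau>"
  proof -
    have "((\<lambda>s. n (\<tau> s - \<tau> t)) \<longlongrightarrow> 0) (at t within {0..}) \<and> ((\<lambda>s. dr.n (\<tau> s - \<tau> t)) \<longlongrightarrow> 0) (at t within {0..})"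
      if t: "t \<ge> 0" for t
    proof
      have lim: "((\<lambda>s. H1_norm \<Omega> (\<tau> s - \<tau> t)) \<longlongrightarrow> 0) (at t within {0..})"
        using \<tau>c[OF t] by (simp add: fun_diff_def)
      show "((\<lambda>s. n (\<tau> s - \<tau> t)) \<longlongrightarrow> 0) (at t within {0..})"
        by (rule Lim_null_comparison[OF _ lim])
          (use t nV \<tau>d H10_L2 in \<open>auto simp: eventually_at_filter L.n_nonneg intro!: always_eventually\<close>)
      show "((\<lambda>s. dr.n (\<tau> s - \<tau> t)) \<longlongrightarrow> 0) (at t within {0..})"
        by (rule Lim_null_comparison[OF _ lim])
          (use t nV \<tau>d in \<open>auto simp: eventually_at_filter dr.n_nonneg intro!: always_eventually\<close>)
    qed
    then show "L.ncont \<tau>" "dr.ncont \<tau>"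
      using \<tau>V H10_L2 by (auto simp: L.ncont_def dr.ncont_def)
  qed
  have "\<exists>N. negligible N \<and> (\<forall>t. t \<in> {0..real (Suc k)} \<longrightarrow> t \<notin> N \<longrightarrow> H10 \<Omega> (v t))" for k :: nat
  proof -
    have "AE t in lebesgue_on {0..real (Suc k)}. H10 \<Omega> (v t)"
      using vH[of "real (Suc k)"] unfolding L2H10_def by simp
    then have "AE t in lebesgue. t \<in> {0..real (Suc k)} \<longrightarrow> H10 \<Omega> (v t)"
      by (subst (asm) AE_restrict_space_iff) auto
    then obtain N where "\<And>t. t \<in> space lebesgue - N \<Longrightarrow> t \<in> {0..real (Suc k)} \<longrightarrow> H10 \<Omega> (v t)" "N \<in> null_sets lebesgue"
      by (rule AE_E3) auto
    then show ?thesis unfolding negligible_iff_null_sets by (intro exI[of _ N]) simp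
  qed
  then obtain Nk where Nk: "\<And>k. negligible (Nk k)" "\<And>k t. t \<in> {0..real (Suc k)} \<Longrightarrow> t \<notin> Nk k \<Longrightarrow> H10 \<Omega> (v t)"
    by metis
  define Z where "Z = (\<Union>k. Nk k)"
  have Z: "negligible Z" unfolding Z_def using Nk(1) by (rule negligible_Union_nat)
  have vV: "H10 \<Omega> (v t)" if "t \<ge> 0" "t \<notin> Z" for t
  proof -
    obtain k where "t \<le> real k" using real_arch_simple by blast
    then show ?thesis using Nk(2)[of t k] that by (auto simp: Z_def)
  qed
  define m where "m r = 2 * ?d\<^sup>2 * (H1_norm \<Omega> (v r))\<^sup>2 + 2 * Ec\<^sup>2 * Dir \<Omega> (\<tau> r) (\<tau> r)" for r
  let ?p = "\<lambda>t. ?d *\<^sub>R v t + Ec *\<^sub>R \<tau> t"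
  have H1int: "integrable (lebesgue_on {s..t}) (\<lambda>r. (H1_norm \<Omega> (v r))\<^sup>2)" if "0 \<le> s" for s t
    by (rule integrable_lebesgue_on_subset[of 0 "max t 1"])
      (use vH[of "max t 1"] that in \<open>auto simp: L2H10_def\<close>)
  have "evol v ?p (\<lambda>_. ?h) m Z"
    unfolding evol_def
  proof (intro conjI allI impI ballI)
    show "L.ncont v" by fact
    show "L.ncont ?p" by (intro L.ncont_add L.ncont_scale ncv nc\<tau>)
    show "L.ncont (\<lambda>_. ?h)" by (rule L.ncont_const) (simp add: hfun_L2)
    show "negligible Z" by fact
    show "m integrable_on {s..t}" if "0 \<le> s" for s t
    proof -
      have "(\<lambda>r. (H1_norm \<Omega> (v r))\<^sup>2) integrable_on {s..t}"
        using has_integral_integral_lebesgue_on[OF H1int[OF that]] by (auto simp: integrable_on_def)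
      then show ?thesis unfolding m_def using dr.ncont_integrable[OF nc\<tau>(2) nc\<tau>(2) that]
        by (intro integrable_add integrable_on_mult_right)
    qed
  next
    fix r :: real assume r: "r \<ge> 0" "r \<notin> Z"
    have V: "v r \<in> {u. H10 \<Omega> u}" "\<tau> r \<in> {u. H10 \<Omega> u}" using vV[OF r] \<tau>V[OF r(1)] by auto
    then show "?p r \<in> {u. H10 \<Omega> u}" by (intro dr.mem)
    have "0 \<le> Dir \<Omega> (?d *\<^sub>R v r - Ec *\<^sub>R \<tau> r) (?d *\<^sub>R v r - Ec *\<^sub>R \<tau> r)" using V by (intro dr.nonneg dr.mem)
    moreover have "Dir \<Omega> (?p r) (?p r) + Dir \<Omega> (?d *\<^sub>R v r - Ec *\<^sub>R \<tau> r) (?d *\<^sub>R v r - Ec *\<^sub>R \<tau> r)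
        = 2 * ?d\<^sup>2 * Dir \<Omega> (v r) (v r) + 2 * Ec\<^sup>2 * Dir \<Omega> (\<tau> r) (\<tau> r)"
      using V dr.mem by (simp add: dr.bilin power2_eq_square algebra_simps)
    moreover have "2 * ?d\<^sup>2 * Dir \<Omega> (v r) (v r) \<le> 2 * ?d\<^sup>2 * (H1_norm \<Omega> (v r))\<^sup>2"
      using H1n[of "v r"] by (intro mult_left_mono) auto
    ultimately show "Dir \<Omega> (?p r) (?p r) \<le> m r" unfolding m_def by linarith
  next
    fix w and s t :: real assume w: "w \<in> {u. H10 \<Omega> u}" and st: "0 \<le> s \<and> s \<le> t"
    have Dv: "integrable (lebesgue_on {s..t}) (\<lambda>r. Dir \<Omega> (v r) w)"
    proof (rule Bochner_Integration.integrable_bound)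
      show "integrable (lebesgue_on {s..t}) (\<lambda>r. (H1_norm \<Omega> (v r))\<^sup>2 + Dir \<Omega> w w)"
        using H1int st continuous_imp_integrable_real[OF continuous_on_const]
        by (intro Bochner_Integration.integrable_add) auto
      have "(\<lambda>r. Dir \<Omega> (v r) w) \<in> borel_measurable (lebesgue_on {0..max t 1})"
        using vH[of "max t 1"] w by (auto simp: L2H10_def)
      then show "(\<lambda>r. Dir \<Omega> (v r) w) \<in> borel_measurable (lebesgue_on {s..t})"
        by (rule measurable_restrict_mono) (use st in auto)
      have "AE r in lebesgue. r \<notin> Z" using Z by (intro AE_not_in) (simp add: negligible_iff_null_sets)
      then have "AE r in lebesgue. r \<in> {s..t} \<longrightarrow> norm (Dir \<Omega> (v r) w) \<le> norm ((H1_norm \<Omega> (v r))\<^sup>2 + Dir \<Omega> w w)"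
      proof eventually_elim
        case (elim r)
        show ?case
        proof
          assume "r \<in> {s..t}"
          then have V: "v r \<in> {u. H10 \<Omega> u}" using vV[of r] elim st by auto
          have "\<bar>Dir \<Omega> (v r) w\<bar> \<le> dr.n (v r) * dr.n w" by (rule dr.cauchy_schwarz[OF V w])
          also have "\<dots> \<le> (dr.n (v r))\<^sup>2 + (dr.n w)\<^sup>2"
            using young_weighted[of 1 "dr.n w" "dr.n (v r)"] zero_le_power2[of "dr.n w"]
            unfolding mult.commute[of "dr.n (v r)"] by linarith
          also have "\<dots> \<le> (H1_norm \<Omega> (v r))\<^sup>2 + Dir \<Omega> w w"
            using H1n[of "v r"] dr.n_sq[OF V] dr.n_sq[OF w] by simp
          finally show "norm (Dir \<Omega> (v r) w) \<le> norm ((H1_norm \<Omega> (v r))\<^sup>2 + Dir \<Omega> w w)" by simp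
        qed
      qed
      then show "AE r in lebesgue_on {s..t}. norm (Dir \<Omega> (v r) w) \<le> norm ((H1_norm \<Omega> (v r))\<^sup>2 + Dir \<Omega> w w)"
        by (subst AE_restrict_space_iff) auto
    qed
    have D\<tau>: "integrable (lebesgue_on {s..t}) (\<lambda>r. Dir \<Omega> (\<tau> r) w)"
      by (rule continuous_imp_integrable_real)
        (use st in \<open>auto intro!: continuous_on_subset[OF dr.ncont_continuous_on1[OF nc\<tau>(2) dr.ncont_const[OF w]]]\<close>)
    have "integrable (lebesgue_on {s..t}) (\<lambda>r. - ?d * Dir \<Omega> (v r) w - Ec * Dir \<Omega> (\<tau> r) w + L2_inner \<Omega> ?h w)"
      using Dv D\<tau> continuous_imp_integrable_real[OF continuous_on_const]
      by (intro Bochner_Integration.integrable_add Bochner_Integration.integrable_diff integrable_mult_right) auto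
    from has_integral_integral_lebesgue_on[OF this]
    have I: "((\<lambda>r. - ?d * Dir \<Omega> (v r) w - Ec * Dir \<Omega> (\<tau> r) w + L2_inner \<Omega> ?h w) has_integral
        (L2_inner \<Omega> (v t) w - L2_inner \<Omega> (v s) w)) {s..t}"
      using veq[of w s t] w st by simp
    show "((\<lambda>r. - Dir \<Omega> (?p r) w + L2_inner \<Omega> ?h w) has_integral (L2_inner \<Omega> (v t) w - L2_inner \<Omega> (v s) w)) {s..t}"
    proof (rule has_integral_spike[OF Z _ I])
      fix r assume "r \<in> {s..t} - Z"
      then have V: "v r \<in> {u. H10 \<Omega> u}" "\<tau> r \<in> {u. H10 \<Omega> u}" using vV[of r] \<tau>V[of r] st by auto
      then show "- Dir \<Omega> (?p r) w + L2_inner \<Omega> ?h w = - ?d * Dir \<Omega> (v r) w - Ec * Dir \<Omega> (\<tau> r) w + L2_inner \<Omega> ?h w"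
        using w dr.mem by (simp add: dr.bilin algebra_simps)
    qed
  qed
  moreover have "((\<lambda>r. L2_inner \<Omega> (\<Gamma> (v r) (\<tau> r)) w) has_integral (L2_inner \<Omega> (\<tau> t) w - L2_inner \<Omega> (\<tau> s) w)) {s..t}"
    if w: "w \<in> {u. H10 \<Omega> u}" and st: "0 \<le> s" "s \<le> t" for w s t
  proof -
    have "w \<in> {u. L2 \<Omega> u}" using w H10_L2 by simp
    then have "continuous_on {0..} (\<lambda>r. L2_inner \<Omega> (\<Gamma> (v r) (\<tau> r)) w)"
      by (intro L.ncont_continuous_on1 ncont_\<Gamma> ncv nc\<tau> L.ncont_const)
    then have "integrable (lebesgue_on {s..t}) (\<lambda>r. L2_inner \<Omega> (\<Gamma> (v r) (\<tau> r)) w)"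
      using st by (intro continuous_imp_integrable_real) (auto intro: continuous_on_subset)
    from has_integral_integral_lebesgue_on[OF this] show ?thesis
      using \<tau>eq[of w s t] w st by simp
  qed
  ultimately show ?thesis
    unfolding sol_def using nc\<tau> \<tau>V by auto
qed

end

theorem theorem4p10:
  fixes \<Omega> :: "'a::euclidean_space set"
    and D Ec \<mu> \<nu> \<beta>R \<beta>G \<beta>inf p0 :: real
    and \<beta>0 :: "real \<Rightarrow> real \<Rightarrow> real"
    and \<phi> \<psi> :: "'a \<Rightarrow> real"
    and S :: "real \<Rightarrow> ('a \<Rightarrow> real) \<times> ('a \<Rightarrow> real) \<Rightarrow> ('a \<Rightarrow> real) \<times> ('a \<Rightarrow> real)"
  assumes "bounded \<Omega>" and "open \<Omega>"
    and "p0 > 2" and "X_sub_W1p p0 \<Omega>"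
    and "D > 0" and "Ec > 0" and "\<mu> > 0" and "\<nu> > 0"
    and "C2_on_closure UNIV (\<lambda>p. \<beta>0 (fst p) (snd p))"
    and "\<beta>G > 0" and "\<beta>R \<ge> \<beta>G" and "\<forall>u \<sigma>. \<beta>G \<le> \<beta>0 u \<sigma> \<and> \<beta>0 u \<sigma> \<le> \<beta>R"
    and "\<beta>inf \<ge> \<beta>G" and "\<exists>R. \<forall>u \<sigma>. \<bar>u\<bar> + \<bar>\<sigma>\<bar> \<ge> R \<longrightarrow> \<beta>0 u \<sigma> = \<beta>inf"
    and "C2_on_closure \<Omega> \<phi>" and "C2_on_closure \<Omega> \<psi>"
    and "\<forall>x\<in>frontier \<Omega>. \<beta>0 (\<phi> x) (\<psi> x) * \<psi> x = \<mu> * \<phi> x"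
    and unique: "\<forall>v1 \<tau>1 v2 \<tau>2.
        weak_solution \<Omega> D Ec \<mu> \<nu> \<beta>0 \<phi> \<psi> v1 \<tau>1 \<and> weak_solution \<Omega> D Ec \<mu> \<nu> \<beta>0 \<phi> \<psi> v2 \<tau>2 \<and>
        L2_dist \<Omega> (v1 0) (v2 0) = 0 \<and> L2_dist \<Omega> (\<tau>1 0) (\<tau>2 0) = 0 \<longrightarrow>
        (\<forall>t\<ge>0. L2_dist \<Omega> (v1 t) (v2 t) = 0 \<and> L2_dist \<Omega> (\<tau>1 t) (\<tau>2 t) = 0)"
    and S_sol: "\<forall>y. inE \<Omega> y \<longrightarrow>
        weak_solution \<Omega> D Ec \<mu> \<nu> \<beta>0 \<phi> \<psi> (\<lambda>t. fst (S t y)) (\<lambda>t. snd (S t y)) \<and>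
        L2_dist \<Omega> (fst (S 0 y)) (fst y) = 0 \<and> L2_dist \<Omega> (snd (S 0 y)) (snd y) = 0"
  shows "(\<forall>y. inE \<Omega> y \<longrightarrow> E_dist \<Omega> (S 0 y) y = 0) \<and>
         (\<forall>y t s. inE \<Omega> y \<and> t \<ge> 0 \<and> s \<ge> 0 \<longrightarrow>
             inE \<Omega> (S s y) \<and> E_dist \<Omega> (S t (S s y)) (S (t + s) y) = 0) \<and>
         (\<forall>t0 y0. t0 \<ge> 0 \<and> inE \<Omega> y0 \<longrightarrow> (\<forall>\<epsilon>>0. \<exists>\<delta>>0. \<forall>t y. t \<ge> 0 \<and> inE \<Omega> y \<and>
             \<bar>t - t0\<bar> < \<delta> \<and> E_dist \<Omega> y y0 < \<delta> \<longrightarrow> E_dist \<Omega> (S t y) (S t0 y0) < \<epsilon>)) \<and>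
         (\<exists>P. (\<forall>p\<in>P. inE \<Omega> p) \<and> E_bounded \<Omega> P \<and>
             (\<forall>B. (\<forall>y\<in>B. inE \<Omega> y) \<and> E_bounded \<Omega> B \<longrightarrow>
                 (\<exists>h\<ge>0. \<forall>t\<ge>h. \<forall>y\<in>B. S t y \<in> P)))"
proof -
  interpret diffusion_problem \<Omega> D Ec \<mu> \<nu> \<beta>G \<beta>inf \<beta>0 \<phi> \<psi>
    using assms by unfold_locales auto
  obtain lam K C where cs: "coupled_system {u. L2 \<Omega> u} {u. H10 \<Omega> u} (L2_inner \<Omega>) (Dir \<Omega>) lam
    (D + \<nu> * Ec) Ec (hfun D Ec \<phi> \<psi>) \<Gamma> K (\<mu> - \<nu> * \<beta>inf) \<beta>inf C"
    using coupled_system_exists by blast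
  interpret coupled_system "{u. L2 \<Omega> u}" "{u. H10 \<Omega> u}" "L2_inner \<Omega>" "Dir \<Omega>" lam
      "D + \<nu> * Ec" Ec "hfun D Ec \<phi> \<psi>" \<Gamma> K "\<mu> - \<nu> * \<beta>inf" \<beta>inf C by (rule cs)
  have dist: "L2_dist \<Omega> u w = n (u - w)" for u w
    by (simp add: L2_dist_def L2_norm_eq fun_diff_def)
  have ws: "weak_solution \<Omega> D Ec \<mu> \<nu> \<beta>0 \<phi> \<psi> (\<lambda>t. fst (S t y)) (\<lambda>t. snd (S t y))"
    and init: "n (fst (S 0 y) - fst y) = 0" "n (snd (S 0 y) - snd y) = 0" if "inE \<Omega> y" for y
    using S_sol[rule_format, OF that] by (simp_all add: dist)
  have sl: "sol (\<lambda>t. fst (S t y)) (\<lambda>t. snd (S t y))" if "inE \<Omega> y" for y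
    by (rule weak_solution_imp_sol[OF cs ws[OF that]])
  have inES: "inE \<Omega> (S t y)" if "inE \<Omega> y" "t \<ge> 0" for t y
    using ws[OF that(1)] that(2) unfolding weak_solution_def inE_def by blast
  have mem: "fst y \<in> {u. L2 \<Omega> u}" "snd y \<in> {u. L2 \<Omega> u}" if "inE \<Omega> y" for y
    using that H10_L2 by (auto simp: inE_def)
  have ED: "E_dist \<Omega> y z = sqrt ((n (fst y - fst z))\<^sup>2 + (n (snd y - snd z))\<^sup>2)" for y z
    by (simp add: E_dist_def dist)
  have near: "n (u0 - w0) \<le> n (u - w)"
    if "n (u0 - u) = 0" "n (w0 - w) = 0" "u \<in> {u. L2 \<Omega> u}" "u0 \<in> {u. L2 \<Omega> u}" "w \<in> {u. L2 \<Omega> u}" "w0 \<in> {u. L2 \<Omega> u}"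
    for u u0 w w0 :: "'a \<Rightarrow> real"
    using L.n_triangle3[OF that(4,6,3)] L.n_triangle3[OF that(3,6,5)] L.n_diff_commute[OF that(5,6)] that(1,2) by linarith
  have init_dist: "(n (fst (S 0 y) - fst (S 0 y0)))\<^sup>2 + (n (snd (S 0 y) - snd (S 0 y0)))\<^sup>2 \<le> (E_dist \<Omega> y y0)\<^sup>2"
    if y: "inE \<Omega> y" and y0: "inE \<Omega> y0" for y y0
  proof -
    note m = mem[OF y] mem[OF y0] mem[OF inES[OF y order_refl]] mem[OF inES[OF y0 order_refl]]
    have "(n (fst (S 0 y) - fst (S 0 y0)))\<^sup>2 \<le> (n (fst y - fst y0))\<^sup>2"
      using m by (intro power_mono near init y y0 L.n_nonneg L.diff_mem)
    moreover have "(n (snd (S 0 y) - snd (S 0 y0)))\<^sup>2 \<le> (n (snd y - snd y0))\<^sup>2"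
      using m by (intro power_mono near init y y0 L.n_nonneg L.diff_mem)
    ultimately show ?thesis by (simp add: ED)
  qed
  define A where "A t = (2 + 2 * e\<^sup>2)\<^sup>2 * exp (4 * (1 + e)\<^sup>2 * K * t)" for t
  have A0: "A t \<ge> 0" for t by (simp add: A_def)

  have semigroup: "E_dist \<Omega> (S t (S s y)) (S (t + s) y) = 0" if y: "inE \<Omega> y" and ts: "t \<ge> 0" "s \<ge> 0" for y t s
  proof -
    note ys = inES[OF y ts(2)]
    have "(n (fst (S t (S s y)) - fst (S (t + s) y)))\<^sup>2 + (n (snd (S t (S s y)) - snd (S (t + s) y)))\<^sup>2
        \<le> A t * ((n (fst (S 0 (S s y)) - fst (S (0 + s) y)))\<^sup>2 + (n (snd (S 0 (S s y)) - snd (S (0 + s) y)))\<^sup>2)"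
      unfolding A_def by (rule lipschitz_dependence[OF sl[OF ys] sol_shift[OF sl[OF y] ts(2)] ts(1)])
    also have "\<dots> = 0" using init[OF ys] by simp
    finally have "(n (fst (S t (S s y)) - fst (S (t + s) y)))\<^sup>2 + (n (snd (S t (S s y)) - snd (S (t + s) y)))\<^sup>2 = 0"
      by (smt (verit) zero_le_power2)
    then show ?thesis by (simp add: ED)
  qed

  have continuity: "\<exists>\<delta>>0. \<forall>t y. t \<ge> 0 \<and> inE \<Omega> y \<and> \<bar>t - t0\<bar> < \<delta> \<and> E_dist \<Omega> y y0 < \<delta> \<longrightarrow> E_dist \<Omega> (S t y) (S t0 y0) < \<epsilon>"
    if t0: "t0 \<ge> 0" and y0: "inE \<Omega> y0" and \<epsilon>: "\<epsilon> > 0" for t0 y0 \<epsilon>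
  proof -
    define a where "a = sqrt (A (t0 + 1))"
    have a: "a \<ge> 0" by (simp add: a_def A0)
    note nc = sol_ncont[OF sl[OF y0]]
    have "((\<lambda>t. n (fst (S t y0) - fst (S t0 y0))) \<longlongrightarrow> 0) (at t0 within {0..})"
      "((\<lambda>t. n (snd (S t y0) - snd (S t0 y0))) \<longlongrightarrow> 0) (at t0 within {0..})"
      using nc t0 unfolding L.ncont_def by auto
    from this[THEN tendstoD, of "\<epsilon> / 4"]
    have "\<forall>\<^sub>F t in at t0 within {0..}. \<bar>n (fst (S t y0) - fst (S t0 y0))\<bar> < \<epsilon> / 4 \<and> \<bar>n (snd (S t y0) - snd (S t0 y0))\<bar> < \<epsilon> / 4"
      using \<epsilon> by (simp add: eventually_conj)
    then obtain \<delta>1 where \<delta>1: "\<delta>1 > 0" "\<And>t. t \<ge> 0 \<Longrightarrow> t \<noteq> t0 \<Longrightarrow> \<bar>t - t0\<bar> < \<delta>1 \<Longrightarrow>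
        \<bar>n (fst (S t y0) - fst (S t0 y0))\<bar> < \<epsilon> / 4 \<and> \<bar>n (snd (S t y0) - snd (S t0 y0))\<bar> < \<epsilon> / 4"
      unfolding eventually_at by (auto simp: dist_real_def)
    define \<delta> where "\<delta> = min (min 1 \<delta>1) (\<epsilon> / (4 * (a + 1)))"
    have \<delta>: "\<delta> > 0" using \<delta>1 \<epsilon> a by (simp add: \<delta>_def)
    have "E_dist \<Omega> (S t y) (S t0 y0) < \<epsilon>"
      if t: "t \<ge> 0" "\<bar>t - t0\<bar> < \<delta>" and y: "inE \<Omega> y" "E_dist \<Omega> y y0 < \<delta>" for t y
    proof -
      have small: "n (fst (S t y0) - fst (S t0 y0)) < \<epsilon> / 4" "n (snd (S t y0) - snd (S t0 y0)) < \<epsilon> / 4"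
        using \<delta>1(2)[of t] t \<epsilon> by (cases "t = t0"; auto simp: \<delta>_def)+
      note m = mem[OF inES[OF y(1) t(1)]] mem[OF inES[OF y0 t(1)]] mem[OF inES[OF y0 t0]]
      have "(n (fst (S t y) - fst (S t y0)))\<^sup>2 + (n (snd (S t y) - snd (S t y0)))\<^sup>2
          \<le> A t * ((n (fst (S 0 y) - fst (S 0 y0)))\<^sup>2 + (n (snd (S 0 y) - snd (S 0 y0)))\<^sup>2)"
        unfolding A_def by (rule lipschitz_dependence[OF sl[OF y(1)] sl[OF y0] t(1)])
      also have "\<dots> \<le> A (t0 + 1) * (E_dist \<Omega> y y0)\<^sup>2"
      proof (rule mult_mono[OF _ init_dist[OF y(1) y0]])
        have "t \<le> t0 + 1" using t by (auto simp: \<delta>_def)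
        then have "4 * (1 + e)\<^sup>2 * K * t \<le> 4 * (1 + e)\<^sup>2 * K * (t0 + 1)"
          using coupled_system.K[OF cs] by (intro mult_left_mono) auto
        then show "A t \<le> A (t0 + 1)" unfolding A_def by (intro mult_left_mono) auto
      qed (auto simp: A0)
      also have "\<dots> = (a * E_dist \<Omega> y y0)\<^sup>2" by (simp add: a_def power_mult_distrib A0)
      finally have sq: "(n (fst (S t y) - fst (S t y0)))\<^sup>2 + (n (snd (S t y) - snd (S t y0)))\<^sup>2 \<le> (a * E_dist \<Omega> y y0)\<^sup>2" .
      have E0: "0 \<le> a * E_dist \<Omega> y y0" using a by (simp add: ED)
      have "n (fst (S t y) - fst (S t y0)) \<le> a * E_dist \<Omega> y y0"
        by (rule power2_le_imp_le[OF _ E0]) (use sq zero_le_power2[of "n (snd (S t y) - snd (S t y0))"] in linarith)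
      moreover have "n (snd (S t y) - snd (S t y0)) \<le> a * E_dist \<Omega> y y0"
        by (rule power2_le_imp_le[OF _ E0]) (use sq zero_le_power2[of "n (fst (S t y) - fst (S t y0))"] in linarith)
      moreover have "a * E_dist \<Omega> y y0 < \<epsilon> / 4"
      proof -
        have "a * E_dist \<Omega> y y0 \<le> a * (\<epsilon> / (4 * (a + 1)))"
          using y(2) a by (intro mult_left_mono) (auto simp: \<delta>_def)
        also have "\<dots> < \<epsilon> / 4" using a \<epsilon> by (simp add: field_simps)
        finally show ?thesis .
      qed
      ultimately have b: "n (fst (S t y) - fst (S t0 y0)) < \<epsilon> / 2" "n (snd (S t y) - snd (S t0 y0)) < \<epsilon> / 2"
        using small L.n_triangle3[OF m(1,5,3)] L.n_triangle3[OF m(2,6,4)] by linarith+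
      have "E_dist \<Omega> (S t y) (S t0 y0) \<le> \<bar>n (fst (S t y) - fst (S t0 y0))\<bar> + \<bar>n (snd (S t y) - snd (S t0 y0))\<bar>"
        unfolding ED by (rule sqrt_sum_squares_le_sum_abs)
      also have "\<dots> < \<epsilon>"
        using b L.n_nonneg[OF L.diff_mem[OF m(1,5)]] L.n_nonneg[OF L.diff_mem[OF m(2,6)]] by linarith
      finally show ?thesis .
    qed
    with \<delta> show ?thesis by blast
  qed

  obtain \<rho> where \<rho>: "\<And>R. \<exists>T\<ge>0. \<forall>v \<tau>. sol v \<tau> \<and> (n (v 0))\<^sup>2 + (n (\<tau> 0))\<^sup>2 \<le> R \<longrightarrow>
    (\<forall>t\<ge>T. (n (v t))\<^sup>2 + (n (\<tau> t))\<^sup>2 \<le> \<rho>)" using absorption by blast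
  define P where "P = {p. inE \<Omega> p \<and> (n (fst p))\<^sup>2 + (n (snd p))\<^sup>2 \<le> \<rho>}"
  have E00: "E_dist \<Omega> p (\<lambda>x. 0, \<lambda>x. 0) = sqrt ((n (fst p))\<^sup>2 + (n (snd p))\<^sup>2)" for p
    by (simp add: E_dist_def L2_dist_def L2_norm_eq)
  have Pb: "E_bounded \<Omega> P"
    unfolding E_bounded_def E00 by (rule exI[of _ "sqrt \<rho>"]) (auto simp: P_def)
  have absorb: "\<exists>h\<ge>0. \<forall>t\<ge>h. \<forall>y\<in>B. S t y \<in> P" if B: "\<forall>y\<in>B. inE \<Omega> y" "E_bounded \<Omega> B" for B
  proof -
    obtain R where R: "\<And>y. y \<in> B \<Longrightarrow> sqrt ((n (fst y))\<^sup>2 + (n (snd y))\<^sup>2) \<le> R"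
      using B(2) unfolding E_bounded_def E00 by blast
    obtain T where T: "T \<ge> 0" "\<And>v \<tau> t. sol v \<tau> \<Longrightarrow> (n (v 0))\<^sup>2 + (n (\<tau> 0))\<^sup>2 \<le> R\<^sup>2 \<Longrightarrow> t \<ge> T \<Longrightarrow>
        (n (v t))\<^sup>2 + (n (\<tau> t))\<^sup>2 \<le> \<rho>" using \<rho>[of "R\<^sup>2"] by blast
    have "S t y \<in> P" if t: "t \<ge> T" and y: "y \<in> B" for t y
    proof -
      have yE: "inE \<Omega> y" using B(1) y by blast
      note m = mem[OF yE] mem[OF inES[OF yE order_refl]]
      have "n (fst (S 0 y)) \<le> n (fst y)" "n (snd (S 0 y)) \<le> n (snd y)"
        using L.n_le_add_diff[OF m(3,1)] L.n_le_add_diff[OF m(4,2)] init[OF yE] by auto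
      then have "(n (fst (S 0 y)))\<^sup>2 + (n (snd (S 0 y)))\<^sup>2 \<le> (n (fst y))\<^sup>2 + (n (snd y))\<^sup>2"
        using m by (intro add_mono power_mono L.n_nonneg)
      also have "\<dots> = (sqrt ((n (fst y))\<^sup>2 + (n (snd y))\<^sup>2))\<^sup>2" by simp
      also have "\<dots> \<le> R\<^sup>2" by (rule power_mono[OF R[OF y]]) simp
      finally have "(n (fst (S t y)))\<^sup>2 + (n (snd (S t y)))\<^sup>2 \<le> \<rho>" by (rule T(2)[OF sl[OF yE] _ t])
      then show ?thesis using inES[OF yE] t T(1) by (simp add: P_def)
    qed
    then show ?thesis using T(1) by blast
  qed
  have "\<exists>P. (\<forall>p\<in>P. inE \<Omega> p) \<and> E_bounded \<Omega> P \<and>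
      (\<forall>B. (\<forall>y\<in>B. inE \<Omega> y) \<and> E_bounded \<Omega> B \<longrightarrow> (\<exists>h\<ge>0. \<forall>t\<ge>h. \<forall>y\<in>B. S t y \<in> P))"
    using Pb absorb by (intro exI[of _ P]) (simp add: P_def)
  moreover have "\<forall>y. inE \<Omega> y \<longrightarrow> E_dist \<Omega> (S 0 y) y = 0"
    using init by (simp add: ED)
  moreover have "\<forall>y t s. inE \<Omega> y \<and> t \<ge> 0 \<and> s \<ge> 0 \<longrightarrow> inE \<Omega> (S s y) \<and> E_dist \<Omega> (S t (S s y)) (S (t + s) y) = 0"
    using inES semigroup by simp
  moreover have "\<forall>t0 y0. t0 \<ge> 0 \<and> inE \<Omega> y0 \<longrightarrow> (\<forall>\<epsilon>>0. \<exists>\<delta>>0. \<forall>t y. t \<ge> 0 \<and> inE \<Omega> y \<and>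
      \<bar>t - t0\<bar> < \<delta> \<and> E_dist \<Omega> y y0 < \<delta> \<longrightarrow> E_dist \<Omega> (S t y) (S t0 y0) < \<epsilon>)"
    using continuity by simp
  ultimately show ?thesis by (intro conjI)
qed

end
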